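(* For any $\sigma>0$, any $d\in\mathbb N$ and any $p>\frac{4(d+2)}{d}$, there exists a constant $C$ independent of $N$ (it may depend on $\sigma,d,p$) such that for all $N\in\mathbb N$ and all $f\in L^{p'}(\mathbb T^{d+1})$, $$\sum_{\mathbf n\in\mathbb Z^d} e^{-\frac{\sigma|\mathbf n|^2}{N^2}}\left|\widehat f(\mathbf n,|\mathbf n|^2)\right|^2\le C\,N^{d-\frac{2(d+2)}{p}}\,\|f\|_{p'}^2 .$$
   Context: $\mathbb T=\mathbb R/\mathbb Z$ with normalized Lebesgue measure; $\mathbb N=\{1,2,\dots\}$. $p'=p/(p-1)$ is the conjugate exponent and $\|\cdot\|_{p'}$ is the norm of $L^{p'}(\mathbb T^{d+1})$. For $\mathbf n=(n_1,\dots,n_d)\in\mathbb Z^d$, $|\mathbf n|^2=n_1^2+\cdots+n_d^2$. $\widehat f$ denotes the Fourier coefficients on $\mathbb T^{d+1}$: $\widehat f(\mathbf n,n_{d+1})=\int_{\mathbb T^{d}\times\mathbb T} f(\mathbf x,t)e^{-2\pi i(\mathbf n\cdot\mathbf x+n_{d+1}t)}\,d\mathbf x\,dt$. *)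

theory Defs
  imports "HOL-Analysis.Analysis"
begin

text \<open>
  A function on the torus $\mathbb T^{d+1} = \mathbb T^d \times \mathbb T$, with \<open>d = CARD('d)\<close>,
  is a function on $\mathbb R^d \times \mathbb R$ that is 1-periodic in each coordinate.
  Normalized Lebesgue measure on the torus is Lebesgue measure on the fundamental domain
  $[0,1)^d \times [0,1)$.
\<close>

definition int_vec :: "int ^ 'd \<Rightarrow> real ^ 'd" where
  "int_vec n = (\<chi> i. of_int (n $ i))"

definition torus_periodic :: "((real ^ 'd) \<times> real \<Rightarrow> 'a) \<Rightarrow> bool" where
  "torus_periodic f \<longleftrightarrow>
     (\<forall>x t. \<forall>(k :: int ^ 'd) (m :: int). f (x + int_vec k, t + of_int m) = f (x, t))"

definition torus_measure :: "((real ^ 'd) \<times> real) measure" where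
  "torus_measure =
     lebesgue_on {(x, t). (\<forall>i. 0 \<le> x $ i \<and> x $ i < 1) \<and> 0 \<le> t \<and> t < 1}"

text \<open>
  Elements of $L^q(\mathbb T^{d+1})$ are represented by functions, not by classes modulo equality
  almost everywhere; \<open>q\<close> is a finite exponent.
\<close>

definition Lq_torus :: "real \<Rightarrow> ((real ^ 'd) \<times> real \<Rightarrow> complex) set" where
  "Lq_torus q = {f. torus_periodic f \<and> f \<in> borel_measurable torus_measure \<and>
                    integrable torus_measure (\<lambda>z. norm (f z) powr q)}"

definition Lq_norm_torus :: "real \<Rightarrow> ((real ^ 'd) \<times> real \<Rightarrow> complex) \<Rightarrow> real" where
  "Lq_norm_torus q f = (LINT z|torus_measure. norm (f z) powr q) powr (1 / q)"

definition torus_fourier :: "((real ^ 'd) \<times> real \<Rightarrow> complex) \<Rightarrow> int ^ 'd \<Rightarrow> int \<Rightarrow> complex" where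
  "torus_fourier f n m =
     (LINT z|torus_measure.
        f z * exp (- (2 * of_real pi * \<i> * of_real (int_vec n \<bullet> fst z + of_int m * snd z))))"

definition sq_length :: "int ^ 'd \<Rightarrow> int" where
  "sq_length n = (\<Sum>i\<in>UNIV. (n $ i)\<^sup>2)"

definition conj_exponent :: "real \<Rightarrow> real" where
  "conj_exponent p = p / (p - 1)"

end

theory Submission
  imports Defs
begin

text \<open>
  Expanding $|\widehat f|^2$ and slicing in time turns the left-hand side into
  $\iint \langle K_{t-u} * f_t, f_u\rangle\,dt\,du$, where $K_t(x)$ is the product over the coordinates
  of the theta sums $\sum_n e^{-\sigma n^2/N^2} e^{2\pi i(n x_j + n^2 t)}$. At fixed times the form
  is bounded on $L^2$ by $1$ (Bessel) and on $L^1$ by $\kappa(t-u) = \sup_x |K_{t-u}(x)|$, hence on $L^{p'}$ by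
  a multiple of $\kappa(t-u)^{1-2/p}$; Young's inequality in time then leaves
  $\int \kappa^{p/2-1}$ to be estimated. Weyl differencing and a double summation by parts give
  $|\theta|^2 \lesssim N^2 / (q (1 + N^2 |2t - a/q|))$ when $a/q$ is a Dirichlet approximation of $2t$,
  without logarithmic loss. The sum of the $v$-th powers of these majorants over all $a/q$, with
  $v = d(p-2)/4$, has integral $O(N^{2v-2})$ because $v > 2$.
\<close>

section \<open>Distance to the nearest integer and Gaussian sums\<close>

text \<open>The obstacle is a logarithm. Weyl differencing with a single summation by parts bounds
  the differenced sum by min(N, 1/||y||), and summing that over h costs a factor log N. Gaussian
  weights can be differenced twice, and the inverse squares obtained in this way sum over the
  residues modulo q without a logarithm. The exponent v is forced. The interpolated bound at fixed
  times is a multiple of kappa^(1 - 2/p), Young's inequality measures it in L^(p/2), and kappa is at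
  most the majorant of |theta|^2 to the power d/2, up to a constant. So the majorant is integrated
  to the power (d/2)(p/2 - 1) = v. A denominator q brings about q numerators, each contributing
  q^(-v) up to powers of N, hence the condition v > 2, which reads p > 2 + 8/d. The power of N comes
  out as (2v - 2)(2/p) = d - 2(d + 2)/p. The Dirichlet fraction of 2t depends on t through a choice;
  summing the majorants over all fractions removes the choice and leaves a measurable
  function.\<close>

definition int_dist :: "real \<Rightarrow> real" where
  "int_dist y = \<bar>y - of_int (round y)\<bar>"

lemma int_dist_le: "int_dist y \<le> \<bar>y - of_int k\<bar>"
  unfolding int_dist_def by (rule round_diff_minimal)

lemma int_dist_nonneg: "0 \<le> int_dist y"
  by (simp add: int_dist_def)

lemma int_dist_le_half: "int_dist y \<le> 1/2"
  using of_int_round_abs_le[of y] by (simp add: int_dist_def abs_minus_commute)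

lemma int_dist_add_le: "int_dist (x + y) \<le> int_dist x + int_dist y"
  using int_dist_le[of "x + y" "round x + round y"] unfolding int_dist_def by simp

lemma int_dist_minus: "int_dist (- x) = int_dist x"
proof -
  have "int_dist (-x) \<le> int_dist x" for x
    using int_dist_le[of "-x" "- round x"] by (simp add: int_dist_def)
  from this[of x] this[of "-x"] show ?thesis by simp
qed

lemma int_dist_diff_le: "int_dist (x - y) \<le> int_dist x + int_dist y"
  using int_dist_add_le[of x "-y"] by (simp add: int_dist_minus)

lemma int_dist_add_of_int: "int_dist (x + of_int k) = int_dist x"
proof -
  have *: "int_dist (x + of_int k) \<le> int_dist x" for x k
    using int_dist_le[of "x + of_int k" "round x + k"] by (simp add: int_dist_def)
  from *[of x k] *[of "x + of_int k" "-k"] show ?thesis by simp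
qed

lemma int_dist_eq_abs: assumes "\<bar>x\<bar> \<le> 1/2" shows "int_dist x = \<bar>x\<bar>"
proof (rule antisym)
  show "int_dist x \<le> \<bar>x\<bar>" using int_dist_le[of x 0] by simp
  show "\<bar>x\<bar> \<le> int_dist x"
  proof (cases "round x = 0")
    case False
    then have "1 \<le> \<bar>real_of_int (round x)\<bar>"
      by linarith
    then show ?thesis using assms unfolding int_dist_def by linarith
  qed (simp add: int_dist_def)
qed

lemma sin_ge_half: assumes "0 \<le> x" "x \<le> pi/3" shows "x / 2 \<le> sin x"
proof -
  have "sin x - x/2 \<ge> sin 0 - 0/2"
  proof (rule DERIV_nonneg_imp_nondecreasing[OF assms(1)])
    fix y assume "0 \<le> y" "y \<le> x"
    then have "cos y \<ge> cos (pi/3)" using assms pi_gt_zero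
      by (intro cos_monotone_0_pi_le) linarith+
    then have "0 \<le> cos y - 1/2" by (simp add: cos_60)
    moreover have "((\<lambda>x. sin x - x/2) has_real_derivative (cos y - 1/2)) (at y)"
      by (auto intro!: derivative_eq_intros)
    ultimately show "\<exists>z. ((\<lambda>x. sin x - x/2) has_real_derivative z) (at y) \<and> 0 \<le> z" by blast
  qed
  then show ?thesis by simp
qed

text \<open>Up to pi/3 the linear bound of slope 1/2 already gives |z|, because pi >= 2; beyond, the
  sine is at least sin(pi/6) = 1/2, the largest value of |z|.\<close>

lemma abs_sin_pi_ge: assumes "\<bar>z\<bar> \<le> 1/2" shows "\<bar>z\<bar> \<le> \<bar>sin (pi * z)\<bar>"
proof -
  define u where "u = pi * \<bar>z\<bar>"
  have u: "0 \<le> u" "u \<le> pi/2" using assms by (auto simp: u_def field_simps)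
  have "\<bar>z\<bar> \<le> sin u"
  proof (cases "u \<le> pi/3")
    case True
    have "\<bar>z\<bar> \<le> u/2" using pi_gt3 assms mult_right_mono[of 2 pi "\<bar>z\<bar>"] by (simp add: u_def)
    then show ?thesis using sin_ge_half[OF u(1) True] by linarith
  next
    case False
    then have "sin (pi/6) \<le> sin u" using u
      by (intro sin_monotone_2pi_le) auto
    then show ?thesis using assms by (simp add: sin_30)
  qed
  also have "sin u \<le> \<bar>sin (pi * z)\<bar>" by (cases "z \<ge> 0") (auto simp: u_def abs_if)
  finally show ?thesis .
qed

text \<open>A double summation by parts produces the multiplier 4 sin^2(pi y); this bound lets
  \<open>int_dist\<close> take its place.\<close>

lemma int_dist_le_sin: "int_dist y \<le> \<bar>sin (pi * y)\<bar>"
proof -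
  define z where "z = y - of_int (round y)"
  have z: "\<bar>z\<bar> = int_dist y" by (simp add: z_def int_dist_def)
  have "sin (pi * y) = sin (pi * z + of_int (round y) * pi)" by (simp add: z_def algebra_simps)
  also have "\<dots> = sin (pi*z) * cos (of_int (round y) * pi)"
    by (simp add: sin_add mult.commute[of _ pi] sin_npi_int)
  also have "\<bar>\<dots>\<bar> = \<bar>sin (pi * z)\<bar>"
  proof -
    have "sin (of_int (round y) * pi) = 0" by (simp add: mult.commute[of _ pi] sin_npi_int)
    then have "(cos (of_int (round y) * pi))\<^sup>2 = 1"
      using sin_cos_squared_add[of "of_int (round y) * pi"] by simp
    then have "\<bar>cos (of_int (round y) * pi)\<bar> = 1" by (simp add: power2_eq_1_iff abs_if) (auto simp: abs_if)
    then show ?thesis by (simp add: abs_mult)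
  qed
  finally show ?thesis using abs_sin_pi_ge[of z] int_dist_le_half[of y] z by simp
qed

text \<open>Completing every block that meets A only adds nonnegative terms. Used with block length
  N for Gaussian weights and with length q for functions of a residue.\<close>

lemma sum_int_blocks_le:
  fixes f :: "int \<Rightarrow> real" and N :: int
  assumes "finite A" "N > 0" "\<And>m. 0 \<le> f m"
  shows "(\<Sum>m\<in>A. f m) \<le> (\<Sum>k\<in>(\<lambda>m. m div N) ` A. \<Sum>r\<in>{0..<N}. f (N * k + r))"
proof -
  define B where "B = (\<lambda>m. m div N) ` A \<times> {0..<N}"
  have fin: "finite B" using assms by (simp add: B_def)
  have inj: "inj_on (\<lambda>m. (m div N, m mod N)) A"
    by (rule inj_onI) (metis prod.inject mult_div_mod_eq)
  have "(\<Sum>m\<in>A. f m) = (\<Sum>z\<in>(\<lambda>m. (m div N, m mod N)) ` A. f (N * fst z + snd z))"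
    by (subst sum.reindex[OF inj]) simp
  also have "\<dots> \<le> (\<Sum>z\<in>B. f (N * fst z + snd z))"
    using fin assms by (intro sum_mono2) (auto simp: B_def)
  also have "\<dots> = (\<Sum>k\<in>(\<lambda>m. m div N) ` A. \<Sum>r\<in>{0..<N}. f (N * k + r))"
    unfolding B_def by (simp add: sum.cartesian_product case_prod_unfold)
  finally show ?thesis .
qed

lemma sum_geometric_inj_le:
  fixes r :: real and g :: "'a \<Rightarrow> nat"
  assumes "finite A" "inj_on g A" "0 \<le> r" "r < 1"
  shows "(\<Sum>k\<in>A. r ^ g k) \<le> 1 / (1 - r)"
proof -
  have "(\<Sum>k\<in>A. r ^ g k) = (\<Sum>k\<in>g ` A. r ^ k)"
    using assms by (simp add: sum.reindex)
  also have "\<dots> \<le> (\<Sum>k. r ^ k)"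
    using assms by (intro sum_le_suminf) auto
  also have "\<dots> = 1 / (1 - r)" using assms by (simp add: suminf_geometric)
  finally show ?thesis .
qed

text \<open>The bound must not depend on the shift z. On each side of -z, rounding |k + z| down to a
  natural number n is injective, and n <= n^2 compares the Gaussian with a geometric series.\<close>

lemma gauss_sum_le:
  fixes b z :: real and A :: "int set"
  assumes "finite A" "b > 0"
  shows "(\<Sum>k\<in>A. exp (- b * (of_int k + z)\<^sup>2)) \<le> 2 / (1 - exp (-b))"
proof -
  define r where "r = exp (-b)"
  have r: "0 \<le> r" "r < 1" using assms by (auto simp: r_def)
  define j where "j k = k + \<lfloor>z\<rfloor>" for k :: int
  define P where "P = {k\<in>A. j k \<ge> 0}"
  define Q where "Q = {k\<in>A. j k < 0}"
  have rp: "r ^ n = exp (- b * real n)" for n by (simp add: r_def exp_of_nat_mult[symmetric] mult.commute)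
  have sq: "real n \<le> (real n)\<^sup>2" for n
    by (cases n) (auto simp: power2_eq_square)
  have 1: "exp (- b * (of_int k + z)\<^sup>2) \<le> r ^ nat (j k)" if "k \<in> P" for k
  proof -
    have "real (nat (j k)) \<le> (real (nat (j k)))\<^sup>2" by (rule sq)
    also have "\<dots> \<le> (of_int k + z)\<^sup>2"
      using that by (intro power_mono; simp add: P_def j_def; linarith)
    finally show ?thesis unfolding rp using assms by simp
  qed
  \<comment> \<open>For negative \<open>j k\<close> the floor loses one: only |k + z| >= -
    \<open>j k\<close> - 1 is available.\<close>
  have 2: "exp (- b * (of_int k + z)\<^sup>2) \<le> r ^ nat (- j k - 1)" if "k \<in> Q" for k
  proof -
    have "real (nat (- j k - 1)) \<le> (real (nat (- j k - 1)))\<^sup>2" by (rule sq)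
    also have "\<dots> \<le> (- (of_int k + z))\<^sup>2"
      using that by (intro power_mono; simp add: Q_def j_def; linarith)
    also have "\<dots> = (of_int k + z)\<^sup>2" by (rule power2_minus)
    finally show ?thesis unfolding rp using assms by simp
  qed
  have "(\<Sum>k\<in>A. exp (- b * (of_int k + z)\<^sup>2)) =
        (\<Sum>k\<in>P. exp (- b * (of_int k + z)\<^sup>2)) + (\<Sum>k\<in>Q. exp (- b * (of_int k + z)\<^sup>2))"
    using assms unfolding P_def Q_def
    by (subst sum.union_disjoint[symmetric]) (auto intro!: sum.cong)
  also have "\<dots> \<le> (\<Sum>k\<in>P. r ^ nat (j k)) + (\<Sum>k\<in>Q. r ^ nat (- j k - 1))"
    by (intro add_mono sum_mono 1 2)
  also have "\<dots> \<le> 1 / (1 - r) + 1 / (1 - r)"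
    using assms r by (intro add_mono sum_geometric_inj_le) (auto simp: P_def Q_def inj_on_def j_def)
  finally show ?thesis by (simp add: r_def)
qed

text \<open>Along the residue class of r modulo N this is a Gaussian sum of unit scale with shift (r
  + y)/N; uniformity in the shift gives N equal bounds.\<close>

lemma gauss_sum_scaled_le:
  fixes b y :: real and A :: "int set" and N :: nat
  assumes "finite A" "b > 0" "N \<ge> 1"
  shows "(\<Sum>m\<in>A. exp (- b * (of_int m + y)\<^sup>2 / (real N)\<^sup>2)) \<le> real N * (2 / (1 - exp (-b)))"
proof -
  let ?f = "\<lambda>m::int. exp (- b * (of_int m + y)\<^sup>2 / (real N)\<^sup>2)"
  let ?B = "(\<lambda>m. m div int N) ` A"
  have "(\<Sum>m\<in>A. ?f m) \<le> (\<Sum>k\<in>?B. \<Sum>r\<in>{0..<int N}. ?f (int N * k + r))"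
    using assms by (intro sum_int_blocks_le) auto
  also have "\<dots> = (\<Sum>r\<in>{0..<int N}. \<Sum>k\<in>?B. exp (- b * (of_int k + (of_int r + y) / N)\<^sup>2))"
    using assms by (subst sum.swap) (intro sum.cong refl, simp add: field_simps power2_eq_square)
  also have "\<dots> \<le> (\<Sum>r\<in>{0..<int N}. 2 / (1 - exp (-b)))"
    using assms by (intro sum_mono gauss_sum_le) auto
  finally show ?thesis by simp
qed

lemma gauss_summable:
  fixes b y :: real and N :: nat
  assumes "b > 0" "N \<ge> 1"
  shows "(\<lambda>m::int. exp (- b * (of_int m + y)\<^sup>2 / (real N)\<^sup>2)) summable_on UNIV"
  using gauss_sum_scaled_le[OF _ assms]
  by (intro nonneg_bdd_above_summable_on bdd_aboveI2[of _ _ "real N * (2 / (1 - exp (-b)))"]) auto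

lemma gauss_infsum_le:
  fixes b y :: real and N :: nat
  assumes "b > 0" "N \<ge> 1"
  shows "(\<Sum>\<^sub>\<infinity>m::int. exp (- b * (of_int m + y)\<^sup>2 / (real N)\<^sup>2)) \<le> real N * (2 / (1 - exp (-b)))"
  using gauss_sum_scaled_le[OF _ assms] gauss_summable[OF assms]
  by (intro infsum_le_finite_sums) auto

section \<open>Summation by parts\<close>

definition echar :: "real \<Rightarrow> complex" where "echar y = cis (2 * pi * y)"

lemma echar_add: "echar (x + y) = echar x * echar y"
  by (simp add: echar_def cis_mult distrib_left)

lemma norm_echar [simp]: "norm (echar y) = 1"
  by (simp add: echar_def)

lemma echar_0 [simp]: "echar 0 = 1"
  by (simp add: echar_def)

lemma cnj_echar: "cnj (echar y) = echar (- y)"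
  by (simp add: echar_def cis_cnj)

lemma norm_echar_second_difference: "norm (echar y - 2 + echar (- y)) = 4 * (sin (pi * y))\<^sup>2"
proof -
  have "echar y - 2 + echar (- y) = of_real (2 * cos (2 * pi * y) - 2)"
    by (simp add: echar_def complex_eq_iff)
  also have "2 * cos (2 * pi * y) - 2 = - (4 * (sin (pi * y))\<^sup>2)"
    using cos_double_sin[of "pi * y"] by (simp add: algebra_simps)
  finally show ?thesis by (simp only: norm_of_real) simp
qed

text \<open>For z >= 0 the left side equals (1 - e^(-z))^2 e^z, which exhibits the quadratic
  vanishing at 0 that makes second differences small.\<close>

lemma exp_add_exp_minus_le:
  fixes z :: real
  shows "exp z + exp (- z) - 2 \<le> z\<^sup>2 * exp \<bar>z\<bar>"
proof -
  have *: "exp z + exp (- z) - 2 \<le> z\<^sup>2 * exp z" if "z \<ge> 0" for z :: real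
  proof -
    have "exp z + exp (- z) - 2 = (1 - exp (-z))\<^sup>2 * exp z"
      by (simp add: power2_eq_square ring_distribs exp_add[symmetric] mult.assoc)
    also have "\<dots> \<le> z\<^sup>2 * exp z"
    proof (intro mult_right_mono power_mono)
      show "1 - exp (-z) \<le> z" using exp_ge_add_one_self[of "-z"] by linarith
    qed (use that in auto)
    finally show ?thesis .
  qed
  from *[of z] *[of "-z"] show ?thesis by (cases "z \<ge> 0") (auto simp: add.commute)
qed

section \<open>Second differences of a product of two Gaussians\<close>

context
  fixes a s :: real and h :: int
  assumes a: "0 < a" "a \<le> s"
begin

text \<open>The amplitude of the differenced theta sum: the Gaussian weights at m and m + h, with a
  standing for s / N^2.\<close>

definition pairw :: "int \<Rightarrow> real" where
  "pairw m = exp (- a * ((of_int m)\<^sup>2 + (of_int (m + h))\<^sup>2))"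

text \<open>Completing the square separates the decay in h from a Gaussian in m centred at
  -h/2.\<close>

lemma pairw_eq: "pairw m = exp (- 2 * a * (of_int m + of_int h / 2)\<^sup>2) * exp (- a * (of_int h)\<^sup>2 / 2)"
  unfolding pairw_def exp_add[symmetric]
  by (rule arg_cong[where f = exp]) (simp add: field_simps power2_eq_square)

text \<open>A second difference gains a factor a, the inverse square of the width. The price is half
  of the exponent in m, 2a falling to a, which absorbs the factors y^2 and exp |4 a y|; the bound a
  <= s keeps the constants independent of N.\<close>

lemma pairw_second_difference_le:
  "\<bar>pairw (m + 1) - 2 * pairw m + pairw (m - 1)\<bar> \<le>
     (4 + 32 * exp (8 * s)) * a * (exp (- a * (of_int m + of_int h / 2)\<^sup>2) * exp (- a * (of_int h)\<^sup>2 / 2))"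
proof -
  define y :: real where "y = of_int m + of_int h / 2"
  define E where "E = exp (- a * (of_int h)\<^sup>2 / 2)"
  have E: "E > 0" by (simp add: E_def)
  have p: "pairw (m + 1) = pairw m * exp (-2*a) * exp (- 4*a*y)"
    unfolding pairw_def exp_add[symmetric] y_def
    by (rule arg_cong[where f = exp]) (simp add: field_simps power2_eq_square)
  have q: "pairw (m - 1) = pairw m * exp (-2*a) * exp (4*a*y)"
    unfolding pairw_def exp_add[symmetric] y_def
    by (rule arg_cong[where f = exp]) (simp add: field_simps power2_eq_square)
  have g: "pairw m = exp (- 2 * a * y\<^sup>2) * E" by (simp add: pairw_eq y_def E_def)
  \<comment> \<open>The second difference relative to \<open>pairw m\<close>, split into a
    nonnegative convexity term and the loss 2 (1 - exp (-2a)); each is bounded separately by a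
    multiple of a.\<close>
  define X where "X = exp (-2*a) * (exp (4*a*y) + exp (-(4*a*y)) - 2) - 2 * (1 - exp (-2*a))"
  have X: "pairw (m + 1) - 2 * pairw m + pairw (m - 1) = pairw m * X"
    unfolding p q X_def by (simp add: algebra_simps)
  have ay: "0 \<le> a * y\<^sup>2" using a by simp
  have b1: "2 * (1 - exp (-2*a)) \<le> 4 * a"
    using exp_ge_add_one_self[of "-2*a"] by (simp add: algebra_simps)
  have pos: "0 \<le> exp (4*a*y) + exp (-(4*a*y)) - 2"
  proof -
    have "exp (4*a*y) + exp (-(4*a*y)) - 2 = (exp (2*a*y) - exp (- (2*a*y)))\<^sup>2"
      by (simp add: power2_diff power2_eq_square exp_add[symmetric] algebra_simps)
    then show ?thesis by simp
  qed
  have b2: "exp (4*a*y) + exp (-(4*a*y)) - 2 \<le> 32 * exp (8 * s) * a * exp (a * y\<^sup>2)"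
  proof -
    have "\<bar>4*a*y\<bar> \<le> a * y\<^sup>2 / 2 + 8 * a"
    proof -
      \<comment> \<open>Expanded, this reads 4 a |y| <= a y^2 / 2 + 8 a.\<close>
      have "0 \<le> a * (\<bar>y\<bar> - 4)\<^sup>2" using a by simp
      then show ?thesis using a by (simp add: power2_diff abs_mult algebra_simps)
    qed
    also have "\<dots> \<le> a * y\<^sup>2 / 2 + 8 * s" using a by simp
    finally have e1: "exp \<bar>4*a*y\<bar> \<le> exp (a * y\<^sup>2 / 2) * exp (8 * s)" by (simp add: exp_add[symmetric])
    have "a * y\<^sup>2 / 2 \<le> exp (a * y\<^sup>2 / 2)" using exp_ge_add_one_self[of "a * y\<^sup>2 / 2"] by linarith
    then have e2: "(4*a*y)\<^sup>2 \<le> 32 * a * exp (a * y\<^sup>2 / 2)"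
      using a mult_left_mono[of "a * y\<^sup>2 / 2" "exp (a * y\<^sup>2 / 2)" "32 * a"] by (simp add: power2_eq_square algebra_simps)
    have "exp (4*a*y) + exp (-(4*a*y)) - 2 \<le> (4*a*y)\<^sup>2 * exp \<bar>4*a*y\<bar>" by (rule exp_add_exp_minus_le)
    also have "\<dots> \<le> (32 * a * exp (a * y\<^sup>2 / 2)) * (exp (a * y\<^sup>2 / 2) * exp (8 * s))"
      by (intro mult_mono e1 e2) (use a in auto)
    also have "\<dots> = 32 * exp (8 * s) * a * (exp (a * y\<^sup>2 / 2) * exp (a * y\<^sup>2 / 2))" by simp
    also have "exp (a * y\<^sup>2 / 2) * exp (a * y\<^sup>2 / 2) = exp (a * y\<^sup>2)" by (simp add: exp_add[symmetric])
    finally show ?thesis .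
  qed
  have ea: "exp (-2*a) \<le> 1" "1 - exp (-2*a) \<ge> 0" using a by auto
  have "\<bar>X\<bar> \<le> exp (-2*a) * (exp (4*a*y) + exp (-(4*a*y)) - 2) + 2 * (1 - exp (-2*a))"
    unfolding X_def using pos ea by (intro order.trans[OF abs_triangle_ineq4]) (auto simp: abs_mult)
  also have "\<dots> \<le> 1 * (32 * exp (8 * s) * a * exp (a * y\<^sup>2)) + 4 * a * exp (a*y\<^sup>2)"
  proof (rule add_mono)
    show "exp (-2*a) * (exp (4*a*y) + exp (-(4*a*y)) - 2) \<le> 1 * (32 * exp (8 * s) * a * exp (a * y\<^sup>2))"
      by (rule mult_mono) (use pos b2 ea in auto)
    have "4 * a * 1 \<le> 4 * a * exp (a*y\<^sup>2)" using a ay by (intro mult_left_mono) auto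
    then show "2 * (1 - exp (-2*a)) \<le> 4 * a * exp (a*y\<^sup>2)" using b1 by linarith
  qed
  also have "\<dots> = (4 + 32 * exp (8 * s)) * a * exp (a * y\<^sup>2)" by (simp add: algebra_simps)
  finally have "pairw m * \<bar>X\<bar> \<le> pairw m * ((4 + 32 * exp (8 * s)) * a * exp (a * y\<^sup>2))"
    by (intro mult_left_mono) (auto simp: pairw_def)
  also have "\<dots> = (4 + 32 * exp (8 * s)) * a * ((exp (- 2 * a * y\<^sup>2) * exp (a * y\<^sup>2)) * E)" by (simp add: g)
  also have "exp (- 2 * a * y\<^sup>2) * exp (a * y\<^sup>2) = exp (- a * y\<^sup>2)" by (simp add: exp_add[symmetric])
  finally show ?thesis unfolding X abs_mult by (simp add: E_def y_def pairw_def)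
qed

end

lemma infsum_int_shift:
  fixes f :: "int \<Rightarrow> 'a::banach"
  shows "(\<Sum>\<^sub>\<infinity>m. f (m + k)) = (\<Sum>\<^sub>\<infinity>m. f m)"
  by (rule infsum_reindex_bij_betw[of "\<lambda>m. m + k" UNIV UNIV f]) (auto intro!: bij_betwI[of _ _ _ "\<lambda>m. m - k"])

lemma summable_on_int_shift:
  fixes f :: "int \<Rightarrow> 'a::banach"
  assumes "f summable_on UNIV"
  shows "(\<lambda>m. f (m + k)) summable_on UNIV"
proof -
  have "bij (\<lambda>m::int. m + k)" by (rule bij_betwI[of _ _ _ "\<lambda>m. m - k"]) auto
  from summable_on_reindex_bij_betw[OF this, of f] assms show ?thesis by simp
qed

lemma abs_summable_echar:
  assumes "g summable_on UNIV" "\<And>m. 0 \<le> (g m :: real)"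
  shows "(\<lambda>m. of_real (g m) * echar (u m)) summable_on UNIV"
  by (rule abs_summable_summable) (use assms in \<open>simp add: norm_mult\<close>)

lemma norm_infsum_echar_le:
  assumes "g summable_on UNIV" "\<And>m. 0 \<le> (g m :: real)"
  shows "norm (\<Sum>\<^sub>\<infinity>m. of_real (g m) * echar (u m)) \<le> (\<Sum>\<^sub>\<infinity>m. g m)"
proof -
  have "norm (\<Sum>\<^sub>\<infinity>m. of_real (g m) * echar (u m)) \<le> (\<Sum>\<^sub>\<infinity>m. norm (of_real (g m) * echar (u m)))"
    by (rule norm_infsum_bound) (use assms in \<open>simp add: norm_mult\<close>)
  then show ?thesis using assms by (simp add: norm_mult)
qed

text \<open>Two summations by parts at once: multiplying the sum by
  \<open>echar \<alpha> - 2 + echar (- \<alpha>)\<close> and shifting the index moves the second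
  difference onto g, and this multiplier has modulus 4 sin^2(pi \<alpha>).\<close>

lemma second_difference_infsum:
  fixes g :: "int \<Rightarrow> real"
  assumes "g summable_on UNIV" "\<And>m. 0 \<le> g m"
    and D: "(\<lambda>m. \<bar>g (m + 1) - 2 * g m + g (m - 1)\<bar>) summable_on UNIV"
  shows "4 * (sin (pi * \<alpha>))\<^sup>2 * norm (\<Sum>\<^sub>\<infinity>m. of_real (g m) * echar (of_int m * \<alpha>))
           \<le> (\<Sum>\<^sub>\<infinity>m. \<bar>g (m + 1) - 2 * g m + g (m - 1)\<bar>)"
proof -
  define I where "I = (\<Sum>\<^sub>\<infinity>m. of_real (g m) * echar (of_int m * \<alpha>))"
  let ?F = "\<lambda>m. of_real (g m) * echar (of_int m * \<alpha>)"
  have s: "?F summable_on UNIV" by (rule abs_summable_echar) fact+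
  have s1: "(\<lambda>m. of_real (g (m - 1)) * echar (of_int m * \<alpha>)) summable_on UNIV"
    using summable_on_int_shift[OF assms(1), of "-1"] assms by (intro abs_summable_echar) auto
  have s2: "(\<lambda>m. of_real (g (m + 1)) * echar (of_int m * \<alpha>)) summable_on UNIV"
    using summable_on_int_shift[OF assms(1), of "1"] assms by (intro abs_summable_echar) auto
  have e1: "echar \<alpha> * I = (\<Sum>\<^sub>\<infinity>m. of_real (g (m - 1)) * echar (of_int m * \<alpha>))"
  proof -
    have "echar \<alpha> * I = (\<Sum>\<^sub>\<infinity>m. echar \<alpha> * ?F m)" unfolding I_def by (rule infsum_cmult_right'[symmetric])
    also have "\<dots> = (\<Sum>\<^sub>\<infinity>m. of_real (g ((m + 1) - 1)) * echar (of_int (m + 1) * \<alpha>))"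
      by (rule infsum_cong) (simp add: ring_distribs echar_add)
    also have "\<dots> = (\<Sum>\<^sub>\<infinity>m. of_real (g (m - 1)) * echar (of_int m * \<alpha>))"
      by (rule infsum_int_shift[where f = "\<lambda>m. of_real (g (m - 1)) * echar (of_int m * \<alpha>)"])
    finally show ?thesis .
  qed
  have e2: "echar (- \<alpha>) * I = (\<Sum>\<^sub>\<infinity>m. of_real (g (m + 1)) * echar (of_int m * \<alpha>))"
  proof -
    have "echar (-\<alpha>) * I = (\<Sum>\<^sub>\<infinity>m. echar (-\<alpha>) * ?F m)" unfolding I_def by (rule infsum_cmult_right'[symmetric])
    also have "\<dots> = (\<Sum>\<^sub>\<infinity>m. of_real (g ((m + (-1)) + 1)) * echar (of_int (m + (-1)) * \<alpha>))"
      by (rule infsum_cong) (simp add: left_diff_distrib echar_add[symmetric])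
    also have "\<dots> = (\<Sum>\<^sub>\<infinity>m. of_real (g (m + 1)) * echar (of_int m * \<alpha>))"
      by (rule infsum_int_shift[where f = "\<lambda>m. of_real (g (m + 1)) * echar (of_int m * \<alpha>)"])
    finally show ?thesis .
  qed
  have "(echar \<alpha> - 2 + echar (-\<alpha>)) * I = echar \<alpha> * I + echar (-\<alpha>) * I + (-2) * I" by (simp add: algebra_simps)
  also have "(-2) * I = (\<Sum>\<^sub>\<infinity>m. (-2) * ?F m)" unfolding I_def by (rule infsum_cmult_right'[symmetric])
  also have "echar \<alpha> * I + echar (-\<alpha>) * I + (\<Sum>\<^sub>\<infinity>m. (-2) * ?F m) =
     (\<Sum>\<^sub>\<infinity>m. of_real (g (m - 1)) * echar (of_int m * \<alpha>) + of_real (g (m + 1)) * echar (of_int m * \<alpha>) + (-2) * ?F m)"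
    unfolding e1 e2
    by (subst infsum_add[symmetric] | intro summable_on_add summable_on_cmult_right s s1 s2 refl)+
  also have "\<dots> = (\<Sum>\<^sub>\<infinity>m. of_real (g (m + 1) - 2 * g m + g (m - 1)) * echar (of_int m * \<alpha>))"
    by (rule infsum_cong) (simp add: algebra_simps)
  finally have "norm ((echar \<alpha> - 2 + echar (-\<alpha>)) * I) \<le> (\<Sum>\<^sub>\<infinity>m. norm (of_real (g (m + 1) - 2 * g m + g (m - 1)) * echar (of_int m * \<alpha>)))"
    using norm_infsum_bound[of "\<lambda>m. of_real (g (m + 1) - 2 * g m + g (m - 1)) * echar (of_int m * \<alpha>)" UNIV] D
    by (simp del: of_real_add of_real_diff add: norm_mult)
  then show ?thesis unfolding I_def[symmetric]
    by (simp add: norm_mult norm_echar_second_difference del: of_real_add of_real_diff)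
qed

text \<open>A stand-in for $\min(N, 1/(N\,\|y\|^2))$ without the junk value of the quotient at integers.\<close>
definition resonance :: "nat \<Rightarrow> real \<Rightarrow> real" where
  "resonance N y = real N / (1 + (real N)\<^sup>2 * (int_dist y)\<^sup>2)"

text \<open>Two bounds for the same sum are added: its total mass, of order N, and N^2 times the
  twice differenced bound, of order 1/N. Together they produce the denominator of
  \<open>resonance\<close> without a case distinction on the size of ||\<alpha>||.\<close>

lemma inner_sum_bound:
  fixes s :: real
  assumes s: "s > 0"
  shows "\<exists>C>0. \<forall>N\<ge>1. \<forall>h \<alpha>. 
    norm (\<Sum>\<^sub>\<infinity>m. of_real (exp (- (s / (real N)\<^sup>2) * ((of_int m)\<^sup>2 + (of_int (m + h))\<^sup>2))) * echar (of_int m * \<alpha>))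
      \<le> C * exp (- s * (of_int h)\<^sup>2 / (2 * (real N)\<^sup>2)) * resonance N \<alpha>"
proof -
  define C1 where "C1 = 2 / (1 - exp (-(2 * s)))"
  define C2 where "C2 = 2 / (1 - exp (-s))"
  define K where "K = (4 + 32 * exp (8 * s)) * s"
  define C where "C = C1 + K * C2"
  have pos: "C1 > 0" "C2 > 0" "K > 0" using s by (auto simp: C1_def C2_def K_def add_pos_pos)
  have key: "norm (\<Sum>\<^sub>\<infinity>m. of_real (exp (- (s / (real N)\<^sup>2) * ((of_int m)\<^sup>2 + (of_int (m + h))\<^sup>2))) * echar (of_int m * \<alpha>))
      \<le> C * exp (- s * (of_int h)\<^sup>2 / (2 * (real N)\<^sup>2)) * resonance N \<alpha>"
    if N: "N \<ge> 1" for N h \<alpha>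
  proof -
    define a where "a = s / (real N)\<^sup>2"
    have N1: "1 \<le> (real N)\<^sup>2" using N by simp
    have a: "0 < a" "a \<le> s" using s N N1 by (auto simp: a_def divide_le_eq)
    define E where "E = exp (- s * (of_int h)\<^sup>2 / (2 * (real N)\<^sup>2))"
    have E: "exp (- a * (of_int h)\<^sup>2 / 2) = E" by (simp add: E_def a_def field_simps)
    define g where "g = pairw a h"
    have g: "g m = E * exp (- (2 * s) * (of_int m + of_int h / 2)\<^sup>2 / (real N)\<^sup>2)" for m
      unfolding g_def pairw_eq[OF a] E by (simp add: a_def)
    have sg: "g summable_on UNIV"
      unfolding g using s N by (intro summable_on_cmult_right gauss_summable) auto
    have g0: "0 \<le> g m" for m by (simp add: g E_def)
    have "infsum g UNIV = E * (\<Sum>\<^sub>\<infinity>m. exp (- (2 * s) * (of_int m + of_int h / 2)\<^sup>2 / (real N)\<^sup>2))"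
      unfolding g by (rule infsum_cmult_right')
    also have "\<dots> \<le> E * (real N * C1)" unfolding C1_def
      using s N by (intro mult_left_mono gauss_infsum_le) (auto simp: E_def)
    finally have g1: "infsum g UNIV \<le> E * (real N * C1)" .
    let ?D = "\<lambda>m. \<bar>g (m + 1) - 2 * g m + g (m - 1)\<bar>"
    let ?H = "\<lambda>m. (K / (real N)\<^sup>2 * E) * exp (- s * (of_int m + of_int h / 2)\<^sup>2 / (real N)\<^sup>2)"
    have DH: "?D m \<le> ?H m" for m
      using pairw_second_difference_le[OF a, of h m] unfolding g_def[symmetric] E
      by (simp add: a_def K_def field_simps)
    have sH: "?H summable_on UNIV"
      using s N by (intro summable_on_cmult_right gauss_summable) auto
    have sD: "?D summable_on UNIV"
      by (rule summable_on_comparison_test[OF sH]) (use DH in auto)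
    have "infsum ?D UNIV \<le> infsum ?H UNIV" by (rule infsum_mono[OF sD sH DH])
    also have "\<dots> = (K / (real N)\<^sup>2 * E) * (\<Sum>\<^sub>\<infinity>m. exp (- s * (of_int m + of_int h / 2)\<^sup>2 / (real N)\<^sup>2))"
      by (rule infsum_cmult_right')
    also have "\<dots> \<le> (K / (real N)\<^sup>2 * E) * (real N * C2)" unfolding C2_def
      using s N pos by (intro mult_left_mono gauss_infsum_le) (auto simp: E_def)
    finally have D1: "infsum ?D UNIV \<le> K * C2 * E / real N" using N by (simp add: power2_eq_square mult_ac)
    define I where "I = norm (\<Sum>\<^sub>\<infinity>m. of_real (g m) * echar (of_int m * \<alpha>))"
    have I1: "I \<le> E * (real N * C1)" unfolding I_def
      by (rule order.trans[OF norm_infsum_echar_le[OF sg g0] g1])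
    have "(int_dist \<alpha>)\<^sup>2 * I \<le> 4 * (sin (pi * \<alpha>))\<^sup>2 * I"
    proof (intro mult_right_mono)
      have "(int_dist \<alpha>)\<^sup>2 \<le> \<bar>sin (pi * \<alpha>)\<bar>\<^sup>2" using int_dist_le_sin int_dist_nonneg by (intro power_mono)
      then show "(int_dist \<alpha>)\<^sup>2 \<le> 4 * (sin (pi * \<alpha>))\<^sup>2"
        using zero_le_power2[of "sin (pi * \<alpha>)"] unfolding power2_abs by linarith
    qed (simp add: I_def)
    also have "\<dots> \<le> infsum ?D UNIV" unfolding I_def by (rule second_difference_infsum[OF sg g0 sD])
    finally have "(int_dist \<alpha>)\<^sup>2 * I \<le> K * C2 * E / real N" using D1 by linarith
    then have "(real N)\<^sup>2 * ((int_dist \<alpha>)\<^sup>2 * I) \<le> (real N)\<^sup>2 * (K * C2 * E / real N)" by (intro mult_left_mono) auto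
    also have "\<dots> = K * C2 * E * real N" using N by (simp add: power2_eq_square)
    finally have "(1 + (real N)\<^sup>2 * (int_dist \<alpha>)\<^sup>2) * I \<le> C * E * real N"
      using I1 by (simp add: C_def algebra_simps)
    moreover have "1 + (real N)\<^sup>2 * (int_dist \<alpha>)\<^sup>2 > 0" by (simp add: add_pos_nonneg)
    ultimately have "I \<le> C * E * resonance N \<alpha>" unfolding resonance_def by (simp add: field_simps)
    moreover have "g = (\<lambda>m. exp (- (s / (real N)\<^sup>2) * ((of_int m)\<^sup>2 + (of_int (m + h))\<^sup>2)))"
      by (rule ext) (simp only: g_def pairw_def[OF a], simp add: a_def)
    ultimately show ?thesis unfolding I_def E_def by simp
  qed
  have "C > 0" using pos by (simp add: C_def add_pos_pos)
  then show ?thesis using key by blast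
qed

section \<open>Weyl differencing of the theta sum\<close>

lemma resonance_nonneg: "0 \<le> resonance N y"
  by (simp add: resonance_def)

lemma resonance_le_four:
  assumes "int_dist y' \<le> 2 * int_dist y" shows "resonance N y \<le> 4 * resonance N y'"
proof -
  have "(int_dist y')\<^sup>2 \<le> (2 * int_dist y)\<^sup>2" using assms int_dist_nonneg by (intro power_mono)
  then have "(real N)\<^sup>2 * (int_dist y')\<^sup>2 \<le> (real N)\<^sup>2 * (4 * (int_dist y)\<^sup>2)"
    by (intro mult_left_mono) (auto simp: power_mult_distrib)
  then have "1 + (real N)\<^sup>2 * (int_dist y')\<^sup>2 \<le> 4 * (1 + (real N)\<^sup>2 * (int_dist y)\<^sup>2)" by simp
  moreover have "0 < 1 + (real N)\<^sup>2 * (int_dist z)\<^sup>2" for z by (simp add: add_pos_nonneg)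
  ultimately have "real N * (1 + (real N)\<^sup>2 * (int_dist y')\<^sup>2) \<le> real N * (4 * (1 + (real N)\<^sup>2 * (int_dist y)\<^sup>2))"
    by (intro mult_left_mono) auto
  with \<open>\<And>z. 0 < 1 + (real N)\<^sup>2 * (int_dist z)\<^sup>2\<close> show ?thesis
    unfolding resonance_def by (simp add: divide_le_eq pos_le_divide_eq mult_ac)
qed

text \<open>The symmetric range contains every difference of two elements of a block of length
  N.\<close>

definition resonance_sum :: "nat \<Rightarrow> real \<Rightarrow> real" where
  "resonance_sum N t = (\<Sum>h\<in>{- int N..int N}. resonance N (of_int h * t))"

lemma resonance_sum_nonneg: "0 \<le> resonance_sum N t"
  unfolding resonance_sum_def by (intro sum_nonneg resonance_nonneg)

text \<open>If \<open>h\<^sub>1\<close> minimises \<open>int_dist (h t)\<close> over the block, then \<open>int_dist ((h - h\<^sub>1) t) \<le> 2 int_dist (h t)\<close>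
  for all \<open>h\<close> in the block, so that any block is as good as the one centred at the origin.\<close>
lemma resonance_block_le:
  assumes "N \<ge> 1"
  shows "(\<Sum>r\<in>{0..<int N}. resonance N (of_int (k + r) * t)) \<le> 4 * resonance_sum N t"
proof -
  have "finite {0..<int N}" "{0..<int N} \<noteq> {}" using assms by auto
  from ex_min_if_finite[of "(\<lambda>r. int_dist (of_int (k + r) * t)) ` {0..<int N}"] this
  obtain r1 where r1: "r1 \<in> {0..<int N}" "\<And>r. r \<in> {0..<int N} \<Longrightarrow> int_dist (of_int (k + r1) * t) \<le> int_dist (of_int (k + r) * t)"
    by (auto simp: not_less)
  have "(\<Sum>r\<in>{0..<int N}. resonance N (of_int (k + r) * t)) \<le> (\<Sum>r\<in>{0..<int N}. 4 * resonance N (of_int (r - r1) * t))"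
  proof (intro sum_mono resonance_le_four)
    fix r assume r: "r \<in> {0..<int N}"
    have "of_int (r - r1) * t = of_int (k + r) * t - of_int (k + r1) * t" by (simp add: algebra_simps)
    then have "int_dist (of_int (r - r1) * t) \<le> int_dist (of_int (k + r) * t) + int_dist (of_int (k + r1) * t)"
      using int_dist_diff_le by metis
    with r1(2)[OF r] show "int_dist (of_int (r - r1) * t) \<le> 2 * int_dist (of_int (k + r) * t)" by linarith
  qed
  also have "\<dots> = 4 * (\<Sum>h\<in>(\<lambda>r. r - r1) ` {0..<int N}. resonance N (of_int h * t))"
    by (subst sum.reindex) (auto simp: inj_on_def sum_distrib_left)
  also have "\<dots> \<le> 4 * resonance_sum N t" unfolding resonance_sum_def
    using r1(1) by (intro mult_left_mono sum_mono2 resonance_nonneg) auto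
  finally show ?thesis .
qed

text \<open>The Gaussian is nearly constant on blocks of length N: on block k it is at most a
  constant times \<open>exp (- (s / 4) * k^2)\<close>. All block sums of \<open>resonance\<close>
  have the same bound, and the remaining sum over k is a Gaussian sum of unit scale.\<close>

lemma gauss_weighted_resonance_le:
  assumes "N \<ge> 1" "s > 0" "finite A"
  shows "(\<Sum>h\<in>A. exp (- s * (of_int h)\<^sup>2 / (2 * (real N)\<^sup>2)) * resonance N (of_int h * t))
           \<le> 4 * exp (s / 2) * (2 / (1 - exp (- (s / 4)))) * resonance_sum N t"
proof -
  let ?f = "\<lambda>h::int. exp (- s * (of_int h)\<^sup>2 / (2 * (real N)\<^sup>2)) * resonance N (of_int h * t)"
  let ?B = "(\<lambda>m. m div int N) ` A"
  have e: "exp (- s * (of_int (int N * k + r))\<^sup>2 / (2 * (real N)\<^sup>2)) \<le> exp (s / 2) * exp (- (s / 4) * (of_int k + 0)\<^sup>2)"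
    if "r \<in> {0..<int N}" for k r
  proof -
    define f where "f = real_of_int r / real N"
    have f: "0 \<le> f" "f \<le> 1" using that assms by (auto simp: f_def)
    have eq: "real_of_int (int N * k + r) = real N * (of_int k + f)" using assms by (simp add: f_def field_simps)
    have "f\<^sup>2 \<le> 1" using f by (simp add: power_le_one)
    \<comment> \<open>This square gives (k + f)^2 >= k^2 / 2 - f^2, so the position inside the block
      costs only the factor \<open>exp (s / 2)\<close>.\<close>
    moreover have "0 \<le> (of_int k + 2 * f)\<^sup>2" by simp
    ultimately have "(of_int k)\<^sup>2 / 2 - 1 \<le> (of_int k + f)\<^sup>2" by (simp add: power2_sum power_mult_distrib)
    then have "s * ((of_int k)\<^sup>2 / 2 - 1) \<le> s * (of_int k + f)\<^sup>2" using assms by (intro mult_left_mono) auto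
    moreover have "- s * (real N * (of_int k + f))\<^sup>2 / (2 * (real N)\<^sup>2) = - s * (of_int k + f)\<^sup>2 / 2"
      using assms by (simp add: power_mult_distrib)
    ultimately show ?thesis unfolding eq exp_add[symmetric] by (simp add: algebra_simps)
  qed
  have "sum ?f A \<le> (\<Sum>k\<in>?B. \<Sum>r\<in>{0..<int N}. ?f (int N * k + r))"
    using assms by (intro sum_int_blocks_le mult_nonneg_nonneg resonance_nonneg) auto
  also have "\<dots> \<le> (\<Sum>k\<in>?B. \<Sum>r\<in>{0..<int N}. exp (s / 2) * exp (- (s / 4) * (of_int k + 0)\<^sup>2) * resonance N (of_int (int N * k + r) * t))"
    by (intro sum_mono mult_right_mono e resonance_nonneg)
  also have "\<dots> = (\<Sum>k\<in>?B. exp (s / 2) * exp (- (s / 4) * (of_int k + 0)\<^sup>2) * (\<Sum>r\<in>{0..<int N}. resonance N (of_int (int N * k + r) * t)))"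
    by (simp add: sum_distrib_left)
  also have "\<dots> \<le> (\<Sum>k\<in>?B. exp (s / 2) * exp (- (s / 4) * (of_int k + 0)\<^sup>2) * (4 * resonance_sum N t))"
    using assms by (intro sum_mono mult_left_mono resonance_block_le) auto
  also have "\<dots> = exp (s / 2) * (4 * resonance_sum N t) * (\<Sum>k\<in>?B. exp (- (s / 4) * (of_int k + 0)\<^sup>2))"
    by (simp add: sum_distrib_left sum_distrib_right mult_ac)
  also have "\<dots> \<le> exp (s / 2) * (4 * resonance_sum N t) * (2 / (1 - exp (- (s / 4))))"
    using assms resonance_sum_nonneg by (intro mult_left_mono gauss_sum_le) auto
  finally show ?thesis by (simp add: mult_ac)
qed

definition gauss_wt :: "real \<Rightarrow> nat \<Rightarrow> int \<Rightarrow> real" where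
  "gauss_wt s N n = exp (- s * (of_int n)\<^sup>2 / (real N)\<^sup>2)"

definition theta :: "real \<Rightarrow> nat \<Rightarrow> real \<Rightarrow> real \<Rightarrow> complex" where
  "theta s N x t = (\<Sum>\<^sub>\<infinity>n. of_real (gauss_wt s N n) * echar (of_int n * x + (of_int n)\<^sup>2 * t))"

lemma gauss_wt_pos: "0 < gauss_wt s N n" by (simp add: gauss_wt_def)

lemma gauss_wt_summable: "s > 0 \<Longrightarrow> N \<ge> 1 \<Longrightarrow> gauss_wt s N summable_on UNIV"
  using gauss_summable[of s N 0] by (simp add: gauss_wt_def[abs_def])

text \<open>Absolute summability in the coordinates (m, h) of the pair (m, h + m); it licenses the
  exchange of sums in \<open>theta_sq\<close>.\<close>

lemma gauss_wt_pair_summable: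
  assumes "s > 0" "N \<ge> 1"
  shows "(\<lambda>(m,h). gauss_wt s N m * gauss_wt s N (h + m)) summable_on UNIV \<times> UNIV"
proof (rule summable_on_SigmaI[where g = "\<lambda>m. gauss_wt s N m * infsum (gauss_wt s N) UNIV"])
  show "((\<lambda>h. case (m, h) of (m, h) \<Rightarrow> gauss_wt s N m * gauss_wt s N (h + m)) has_sum gauss_wt s N m * infsum (gauss_wt s N) UNIV) UNIV" for m
  proof -
    have "(\<lambda>h. gauss_wt s N (h + m)) summable_on UNIV" by (intro summable_on_int_shift gauss_wt_summable assms)
    then have "((\<lambda>h. gauss_wt s N (h + m)) has_sum infsum (gauss_wt s N) UNIV) UNIV"
      using infsum_int_shift[of "gauss_wt s N" m] has_sum_infsum by metis
    then show ?thesis by (auto intro: has_sum_cmult_right)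
  qed
  show "(\<lambda>m. gauss_wt s N m * infsum (gauss_wt s N) UNIV) summable_on UNIV"
    by (intro summable_on_cmult_left gauss_wt_summable assms)
qed (auto simp: gauss_wt_def)

text \<open>Weyl differencing: for frequencies m and h + m the quadratic phases differ by h^2 + 2 h
  m times t, which for fixed h is linear in m. The inner sum is then a linear exponential sum with
  frequency 2 h t.\<close>

lemma theta_sq:
  assumes "s > 0" "N \<ge> 1"
  shows "theta s N x t * cnj (theta s N x t) =
    (\<Sum>\<^sub>\<infinity>h. echar (of_int h * x + (of_int h)\<^sup>2 * t) *
       (\<Sum>\<^sub>\<infinity>m. of_real (exp (- (s / (real N)\<^sup>2) * ((of_int m)\<^sup>2 + (of_int (m + h))\<^sup>2))) * echar (of_int m * (2 * of_int h * t))))"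
proof -
  define u where "u n = of_real (gauss_wt s N n) * echar (of_int n * x + (of_int n)\<^sup>2 * t)" for n :: int
  have nu: "norm (u n) = gauss_wt s N n" for n by (simp add: u_def norm_mult gauss_wt_def)
  have T: "theta s N x t = infsum u UNIV" by (simp add: theta_def u_def[abs_def])
  have prodterm: "cnj (u m) * u (h + m) = echar (of_int h * x + (of_int h)\<^sup>2 * t) *
     (of_real (exp (- (s / (real N)\<^sup>2) * ((of_int m)\<^sup>2 + (of_int (m + h))\<^sup>2))) * echar (of_int m * (2 * of_int h * t)))" for h m
  proof -
    have p1: "gauss_wt s N m * gauss_wt s N (h + m) = exp (- (s / (real N)\<^sup>2) * ((of_int m)\<^sup>2 + (of_int (m + h))\<^sup>2))"
      unfolding gauss_wt_def exp_add[symmetric] by (rule arg_cong[where f = exp]) (simp add: algebra_simps add_divide_distrib)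
    have p2: "echar (- (of_int m * x + (of_int m)\<^sup>2 * t)) * echar (of_int (h + m) * x + (of_int (h + m))\<^sup>2 * t) =
        echar (of_int h * x + (of_int h)\<^sup>2 * t) * echar (of_int m * (2 * of_int h * t))"
      unfolding echar_add[symmetric] by (rule arg_cong[where f = echar]) (simp add: ring_distribs power2_eq_square)
    have p3: "cnj (u m) * u (h + m) = of_real (gauss_wt s N m * gauss_wt s N (h + m)) *
        (echar (- (of_int m * x + (of_int m)\<^sup>2 * t)) * echar (of_int (h + m) * x + (of_int (h + m))\<^sup>2 * t))"
      by (simp only: u_def complex_cnj_mult cnj_echar complex_cnj_complex_of_real of_real_mult mult_ac)
    show ?thesis unfolding p3 p1 p2 by (simp only: mult_ac)
  qed
  have "theta s N x t * cnj (theta s N x t) = (\<Sum>\<^sub>\<infinity>m. cnj (u m) * infsum u UNIV)"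
    unfolding T infsum_cmult_left' infsum_cnj by (rule mult.commute)
  also have "\<dots> = (\<Sum>\<^sub>\<infinity>m. \<Sum>\<^sub>\<infinity>h. cnj (u m) * u (h + m))"
    by (simp add: infsum_cmult_right' infsum_int_shift)
  also have "\<dots> = (\<Sum>\<^sub>\<infinity>h. \<Sum>\<^sub>\<infinity>m. cnj (u m) * u (h + m))"
  proof (rule infsum_swap_banach, rule abs_summable_summable)
    show "(\<lambda>z. norm (case z of (m, h) \<Rightarrow> cnj (u m) * u (h + m))) summable_on (UNIV \<times> UNIV)"
      using gauss_wt_pair_summable[OF assms] by (simp add: norm_mult nu case_prod_unfold)
  qed
  also have "\<dots> = (\<Sum>\<^sub>\<infinity>h. echar (of_int h * x + (of_int h)\<^sup>2 * t) *
       (\<Sum>\<^sub>\<infinity>m. of_real (exp (- (s / (real N)\<^sup>2) * ((of_int m)\<^sup>2 + (of_int (m + h))\<^sup>2))) * echar (of_int m * (2 * of_int h * t))))"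
    by (rule infsum_cong) (simp only: prodterm infsum_cmult_right')
  finally show ?thesis .
qed

text \<open>After differencing, x occurs only in unimodular factors outside the inner sums, so
  absolute values give a bound uniform in x, as a supremum over space requires.\<close>

lemma theta_le_resonance_sum:
  fixes s :: real
  assumes s: "s > 0"
  shows "\<exists>C>0. \<forall>N\<ge>1. \<forall>x t. (norm (theta s N x t))\<^sup>2 \<le> C * resonance_sum N (2 * t)"
proof -
  obtain C where C: "C > 0" "\<And>N h \<alpha>. N \<ge> 1 \<Longrightarrow> 
    norm (\<Sum>\<^sub>\<infinity>m. of_real (exp (- (s / (real N)\<^sup>2) * ((of_int m)\<^sup>2 + (of_int (m + h))\<^sup>2))) * echar (of_int m * \<alpha>))
      \<le> C * exp (- s * (of_int h)\<^sup>2 / (2 * (real N)\<^sup>2)) * resonance N \<alpha>"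
    using inner_sum_bound[OF s] by auto
  define D where "D = 4 * exp (s / 2) * (2 / (1 - exp (- (s / 4))))"
  have D: "D > 0" using s by (simp add: D_def)
  have "(norm (theta s N x t))\<^sup>2 \<le> C * D * resonance_sum N (2 * t)" if N: "N \<ge> 1" for N x t
  proof -
    define J where "J h = echar (of_int h * x + (of_int h)\<^sup>2 * t) *
       (\<Sum>\<^sub>\<infinity>m. of_real (exp (- (s / (real N)\<^sup>2) * ((of_int m)\<^sup>2 + (of_int (m + h))\<^sup>2))) * echar (of_int m * (2 * of_int h * t)))"
      for h
    let ?b = "\<lambda>h::int. C * (exp (- s * (of_int h)\<^sup>2 / (2 * (real N)\<^sup>2)) * resonance N (of_int h * (2 * t)))"
    have J: "norm (J h) \<le> ?b h" for h
      unfolding J_def using C(2)[OF N, of h "2 * of_int h * t"] by (simp add: norm_mult mult_ac)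
    have fin: "(\<Sum>h\<in>A. norm (J h)) \<le> C * D * resonance_sum N (2 * t)" if "finite A" for A
    proof -
      have "(\<Sum>h\<in>A. norm (J h)) \<le> (\<Sum>h\<in>A. ?b h)" by (intro sum_mono J)
      also have "\<dots> = C * (\<Sum>h\<in>A. exp (- s * (of_int h)\<^sup>2 / (2 * (real N)\<^sup>2)) * resonance N (of_int h * (2 * t)))"
        by (simp add: sum_distrib_left)
      also have "\<dots> \<le> C * (D * resonance_sum N (2 * t))"
        unfolding D_def using C(1) by (intro mult_left_mono gauss_weighted_resonance_le N s that) auto
      finally show ?thesis by (simp add: mult_ac)
    qed
    have sJ: "(\<lambda>h. norm (J h)) summable_on UNIV"
      by (intro nonneg_bdd_above_summable_on bdd_aboveI2[of _ _ "C * D * resonance_sum N (2 * t)"]) (auto intro: fin)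
    have "(norm (theta s N x t))\<^sup>2 = norm (theta s N x t * cnj (theta s N x t))"
      by (simp add: norm_mult power2_eq_square)
    also have "\<dots> = norm (infsum J UNIV)" unfolding theta_sq[OF s N] J_def ..
    also have "\<dots> \<le> (\<Sum>\<^sub>\<infinity>h. norm (J h))" by (rule norm_infsum_bound[OF sJ])
    also have "\<dots> \<le> C * D * resonance_sum N (2 * t)" by (rule infsum_le_finite_sums[OF sJ fin])
    finally show ?thesis .
  qed
  with C(1) D show ?thesis by (intro exI[of _ "C * D"]) auto
qed

section \<open>Major arcs\<close>

text \<open>The right side is of the order of min(K, 1/c). It telescopes: its increment is 2/(A B)
  with A = 1 + c K and B = 1 + c (K + 1), and A B <= B^2 <= 2 (1 + (c (K + 1))^2).\<close>

lemma sum_inverse_one_plus_square_le: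
  fixes c :: real
  assumes "c \<ge> 0"
  shows "(\<Sum>k=1..K. 1 / (1 + (c * real k)\<^sup>2)) \<le> 2 * real K / (1 + c * real K)"
proof (induction K)
  case (Suc K)
  define A where "A = 1 + c * real K"
  define B where "B = 1 + c * real (Suc K)"
  have pos: "0 < A" "0 < B" "A \<le> B" using assms by (auto simp: A_def B_def add_pos_nonneg algebra_simps)
  have "A * B \<le> B * B" using pos by (intro mult_right_mono) auto
  also have "\<dots> \<le> 2 * (1 + (c * real (Suc K))\<^sup>2)"
  proof -
    have "0 \<le> (1 - c * real (Suc K))\<^sup>2" by simp
    then show ?thesis unfolding B_def by (simp add: power2_eq_square algebra_simps)
  qed
  finally have "1 / (1 + (c * real (Suc K))\<^sup>2) \<le> 2 / (A * B)"
    using pos by (simp add: divide_le_eq pos_le_divide_eq add_pos_nonneg)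
  also have "2 / (A * B) = 2 * real (Suc K) / B - 2 * real K / A"
    using pos by (simp add: divide_simps) (simp add: A_def B_def algebra_simps)
  finally show ?case using Suc.IH by (simp add: A_def B_def)
qed simp

text \<open>The induction carries the stronger bound 2 - 1/n, whose increment 1/(n (n + 1))
  dominates the new term.\<close>

lemma sum_inverse_square_le: "(\<Sum>j\<in>{1..int n}. 1 / (of_int j)\<^sup>2) \<le> (2::real)"
proof -
  have "(\<Sum>j\<in>{1..int n}. 1 / (of_int j)\<^sup>2) \<le> 2 - 1 / real n" if "n \<ge> 1" for n
    using that
  proof (induction n rule: nat_induct_at_least)
    case (Suc n)
    have "{1..int (Suc n)} = insert (int (Suc n)) {1..int n}" by auto
    then have "(\<Sum>j\<in>{1..int (Suc n)}. 1 / (of_int j)\<^sup>2) = 1 / (real (Suc n))\<^sup>2 + (\<Sum>j\<in>{1..int n}. 1 / (real_of_int j)\<^sup>2)"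
      by simp
    also have "1 / (real (Suc n))\<^sup>2 \<le> 1 / real n - 1 / real (Suc n)"
    proof -
      have "1 / real n - 1 / real (Suc n) = 1 / (real n * real (Suc n))" using Suc.hyps by (simp add: field_simps)
      moreover have "1 / (real (Suc n))\<^sup>2 \<le> 1 / (real n * real (Suc n))"
        using Suc.hyps unfolding power2_eq_square by (intro divide_left_mono mult_right_mono mult_pos_pos) auto
      ultimately show ?thesis by simp
    qed
    finally show ?case using Suc.IH by linarith
  qed simp
  from this[of n] show ?thesis by (cases "n = 0") (auto intro: order.trans)
qed

text \<open>The nearest integer to r/q is 0 or 1. The second form adds both reciprocals, so that
  later sums need not decide which.\<close>

lemma int_dist_fraction_ge:
  fixes q r :: int
  assumes "0 < r" "r < q"
  shows "1 / of_int q \<le> int_dist (of_int r / of_int q)"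
    "1 / (int_dist (of_int r / of_int q))\<^sup>2 \<le> (of_int q)\<^sup>2 * (1 / (of_int r)\<^sup>2 + 1 / (of_int (q - r))\<^sup>2)"
proof -
  have q: "real_of_int q > 0" "real_of_int r > 0" "real_of_int (q - r) > 0" using assms by auto
  define y where "y = real_of_int r / of_int q"
  have y: "0 < y" "y < 1" using assms by (auto simp: y_def)
  consider "round y \<le> 0" | "round y \<ge> 1" by linarith
  then have "int_dist y = y \<or> int_dist y = 1 - y"
  proof cases
    case 1
    then have "y \<le> int_dist y" unfolding int_dist_def by linarith
    with int_dist_le[of y 0] y show ?thesis by auto
  next
    case 2
    then have "1 - y \<le> int_dist y" unfolding int_dist_def by linarith
    with int_dist_le[of y 1] y show ?thesis by auto
  qed
  moreover have "1 - y = of_int (q - r) / of_int q" using q by (simp add: y_def field_simps)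
  ultimately have *: "int_dist y = of_int r / of_int q \<or> int_dist y = of_int (q - r) / of_int q"
    by (auto simp: y_def)
  have "(1::real) \<le> of_int r" "(1::real) \<le> of_int (q - r)" using assms by linarith+
  then have "1 / of_int q \<le> real_of_int r / of_int q" "1 / of_int q \<le> real_of_int (q - r) / of_int q"
    using q by (auto intro!: divide_right_mono simp del: of_int_diff)
  then show "1 / of_int q \<le> int_dist (of_int r / of_int q)"
    using * unfolding y_def by auto
  show "1 / (int_dist (of_int r / of_int q))\<^sup>2 \<le> (of_int q)\<^sup>2 * (1 / (of_int r)\<^sup>2 + 1 / (of_int (q - r))\<^sup>2)"
    using * q unfolding y_def by (auto simp: power_divide distrib_left simp del: of_int_diff)
qed

text \<open>Multiplication by a permutes the nonzero residues modulo q, so a may be taken to be 1,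
  and the sum of inverse squares converges. First powers would give an extra log q here.\<close>

lemma sum_int_dist_fractions_le:
  fixes a q :: int
  assumes "coprime a q" "q > 0"
  shows "(\<Sum>r\<in>{1..<q}. 1 / (int_dist (of_int (r * a) / of_int q))\<^sup>2) \<le> 4 * (of_int q)\<^sup>2"
proof -
  define \<psi> where "\<psi> r = (of_int q)\<^sup>2 * (1 / (of_int r)\<^sup>2 + 1 / (real_of_int (q - r))\<^sup>2)" for r
  define j where "j r = (r * a) mod q" for r
  have inj: "inj_on j {1..<q}"
  proof (rule inj_onI)
    fix r r' assume r: "r \<in> {1..<q}" "r' \<in> {1..<q}" "j r = j r'"
    then have "q dvd (r - r') * a" unfolding j_def by (simp add: mod_eq_dvd_iff left_diff_distrib)
    then have "q dvd r - r'" using assms by (simp add: coprime_dvd_mult_left_iff coprime_commute)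
    then show "r = r'" using r dvd_imp_le_int[of "r - r'" q] by (cases "r = r'") auto
  qed
  have jr: "j r \<in> {1..<q}" if "r \<in> {1..<q}" for r
  proof -
    have "\<not> q dvd r" using that zdvd_imp_le[of q r] by auto
    then have "\<not> q dvd r * a" using assms by (simp add: coprime_dvd_mult_left_iff coprime_commute)
    then have "j r \<noteq> 0" by (simp add: j_def dvd_eq_mod_eq_0)
    moreover have "0 \<le> j r" "j r < q" using assms by (auto simp: j_def)
    ultimately show ?thesis by auto
  qed
  have e: "int_dist (of_int (r * a) / of_int q) = int_dist (of_int (j r) / of_int q)" for r
  proof -
    have "real_of_int (r * a) = of_int q * of_int (r * a div q) + of_int (j r)"
      unfolding j_def of_int_mult[symmetric] of_int_add[symmetric] by simp
    then have "real_of_int (r * a) / of_int q = of_int (j r) / of_int q + of_int (r * a div q)"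
      using assms by (simp add: field_simps)
    then show ?thesis by (simp add: int_dist_add_of_int)
  qed
  have "(\<Sum>r\<in>{1..<q}. 1 / (int_dist (of_int (r * a) / of_int q))\<^sup>2) \<le> (\<Sum>r\<in>{1..<q}. \<psi> (j r))"
    unfolding e \<psi>_def
  proof (rule sum_mono)
    fix r assume "r \<in> {1..<q}"
    from jr[OF this] show "1 / (int_dist (of_int (j r) / of_int q))\<^sup>2
        \<le> (of_int q)\<^sup>2 * (1 / (of_int (j r))\<^sup>2 + 1 / (real_of_int (q - j r))\<^sup>2)"
      by (intro int_dist_fraction_ge) auto
  qed
  also have "\<dots> = (\<Sum>r\<in>j ` {1..<q}. \<psi> r)" using inj by (simp add: sum.reindex)
  also have "\<dots> \<le> (\<Sum>r\<in>{1..<q}. \<psi> r)" using jr by (intro sum_mono2) (auto simp: \<psi>_def)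
  also have "\<dots> = (of_int q)\<^sup>2 * ((\<Sum>r\<in>{1..<q}. 1 / (of_int r)\<^sup>2) + (\<Sum>r\<in>{1..<q}. 1 / (real_of_int (q - r))\<^sup>2))"
    unfolding \<psi>_def by (simp add: sum_distrib_left[symmetric] sum.distrib)
  also have "(\<Sum>r\<in>{1..<q}. 1 / (real_of_int (q - r))\<^sup>2) = (\<Sum>r\<in>{1..<q}. 1 / (of_int r)\<^sup>2)"
    by (rule sum.reindex_bij_witness[of _ "\<lambda>r. q - r" "\<lambda>r. q - r"]) auto
  also have "(\<Sum>r\<in>{1..<q}. 1 / (real_of_int r)\<^sup>2) \<le> 2"
  proof -
    have "{1..<q} = {1..int (nat (q - 1))}" using assms by auto
    then show ?thesis using sum_inverse_square_le by metis
  qed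
  finally show ?thesis by (simp add: mult_left_mono)
qed

text \<open>Values of \<open>resonance\<close> at the points \<open>h t\<close>, when \<open>t\<close> is close to \<open>a / q\<close>: the multiples of \<open>q\<close>
  see only the distance \<open>\<beta>\<close> of \<open>t\<close> to \<open>a / q\<close>, the others only \<open>a / q\<close>.\<close>
context
  fixes N :: nat and a q :: int and t \<beta> :: real
  assumes N: "N \<ge> 1" and q: "0 < q" "q \<le> 2 * int N" and cop: "coprime a q"
    and \<beta>_def: "\<beta> = \<bar>t - of_int a / of_int q\<bar>" and \<beta>_le: "\<beta> \<le> 1 / (2 * of_int q * real N)"
begin

text \<open>The right side is half of 1/q, the least nonzero distance of a multiple of a/q from the
  integers.\<close>

lemma h_beta_le: assumes "\<bar>h\<bar> \<le> int N" shows "\<bar>of_int h\<bar> * \<beta> \<le> 1 / (2 * of_int q)"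
proof -
  have "\<bar>real_of_int h\<bar> \<le> real N" using assms by linarith
  then have "\<bar>of_int h\<bar> * \<beta> \<le> real N * (1 / (2 * of_int q * real N))"
    using \<beta>_le by (intro mult_mono) (auto simp: \<beta>_def)
  then show ?thesis using N by simp
qed

text \<open>For h = q k the point h t lies within q |k| \<beta> <= 1/2 of an integer, so its
  distance is exactly that, and \<open>sum_inverse_one_plus_square_le\<close> applies with c = N q
  \<beta>. The constant is 7 = 3 + 4: 3 for k = 0, because c <= 1/2 and M >= 1/2 give 1 + c M <= 3
  M, and 4 for the two signs of k.\<close>

lemma sum_multiples_le:
  "(\<Sum>h | h \<in> {-int N..int N} \<and> q dvd h. resonance N (of_int h * t)) \<le> 7 * ((real N)\<^sup>2 / (of_int q * (1 + (real N)\<^sup>2 * \<beta>)))"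
proof -
  define K where "K = nat (int N div q)"
  have K: "int K = int N div q" using q by (simp add: K_def pos_imp_zdiv_nonneg_iff)
  define c where "c = real N * of_int q * \<beta>"
  have c: "0 \<le> c" "c \<le> 1/2" using q N \<beta>_le by (auto simp: c_def \<beta>_def field_simps)
  define M where "M = real N / of_int q"
  have M: "1/2 \<le> M" using q by (simp add: M_def field_simps)
  have KM: "real K \<le> M" unfolding M_def
  proof -
    have "int K * q \<le> int N" unfolding K using q minus_mod_eq_div_mult[of "int N" q] pos_mod_sign[of q "int N"] by linarith
    then have "real K * of_int q \<le> real N" by (metis of_int_le_iff of_int_mult of_int_of_nat_eq)
    then show "real K \<le> real N / of_int q" using q by (simp add: field_simps)
  qed
  have le: "k \<le> int N div q \<longleftrightarrow> k * q \<le> int N" for k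
  proof
    assume "k \<le> int N div q"
    then have "k * q \<le> int N div q * q" using q by (intro mult_right_mono) auto
    then show "k * q \<le> int N" using minus_mod_eq_div_mult[of "int N" q] pos_mod_sign[of q "int N"] q by linarith
  next
    assume "k * q \<le> int N"
    then have "k * q div q \<le> int N div q" using q by (intro zdiv_mono1)
    then show "k \<le> int N div q" using q by simp
  qed
  have set: "{h. h \<in> {-int N..int N} \<and> q dvd h} = (\<lambda>k. q * k) ` {- int K..int K}"
  proof (intro equalityI subsetI)
    fix h assume "h \<in> {h. h \<in> {-int N..int N} \<and> q dvd h}"
    then obtain k where k: "h = q * k" "- int N \<le> q * k" "q * k \<le> int N" by (auto elim: dvdE)
    have "k \<le> int N div q" using k by (simp add: le mult.commute)
    moreover have "- k \<le> int N div q" using k by (simp add: le mult.commute)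
    ultimately show "h \<in> (\<lambda>k. q * k) ` {- int K..int K}" using k K by auto
  next
    fix h assume "h \<in> (\<lambda>k. q * k) ` {- int K..int K}"
    then obtain k where k: "h = q * k" "k \<in> {- int K..int K}" by blast
    then have "k \<le> int N div q" "- k \<le> int N div q" using K by auto
    then have "k * q \<le> int N" "- k * q \<le> int N" by (simp_all only: le)
    then show "h \<in> {h. h \<in> {-int N..int N} \<and> q dvd h}" using k by (auto simp: mult.commute)
  qed
  have F: "resonance N (of_int (q * k) * t) = real N * (1 / (1 + (c * of_int k)\<^sup>2))" if "k \<in> {- int K..int K}" for k
  proof -
    have "q * k \<in> {h. h \<in> {-int N..int N} \<and> q dvd h}" unfolding set using that by (rule imageI)
    then have h: "\<bar>q * k\<bar> \<le> int N" by auto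
    have "of_int (q * k) * t = of_int (q * k) * (t - of_int a / of_int q) + of_int (k * a)"
      using q by (simp add: field_simps)
    then have "int_dist (of_int (q * k) * t) = int_dist (of_int (q * k) * (t - of_int a / of_int q))"
      by (simp only: int_dist_add_of_int)
    also have "\<dots> = \<bar>of_int (q * k) * (t - of_int a / of_int q)\<bar>"
    proof (rule int_dist_eq_abs)
      have "\<bar>of_int (q * k) * (t - of_int a / of_int q)\<bar> = \<bar>of_int (q * k)\<bar> * \<beta>" by (simp add: \<beta>_def abs_mult)
      also have "\<dots> \<le> 1 / (2 * of_int q)" by (rule h_beta_le[OF h])
      also have "\<dots> \<le> 1/2" using q by (simp add: field_simps)
      finally show "\<bar>of_int (q * k) * (t - of_int a / of_int q)\<bar> \<le> 1/2" .
    qed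
    also have "\<dots> = of_int q * \<bar>of_int k\<bar> * \<beta>" using q by (simp add: \<beta>_def abs_mult)
    finally show ?thesis unfolding resonance_def c_def by (simp add: power_mult_distrib mult_ac)
  qed
  have "(\<Sum>h | h \<in> {-int N..int N} \<and> q dvd h. resonance N (of_int h * t)) =
      (\<Sum>k\<in>{- int K..int K}. resonance N (of_int (q * k) * t))"
    unfolding set using q by (subst sum.reindex) (auto simp: inj_on_def)
  also have "\<dots> = (\<Sum>k\<in>{- int K..int K}. real N * (1 / (1 + (c * of_int k)\<^sup>2)))"
    by (intro sum.cong refl F)
  also have "\<dots> = real N * (1 + 2 * (\<Sum>k=1..K. 1 / (1 + (c * real k)\<^sup>2)))"
  proof -
    have u: "{- int K..int K} = insert 0 (int ` {1..K} \<union> (\<lambda>k. - int k) ` {1..K})"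
    proof (intro equalityI subsetI)
      fix k assume "k \<in> {- int K..int K}"
      then have "k = 0 \<or> k = int (nat k) \<and> nat k \<in> {1..K} \<or> k = - int (nat (-k)) \<and> nat (-k) \<in> {1..K}" by auto
      then show "k \<in> insert 0 (int ` {1..K} \<union> (\<lambda>k. - int k) ` {1..K})" by blast
    qed auto
    have "(\<Sum>k\<in>{- int K..int K}. 1 / (1 + (c * real_of_int k)\<^sup>2)) =
        1 + ((\<Sum>k\<in>int ` {1..K}. 1 / (1 + (c * real_of_int k)\<^sup>2)) + (\<Sum>k\<in>(\<lambda>k. - int k) ` {1..K}. 1 / (1 + (c * real_of_int k)\<^sup>2)))"
      unfolding u by (subst sum.insert, simp, force, subst sum.union_disjoint) auto
    also have "\<dots> = 1 + 2 * (\<Sum>k=1..K. 1 / (1 + (c * real k)\<^sup>2))"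
      by (simp add: sum.reindex inj_on_def)
    finally show ?thesis by (simp only: sum_distrib_left[symmetric])
  qed
  also have "\<dots> \<le> real N * (1 + 2 * (2 * real K / (1 + c * real K)))"
    using c by (intro mult_left_mono add_left_mono sum_inverse_one_plus_square_le) auto
  also have "\<dots> \<le> real N * (7 * (M / (1 + c * M)))"
  proof (rule mult_left_mono)
    have pos: "0 < 1 + c * M" "0 < 1 + c * real K" using c M by (auto intro: add_pos_nonneg)
    have 1: "real K / (1 + c * real K) \<le> M / (1 + c * M)"
      using pos KM by (simp add: divide_le_eq pos_le_divide_eq mult.commute algebra_simps)
    have "c * M \<le> 1/2 * M" using c M by (intro mult_right_mono) auto
    then have "1 + c * M \<le> 3 * M" using M by linarith
    then have 2: "1 \<le> 3 * (M / (1 + c * M))" using pos by (simp add: pos_le_divide_eq)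
    have "1 + 2 * (2 * real K / (1 + c * real K)) = 1 + 4 * (real K / (1 + c * real K))" by simp
    also have "\<dots> \<le> 7 * (M / (1 + c * M))" using 1 2 by linarith
    finally show "1 + 2 * (2 * real K / (1 + c * real K)) \<le> 7 * (M / (1 + c * M))" .
  qed auto
  also have "\<dots> = 7 * ((real N)\<^sup>2 / (of_int q * (1 + (real N)\<^sup>2 * \<beta>)))"
  proof -
    have "c * M = (real N)\<^sup>2 * \<beta>" using q by (simp add: c_def M_def power2_eq_square)
    then show ?thesis by (simp add: M_def power2_eq_square)
  qed
  finally show ?thesis .
qed

text \<open>Here the distance of h t to the integers is at least half that of h a / q, so
  \<open>resonance\<close> is O(1 / (N ||h a / q||^2)). A full period contributes 4 q^2, there are
  O(N / q) periods, and the total O(q) stays below the target because q <= 2 N and \<beta> is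
  small.\<close>

lemma sum_nonmultiples_le:
  "(\<Sum>h | h \<in> {-int N..int N} \<and> \<not> q dvd h. resonance N (of_int h * t)) \<le> 480 * ((real N)\<^sup>2 / (of_int q * (1 + (real N)\<^sup>2 * \<beta>)))"
proof -
  define f where "f h = (if q dvd h then 0 else 1 / (int_dist (of_int (h * a) / of_int q))\<^sup>2)" for h
  have f0: "0 \<le> f h" for h by (simp add: f_def)
  have q0: "real_of_int q > 0" using q by simp
  have step: "resonance N (of_int h * t) \<le> 4 / real N * f h" if h: "h \<in> {-int N..int N}" "\<not> q dvd h" for h
  proof -
    define u where "u = int_dist (of_int (h * a) / of_int q)"
    have "of_int (h * a) / of_int q = of_int h * t - of_int h * (t - of_int a / of_int q)"
      using q by (simp add: field_simps)
    then have "u \<le> int_dist (of_int h * t) + int_dist (of_int h * (t - of_int a / of_int q))"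
      unfolding u_def using int_dist_diff_le by metis
    also have "int_dist (of_int h * (t - of_int a / of_int q)) \<le> \<bar>of_int h\<bar> * \<beta>"
      using int_dist_le[of "of_int h * (t - of_int a / of_int q)" 0] by (simp add: \<beta>_def abs_mult)
    also have "\<dots> \<le> 1 / (2 * of_int q)" using h by (intro h_beta_le) auto
    finally have u1: "u \<le> int_dist (of_int h * t) + 1 / (2 * of_int q)" by simp
    have u2: "1 / of_int q \<le> u"
    proof -
      define r where "r = (h * a) mod q"
      have "real_of_int (h * a) = of_int q * of_int (h * a div q) + of_int r"
        unfolding r_def of_int_mult[symmetric] of_int_add[symmetric] by simp
      then have "real_of_int (h * a) / of_int q = of_int r / of_int q + of_int (h * a div q)"
        using q by (simp add: field_simps)
      then have u: "u = int_dist (of_int r / of_int q)" unfolding u_def by (simp add: int_dist_add_of_int)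
      have "\<not> q dvd h * a" using cop h(2) by (simp add: coprime_dvd_mult_left_iff coprime_commute)
      then have "r \<noteq> 0" by (simp add: r_def dvd_eq_mod_eq_0)
      moreover have "0 \<le> r" "r < q" using q by (auto simp: r_def)
      ultimately show ?thesis unfolding u by (intro int_dist_fraction_ge) auto
    qed
    have upos: "u > 0" using u2 q0 by (meson divide_pos_pos less_le_trans zero_less_one)
    \<comment> \<open>The perturbation 1/(2q) is at most u/2 because u >= 1/q.\<close>
    have "u / 2 \<le> int_dist (of_int h * t)" using u1 u2 by (simp add: field_simps)
    then have "(u / 2)\<^sup>2 \<le> (int_dist (of_int h * t))\<^sup>2" using upos by (intro power_mono) auto
    then have "(real N)\<^sup>2 * (u / 2)\<^sup>2 \<le> 1 + (real N)\<^sup>2 * (int_dist (of_int h * t))\<^sup>2"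
      using mult_left_mono[of "(u / 2)\<^sup>2" "(int_dist (of_int h * t))\<^sup>2" "(real N)\<^sup>2"] by simp
    then have "resonance N (of_int h * t) \<le> real N / ((real N)\<^sup>2 * (u / 2)\<^sup>2)"
      unfolding resonance_def using N upos by (intro divide_left_mono) (auto intro!: mult_pos_pos add_pos_nonneg)
    also have "\<dots> = 4 / real N * (1 / u\<^sup>2)" using N by (simp add: power2_eq_square)
    finally show ?thesis using h(2) by (simp add: f_def u_def)
  qed
  have fper: "f (q * k + r) = f r" for k r
  proof -
    have "real_of_int ((q * k + r) * a) / of_int q = of_int (r * a) / of_int q + of_int (k * a)"
      using q by (simp add: field_simps)
    then have "int_dist (real_of_int ((q * k + r) * a) / of_int q) = int_dist (of_int (r * a) / of_int q)"
      by (simp only: int_dist_add_of_int)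
    moreover have "q dvd q * k + r \<longleftrightarrow> q dvd r" by (simp add: dvd_add_right_iff)
    ultimately show ?thesis by (simp only: f_def)
  qed
  have block: "(\<Sum>r\<in>{0..<q}. f r) \<le> 4 * (of_int q)\<^sup>2"
  proof -
    have "(\<Sum>r\<in>{0..<q}. f r) = (\<Sum>r\<in>{1..<q}. f r)"
    proof -
      have "{0..<q} = insert 0 {1..<q}" using q by auto
      then show ?thesis by (simp add: f_def)
    qed
    also have "\<dots> = (\<Sum>r\<in>{1..<q}. 1 / (int_dist (of_int (r * a) / of_int q))\<^sup>2)"
      using zdvd_imp_le by (intro sum.cong) (fastforce simp: f_def)+
    also have "\<dots> \<le> 4 * (of_int q)\<^sup>2" by (rule sum_int_dist_fractions_le[OF cop q(1)])
    finally show ?thesis .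
  qed
  let ?B = "(\<lambda>m. m div q) ` {-int N..int N}"
  \<comment> \<open>At most 2N/q + 2 blocks meet [-N, N], and q <= 2N turns 2N + 2q into 6N.\<close>
  have cB: "real (card ?B) * of_int q \<le> 6 * real N"
  proof -
    have "?B \<subseteq> {(- int N) div q..int N div q}" using q by (auto intro: zdiv_mono1)
    then have "card ?B \<le> card {(- int N) div q..int N div q}" by (intro card_mono) auto
    also have "\<dots> = nat (int N div q - (- int N) div q + 1)" by simp
    finally have "int (card ?B) \<le> int N div q - (- int N) div q + 1" 
    proof -
      assume "card ?B \<le> nat (int N div q - (- int N) div q + 1)"
      moreover have "(- int N) div q \<le> int N div q" using q by (intro zdiv_mono1) auto
      ultimately show ?thesis by linarith
    qed
    then have "int (card ?B) * q \<le> (int N div q - (- int N) div q + 1) * q" using q by (intro mult_right_mono) auto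
    also have "\<dots> = (int N - int N mod q) - (- int N - (- int N) mod q) + q"
      by (simp add: minus_mod_eq_div_mult left_diff_distrib distrib_right)
    also have "\<dots> \<le> 2 * int N + 2 * q"
      using pos_mod_bound[of q "- int N"] pos_mod_sign[of q "int N"] q by linarith
    also have "\<dots> \<le> 6 * int N" using q by linarith
    finally have "real_of_int (int (card ?B) * q) \<le> of_int (6 * int N)" by (simp only: of_int_le_iff)
    then show ?thesis by simp
  qed
  have "(\<Sum>h | h \<in> {-int N..int N} \<and> \<not> q dvd h. resonance N (of_int h * t)) \<le>
     (\<Sum>h | h \<in> {-int N..int N} \<and> \<not> q dvd h. 4 / real N * f h)"
    using step by (intro sum_mono) auto
  also have "\<dots> \<le> (\<Sum>h\<in>{-int N..int N}. 4 / real N * f h)"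
    using f0 by (intro sum_mono2) auto
  also have "\<dots> = 4 / real N * (\<Sum>h\<in>{-int N..int N}. f h)" by (rule sum_distrib_left[symmetric])
  also have "(\<Sum>h\<in>{-int N..int N}. f h) \<le> (\<Sum>k\<in>?B. \<Sum>r\<in>{0..<q}. f (q * k + r))"
    using q f0 by (intro sum_int_blocks_le) auto
  also have "\<dots> \<le> real (card ?B) * (4 * (of_int q)\<^sup>2)"
    unfolding fper using block by (simp add: mult_left_mono)
  also have "4 / real N * (real (card ?B) * (4 * (of_int q)\<^sup>2)) = 16 * of_int q / real N * (real (card ?B) * of_int q)"
    by (simp add: power2_eq_square)
  also have "\<dots> \<le> 16 * of_int q / real N * (6 * real N)"
    using q0 cB by (intro mult_left_mono) auto
  also have "\<dots> = 96 * of_int q" using N by simp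
  \<comment> \<open>From q^2 <= 4 N^2 and q^2 \<beta> <= 1 follows q^2 (1 + N^2 \<beta>) <= 5 N^2;
    the constant is 96 times 5.\<close>
  also have "\<dots> \<le> 480 * ((real N)\<^sup>2 / (of_int q * (1 + (real N)\<^sup>2 * \<beta>)))"
  proof -
    have b0: "0 \<le> \<beta>" by (simp add: \<beta>_def)
    have q2: "real_of_int q \<le> 2 * real N" using q(2) by (metis of_int_le_iff of_int_mult of_int_numeral of_int_of_nat_eq)
    have "(of_int q)\<^sup>2 \<le> (2 * real N)\<^sup>2" using q2 q0 by (intro power_mono) auto
    then have 1: "(of_int q)\<^sup>2 \<le> 4 * (real N)\<^sup>2" by (simp add: power_mult_distrib)
    have "(of_int q)\<^sup>2 * \<beta> \<le> (of_int q)\<^sup>2 * (1 / (2 * of_int q * real N))" using \<beta>_le by (intro mult_left_mono) auto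
    also have "\<dots> = of_int q / (2 * real N)" using q0 by (simp add: power2_eq_square)
    also have "\<dots> \<le> 1" using q2 N by simp
    finally have "(real N)\<^sup>2 * ((of_int q)\<^sup>2 * \<beta>) \<le> (real N)\<^sup>2 * 1" by (intro mult_left_mono) auto
    with 1 have "of_int q * (of_int q * (1 + (real N)\<^sup>2 * \<beta>)) \<le> 5 * (real N)\<^sup>2"
      by (simp add: power2_eq_square algebra_simps)
    moreover have "0 < of_int q * (1 + (real N)\<^sup>2 * \<beta>)" using q0 b0 by (intro mult_pos_pos add_pos_nonneg) auto
    ultimately have "of_int q \<le> 5 * (real N)\<^sup>2 / (of_int q * (1 + (real N)\<^sup>2 * \<beta>))"
      by (simp only: pos_le_divide_eq)
    then show ?thesis by simp
  qed
  finally show ?thesis using N by (simp add: mult_left_mono divide_right_mono)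
qed

lemma resonance_sum_le: "resonance_sum N t \<le> 487 * ((real N)\<^sup>2 / (of_int q * (1 + (real N)\<^sup>2 * \<beta>)))"
proof -
  have "resonance_sum N t = (\<Sum>h | h \<in> {-int N..int N} \<and> q dvd h. resonance N (of_int h * t)) +
     (\<Sum>h | h \<in> {-int N..int N} \<and> \<not> q dvd h. resonance N (of_int h * t))"
    unfolding resonance_sum_def by (subst sum.union_disjoint[symmetric])
      (auto intro!: sum.cong intro: finite_subset[of _ "{-int N..int N}"])
  then show ?thesis using sum_multiples_le sum_nonmultiples_le by linarith
qed

end

text \<open>The v-th powers make the sum over fractions integrable with the right power of N; the
  root 1/v is taken back in the pointwise bound. The argument is 2t because differencing produces
  the frequency 2 h t.\<close>

definition arc_sum :: "nat \<Rightarrow> real \<Rightarrow> real \<Rightarrow> real" where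
  "arc_sum N v t = (\<Sum>q\<in>{1..2 * int N}. \<Sum>a\<in>{- 3 * q..3 * q}.
     (((real N)\<^sup>2 / of_int q) / (1 + (real N)\<^sup>2 * \<bar>2 * t - of_int a / of_int q\<bar>)) powr v)"

lemma arc_sum_nonneg: "0 \<le> arc_sum N v t"
  unfolding arc_sum_def by (intro sum_nonneg) auto

lemma arc_sum_measurable [measurable]: "arc_sum N v \<in> borel_measurable borel"
  unfolding arc_sum_def[abs_def] by measurable

text \<open>A sum of nonnegative terms dominates the one belonging to the Dirichlet fraction of 2t.
  Positivity is recorded because the kernel bound \<kappa> built from \<open>arc_sum\<close> has to
  be positive.\<close>

lemma theta_sq_le_arc_sum:
  fixes s v :: real
  assumes s: "s > 0" and v: "v > 0"
  shows "\<exists>C>0. \<forall>N\<ge>1. \<forall>x t. \<bar>t\<bar> \<le> 1 \<longrightarrow> 0 < arc_sum N v t \<and> (norm (theta s N x t))\<^sup>2 \<le> C * arc_sum N v t powr (1 / v)"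
proof -
  obtain C where C: "C > 0" "\<And>N x t. N \<ge> 1 \<Longrightarrow> (norm (theta s N x t))\<^sup>2 \<le> C * resonance_sum N (2 * t)"
    using theta_le_resonance_sum[OF s] by auto
  have "0 < arc_sum N v t \<and> (norm (theta s N x t))\<^sup>2 \<le> (C * 487) * arc_sum N v t powr (1 / v)"
    if N: "N \<ge> 1" and t: "\<bar>t\<bar> \<le> 1" for N :: nat and x t :: real
  proof -
    \<comment> \<open>Approximation at level 2N rather than N yields \<beta> <= 1/(2 q N), so that
      |h| \<beta> is at most half of 1/q for |h| <= N.\<close>
    have "2 * N > 0" using N by simp
    then obtain a q where aq: "coprime a q" "0 < q" "q \<le> int (2 * N)"
      "\<bar>of_int q * (2 * t) - of_int a\<bar> < 1 / real (2 * N)"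
      by (rule Dirichlet_approx_coprime)
    have q0: "0 < real_of_int q" using aq by simp
    define \<beta> where "\<beta> = \<bar>2 * t - of_int a / of_int q\<bar>"
    have "of_int q * \<beta> = \<bar>of_int q * (2 * t) - of_int a\<bar>"
    proof -
      have "of_int q * (2 * t) - of_int a = of_int q * (2 * t - of_int a / of_int q)" using q0 by (simp add: field_simps)
      then show ?thesis using q0 unfolding \<beta>_def by (simp add: abs_mult)
    qed
    with aq(4) have "of_int q * \<beta> \<le> 1 / real (2 * N)" by linarith
    then have b: "\<beta> \<le> 1 / (2 * of_int q * real N)" using q0 N by (simp add: field_simps)
    define Y where "Y = ((real N)\<^sup>2 / of_int q) / (1 + (real N)\<^sup>2 * \<beta>)"
    have Y: "0 < Y" using N q0 unfolding Y_def by (intro divide_pos_pos add_pos_nonneg) (auto simp: \<beta>_def)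
    have "q \<le> 2 * int N" using aq by simp
    from resonance_sum_le[OF N aq(2) this aq(1) \<beta>_def b] have S: "resonance_sum N (2 * t) \<le> 487 * Y"
      by (simp add: Y_def)
    \<comment> \<open>From |t| <= 1 one gets |a| <= 2q + 1 <= 3q, which explains the range of a in
      \<open>arc_sum\<close>.\<close>
    have a3: "a \<in> {- 3 * q..3 * q}"
    proof -
      have "1 / real (2 * N) \<le> 1" using N by simp
      with aq(4) have "\<bar>of_int q * (2 * t) - of_int a\<bar> \<le> 1" by linarith
      moreover have "\<bar>of_int q * (2 * t)\<bar> \<le> 2 * of_int q" using t q0 by (simp add: abs_mult)
      ultimately have "\<bar>real_of_int a\<bar> \<le> 2 * of_int q + 1" by linarith
      then have "\<bar>real_of_int a\<bar> \<le> 3 * of_int q" using aq(2) by linarith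
      then show ?thesis by auto
    qed
    have "Y powr v \<le> (\<Sum>a\<in>{- 3 * q..3 * q}.
        (((real N)\<^sup>2 / of_int q) / (1 + (real N)\<^sup>2 * \<bar>2 * t - of_int a / of_int q\<bar>)) powr v)"
      unfolding Y_def \<beta>_def using a3 by (intro member_le_sum) auto
    also have "\<dots> \<le> arc_sum N v t"
      unfolding arc_sum_def using aq by (intro member_le_sum[of q "{1..2 * int N}" "\<lambda>q. \<Sum>a\<in>{- 3 * q..3 * q}.
     (((real N)\<^sup>2 / of_int q) / (1 + (real N)\<^sup>2 * \<bar>2 * t - of_int a / of_int q\<bar>)) powr v"] sum_nonneg) auto
    finally have YG: "Y powr v \<le> arc_sum N v t" .
    then have "(Y powr v) powr (1 / v) \<le> arc_sum N v t powr (1 / v)" using v by (intro powr_mono2) auto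
    then have "Y \<le> arc_sum N v t powr (1 / v)" using Y v by (simp add: powr_powr)
    then have "C * resonance_sum N (2 * t) \<le> C * (487 * arc_sum N v t powr (1 / v))"
      using S C by (intro mult_left_mono) auto
    moreover have "0 < Y powr v" using Y by simp
    then have "0 < arc_sum N v t" using YG by linarith
    ultimately show ?thesis using C(2)[OF N, of x t] by simp
  qed
  with C(1) show ?thesis by (intro exI[of _ "C * 487"]) auto
qed

section \<open>The integral of the summed majorant over the line\<close>

lemma nn_integral_inverse_one_plus_square: "(\<integral>\<^sup>+x. ennreal (1 / (1 + x\<^sup>2)) \<partial>lborel) = ennreal pi"
proof -
  have half: "(\<integral>\<^sup>+x. ennreal (1 / (1 + x\<^sup>2)) * indicator {0..} x \<partial>lborel) = ennreal (pi / 2)"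
  proof -
    have "(\<integral>\<^sup>+x. ennreal (1 / (1 + x\<^sup>2)) * indicator {0..} x \<partial>lborel) = ennreal (pi / 2 - arctan 0)"
      by (rule nn_integral_FTC_atLeast)
         (auto intro!: derivative_eq_intros tendsto_arctan_at_top simp: inverse_eq_divide)
    then show ?thesis by simp
  qed
  have half': "(\<integral>\<^sup>+x. ennreal (1 / (1 + x\<^sup>2)) * indicator {..0} x \<partial>lborel) = ennreal (pi / 2)"
    unfolding half[symmetric] by (subst nn_integral_real_affine[where c = "-1" and t = 0]) (auto intro!: nn_integral_cong simp: indicator_def)
  have "(\<integral>\<^sup>+x. ennreal (1 / (1 + x\<^sup>2)) \<partial>lborel) =
     (\<integral>\<^sup>+x. ennreal (1 / (1 + x\<^sup>2)) * indicator {0..} x + ennreal (1 / (1 + x\<^sup>2)) * indicator {..0} x \<partial>lborel)"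
    by (rule nn_integral_cong_AE, rule AE_I[where N = "{0}"]) (auto simp: indicator_def split: if_splits)
  also have "\<dots> = ennreal (pi / 2) + ennreal (pi / 2)"
    by (subst nn_integral_add) (auto simp: half half')
  also have "\<dots> = ennreal pi" by (subst ennreal_plus[symmetric]) auto
  finally show ?thesis .
qed

text \<open>For u >= 0 and v >= 2 one has (1 + u)^v >= 1 + u^2, which reduces every peak to the
  Cauchy density under an affine substitution of slope 2M.\<close>

lemma nn_integral_peak_le:
  fixes X M c v :: real
  assumes "X \<ge> 0" "M > 0" "v \<ge> 2"
  shows "(\<integral>\<^sup>+t. ennreal ((X / (1 + M * \<bar>2 * t - c\<bar>)) powr v) \<partial>lborel) \<le> ennreal (X powr v * (pi / (2 * M)))"
proof -
  have le: "(X / (1 + M * \<bar>2 * t - c\<bar>)) powr v \<le> X powr v * (1 / (1 + (- M * c + (2 * M) * t)\<^sup>2))" for t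
  proof -
    define u where "u = M * \<bar>2 * t - c\<bar>"
    have u: "u \<ge> 0" using assms by (simp add: u_def)
    have u2: "u\<^sup>2 = (- M * c + (2 * M) * t)\<^sup>2"
    proof -
      have "u = \<bar>- M * c + (2 * M) * t\<bar>" using assms by (simp add: u_def abs_mult_pos' algebra_simps)
      then show ?thesis by simp
    qed
    have "1 + u\<^sup>2 \<le> (1 + u)\<^sup>2" using u by (simp add: power2_eq_square algebra_simps)
    also have "\<dots> = (1 + u) powr 2" using u by (simp add: powr_numeral)
    also have "\<dots> \<le> (1 + u) powr v" using u assms by (intro powr_mono) auto
    finally have "1 + u\<^sup>2 \<le> (1 + u) powr v" .
    moreover have "0 < 1 + u\<^sup>2" by (simp add: add_pos_nonneg)
    ultimately have "X powr v / (1 + u) powr v \<le> X powr v / (1 + u\<^sup>2)"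
      using u by (intro divide_left_mono mult_pos_pos) auto
    then show ?thesis using u assms unfolding u_def[symmetric] u2[symmetric] by (simp add: powr_divide)
  qed
  have "ennreal pi = (\<integral>\<^sup>+x. ennreal (1 / (1 + x\<^sup>2)) \<partial>lborel)"
    by (rule nn_integral_inverse_one_plus_square[symmetric])
  also have "\<dots> = ennreal \<bar>2 * M\<bar> * (\<integral>\<^sup>+t. ennreal (1 / (1 + (- M * c + (2 * M) * t)\<^sup>2)) \<partial>lborel)"
    using assms by (intro nn_integral_real_affine) auto
  finally have "ennreal (1 / (2 * M)) * ennreal pi = (ennreal (1 / (2 * M)) * ennreal \<bar>2 * M\<bar>) * (\<integral>\<^sup>+t. ennreal (1 / (1 + (- M * c + (2 * M) * t)\<^sup>2)) \<partial>lborel)"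
    by (simp add: mult.assoc)
  also have "ennreal (1 / (2 * M)) * ennreal \<bar>2 * M\<bar> = 1"
    using assms by (subst ennreal_mult[symmetric]) auto
  finally have I: "(\<integral>\<^sup>+t. ennreal (1 / (1 + (- M * c + (2 * M) * t)\<^sup>2)) \<partial>lborel) = ennreal (pi / (2 * M))"
    using assms by (simp add: ennreal_mult[symmetric])
  have "(\<integral>\<^sup>+t. ennreal ((X / (1 + M * \<bar>2 * t - c\<bar>)) powr v) \<partial>lborel) \<le>
      (\<integral>\<^sup>+t. ennreal (X powr v) * ennreal (1 / (1 + (- M * c + (2 * M) * t)\<^sup>2)) \<partial>lborel)"
    using le by (intro nn_integral_mono) (simp add: ennreal_mult[symmetric] ennreal_leI)
  also have "\<dots> = ennreal (X powr v) * ennreal (pi / (2 * M))"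
    by (subst nn_integral_cmult, measurable) (simp only: I)
  also have "\<dots> = ennreal (X powr v * (pi / (2 * M)))"
    using assms by (subst ennreal_mult[symmetric]) auto
  finally show ?thesis .
qed

text \<open>A peak at a/q has integral of order (N^2/q)^v / N^2, and q has at most 7q numerators. Up
  to the power of N it contributes q^(1 - v), the term of a convergent series when v > 2.\<close>

lemma nn_integral_arc_sum_le:
  fixes v :: real
  assumes v: "v > 2"
  shows "\<exists>C>0. \<forall>N\<ge>1. (\<integral>\<^sup>+t. ennreal (arc_sum N v t) \<partial>lborel) \<le> ennreal (C * real N powr (2 * v - 2))"
proof -
  \<comment> \<open>The term n = 0 is harmless, as 0 powr (1 - v) is 0. The constant below uses Z +
    1, which is visibly positive.\<close>
  define Z where "Z = (\<Sum>n. real n powr (1 - v))"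
  have sm: "summable (\<lambda>n. real n powr (1 - v))" using v by (simp add: summable_real_powr_iff)
  have "(\<integral>\<^sup>+t. ennreal (arc_sum N v t) \<partial>lborel) \<le> ennreal ((7 * pi * (Z + 1)) * real N powr (2 * v - 2))"
    if N: "N \<ge> 1" for N
  proof -
    let ?g = "\<lambda>q a t. (((real N)\<^sup>2 / of_int q) / (1 + (real N)\<^sup>2 * \<bar>2 * t - of_int a / of_int q\<bar>)) powr v"
    define w where "w q = ((real N)\<^sup>2 / of_int q) powr v * (pi / (2 * (real N)\<^sup>2))" for q :: int
    have w0: "0 \<le> w q" for q by (simp add: w_def)
    have "(\<integral>\<^sup>+t. ennreal (arc_sum N v t) \<partial>lborel) = (\<integral>\<^sup>+t. (\<Sum>q\<in>{1..2 * int N}. \<Sum>a\<in>{- 3 * q..3 * q}. ennreal (?g q a t)) \<partial>lborel)"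
      unfolding arc_sum_def by (intro nn_integral_cong) (simp add: sum_nonneg sum_ennreal del: sum_ennreal add: sum_ennreal[symmetric])
    also have "\<dots> = (\<Sum>q\<in>{1..2 * int N}. \<Sum>a\<in>{- 3 * q..3 * q}. \<integral>\<^sup>+t. ennreal (?g q a t) \<partial>lborel)"
      by (subst nn_integral_sum, measurable, intro sum.cong refl, subst nn_integral_sum) auto
    also have "\<dots> \<le> (\<Sum>q\<in>{1..2 * int N}. \<Sum>a\<in>{- 3 * q..3 * q}. ennreal (w q))"
      unfolding w_def using N v by (intro sum_mono nn_integral_peak_le) auto
    also have "\<dots> = ennreal (\<Sum>q\<in>{1..2 * int N}. \<Sum>a\<in>{- 3 * q..3 * q}. w q)"
      using w0 by (simp add: sum_nonneg sum_ennreal[symmetric] del: sum_ennreal sum_constant)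
    also have "\<dots> \<le> ennreal ((7 * pi * (Z + 1)) * real N powr (2 * v - 2))"
    proof (rule ennreal_leI)
      have "(\<Sum>q\<in>{1..2 * int N}. \<Sum>a\<in>{- 3 * q..3 * q}. w q) = (\<Sum>q\<in>{1..2 * int N}. (6 * of_int q + 1) * w q)"
        by (intro sum.cong) auto
      also have "\<dots> \<le> (\<Sum>q\<in>{1..2 * int N}. (7 * pi / 2 * real N powr (2 * v - 2)) * of_int q powr (1 - v))"
      proof (rule sum_mono)
        fix q :: int assume "q \<in> {1..2 * int N}"
        then have q: "1 \<le> real_of_int q" by auto
        have "real N powr (2 * v - 2) = real N powr (2 * v) / (real N)\<^sup>2"
          using N by (simp add: powr_diff powr_numeral)
        moreover have "((real N)\<^sup>2) powr v = real N powr (2 * v)"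
          using N by (simp add: powr_numeral[symmetric] powr_powr del: powr_numeral)
        ultimately have w: "w q = pi / 2 * real N powr (2 * v - 2) * of_int q powr (- v)"
          using q N unfolding w_def by (simp add: powr_divide powr_minus_divide mult_ac)
        have "(6 * of_int q + 1) * w q \<le> (7 * of_int q) * w q" using q w0 by (intro mult_right_mono) auto
        also have "\<dots> = (7 * pi / 2 * real N powr (2 * v - 2)) * (of_int q powr 1 * of_int q powr (- v))"
          using q unfolding w by simp
        also have "of_int q powr 1 * of_int q powr (- v) = of_int q powr (1 - v)"
          using q by (simp only: powr_add[symmetric]) simp
        finally show "(6 * of_int q + 1) * w q \<le> (7 * pi / 2 * real N powr (2 * v - 2)) * of_int q powr (1 - v)" .
      qed
      also have "\<dots> = (7 * pi / 2 * real N powr (2 * v - 2)) * (\<Sum>q\<in>{1..2 * int N}. of_int q powr (1 - v))"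
        by (rule sum_distrib_left[symmetric])
      also have "(\<Sum>q\<in>{1..2 * int N}. of_int q powr (1 - v)) = (\<Sum>n\<in>{1..2 * N}. real n powr (1 - v))"
        by (rule sum.reindex_bij_witness[of _ int nat]) auto
      also have "(7 * pi / 2 * real N powr (2 * v - 2)) * (\<Sum>n\<in>{1..2 * N}. real n powr (1 - v)) \<le> (7 * pi / 2 * real N powr (2 * v - 2)) * Z"
        unfolding Z_def by (intro mult_left_mono sum_le_suminf sm) auto
      also have "(7 * pi / 2 * real N powr (2 * v - 2)) * Z \<le> (7 * pi * (Z + 1)) * real N powr (2 * v - 2)"
      proof -
        have "0 \<le> Z" unfolding Z_def by (intro suminf_nonneg sm) auto
        then have "7 * pi / 2 * Z \<le> 7 * pi * (Z + 1)" by (simp add: algebra_simps)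
        then have "(7 * pi / 2 * Z) * real N powr (2 * v - 2) \<le> 7 * pi * (Z + 1) * real N powr (2 * v - 2)"
          by (intro mult_right_mono) auto
        then show ?thesis by (simp add: mult_ac)
      qed
      finally show "(\<Sum>q\<in>{1..2 * int N}. \<Sum>a\<in>{- 3 * q..3 * q}. w q) \<le> (7 * pi * (Z + 1)) * real N powr (2 * v - 2)" .
    qed
    finally show ?thesis .
  qed
  moreover have "0 \<le> Z" unfolding Z_def by (intro suminf_nonneg sm) auto
  ultimately show ?thesis by (intro exI[of _ "7 * pi * (Z + 1)"]) auto
qed

section \<open>Interpolation between $L^1$ and $L^2$\<close>

lemma nn_integral_powr_Icc:
  fixes a c :: real
  assumes "a > -1" "c \<ge> 0"
  shows "(\<integral>\<^sup>+r. ennreal (r powr a) * indicator {0..c} r \<partial>lborel) = ennreal (c powr (a + 1) / (a + 1))"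
  by (rule nn_integral_has_integral_lebesgue'[OF _ has_integral_powr_from_0[OF assms]]) simp

lemma (in finite_measure) integrable_of_integrable_powr:
  fixes h :: "'a \<Rightarrow> complex" and q :: real
  assumes q: "1 < q" and [measurable]: "h \<in> borel_measurable M" and "integrable M (\<lambda>x. norm (h x) powr q)"
  shows "integrable M h"
proof (rule Bochner_Integration.integrable_bound)
  show "integrable M (\<lambda>x. 1 + norm (h x) powr q)" using assms by simp
  have "t \<le> 1 + t powr q" if "t \<ge> 0" for t :: real
  proof (cases "t \<le> 1")
    case True then show ?thesis using powr_ge_zero[of t q] by linarith
  next
    case False
    then have "t powr 1 \<le> t powr q" using q by (intro powr_mono) auto
    with False show ?thesis by simp
  qed
  then show "AE x in M. norm (h x) \<le> norm (1 + norm (h x) powr q)" by (intro AE_I2) (simp add: abs_of_nonneg)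
qed simp

text \<open>The inequality with free e > 0 is boundedness on L^2 with norm 1: optimising e gives the
  product of the norms. In the additive form both sides remain integrals, so e may depend on a level
  r and the bound can be integrated over r. It is asked for bounded functions only, which layers of
  f and truncations of g are.\<close>

locale bounded_kernel = finite_measure M for M :: "'a measure" +
  fixes k :: "'a \<times> 'a \<Rightarrow> complex" and \<kappa> :: real
  assumes k_measurable [measurable]: "k \<in> borel_measurable (M \<Otimes>\<^sub>M M)"
    and \<kappa>: "\<kappa> > 0" and k_le: "\<And>z. norm (k z) \<le> \<kappa>"
    and L2_bound: "\<And>\<phi> \<psi> e. \<phi> \<in> borel_measurable M \<Longrightarrow> \<psi> \<in> borel_measurable M \<Longrightarrow>
       (\<exists>B. \<forall>x. norm (\<phi> x) \<le> B) \<Longrightarrow> (\<exists>B. \<forall>x. norm (\<psi> x) \<le> B) \<Longrightarrow> (e::real) > 0 \<Longrightarrow>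
       norm (\<integral>x. \<phi> x * (\<integral>y. k (x, y) * \<psi> y \<partial>M) \<partial>M)
         \<le> (e * (\<integral>x. (norm (\<phi> x))\<^sup>2 \<partial>M) + (\<integral>x. (norm (\<psi> x))\<^sup>2 \<partial>M) / e) / 2"
begin

definition T :: "('a \<Rightarrow> complex) \<Rightarrow> 'a \<Rightarrow> complex" where
  "T g x = (\<integral>y. k (x, y) * g y \<partial>M)"

lemma T_measurable [measurable]:
  assumes [measurable]: "g \<in> borel_measurable M"
  shows "T g \<in> borel_measurable M"
  unfolding T_def[abs_def] by measurable

lemma integrable_k_mult:
  assumes "integrable M g" "x \<in> space M"
  shows "integrable M (\<lambda>y. k (x, y) * g y)"
proof (rule Bochner_Integration.integrable_bound)
  have [measurable]: "g \<in> borel_measurable M" using assms by simp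
  show "integrable M (\<lambda>y. \<kappa> * norm (g y))" using assms by simp
  show "(\<lambda>y. k (x, y) * g y) \<in> borel_measurable M" using assms(2) by measurable
  show "AE y in M. norm (k (x, y) * g y) \<le> norm (\<kappa> * norm (g y))"
    using k_le \<kappa> by (auto simp: norm_mult mult_right_mono)
qed

lemma norm_T_le:
  assumes "integrable M g" "x \<in> space M"
  shows "norm (T g x) \<le> \<kappa> * (\<integral>y. norm (g y) \<partial>M)"
proof -
  have "norm (T g x) \<le> (\<integral>y. norm (k (x, y) * g y) \<partial>M)" unfolding T_def by (rule integral_norm_bound)
  also have "\<dots> \<le> (\<integral>y. \<kappa> * norm (g y) \<partial>M)"
    using assms k_le
    by (intro integral_mono integrable_norm integrable_k_mult) (auto simp: norm_mult mult_right_mono)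
  finally show ?thesis by simp
qed

lemma integrable_mult_T:
  assumes "integrable M f" "integrable M g"
  shows "integrable M (\<lambda>x. f x * T g x)"
proof (rule Bochner_Integration.integrable_bound)
  have [measurable]: "f \<in> borel_measurable M" "g \<in> borel_measurable M" using assms by auto
  show "integrable M (\<lambda>x. norm (f x) * (\<kappa> * (\<integral>y. norm (g y) \<partial>M)))" using assms by simp
  show "(\<lambda>x. f x * T g x) \<in> borel_measurable M" by measurable
  have "0 \<le> \<kappa> * (\<integral>y. norm (g y) \<partial>M)" using \<kappa> by simp
  then show "AE x in M. norm (f x * T g x) \<le> norm (norm (f x) * (\<kappa> * (\<integral>y. norm (g y) \<partial>M)))"
    using norm_T_le[OF assms(2)] by (intro AE_I2) (auto simp: norm_mult mult_left_mono)
qed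

lemma norm_integral_T_le_L1:
  assumes "integrable M f" "integrable M g"
  shows "norm (\<integral>x. f x * T g x \<partial>M) \<le> \<kappa> * (\<integral>x. norm (f x) \<partial>M) * (\<integral>y. norm (g y) \<partial>M)"
proof -
  have "norm (\<integral>x. f x * T g x \<partial>M) \<le> (\<integral>x. norm (f x * T g x) \<partial>M)" by (rule integral_norm_bound)
  also have "\<dots> \<le> (\<integral>x. norm (f x) * (\<kappa> * (\<integral>y. norm (g y) \<partial>M)) \<partial>M)"
    using assms norm_T_le[OF assms(2)]
    by (intro integral_mono integrable_norm integrable_mult_T) (auto simp: norm_mult mult_left_mono)
  finally show ?thesis by (simp add: mult_ac)
qed

section \<open>Layer-cake interpolation of the bilinear form\<close>

context
  fixes q :: real and f g :: "'a \<Rightarrow> complex"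
  assumes q: "1 < q" "q < 2"
    and f_measurable [measurable]: "f \<in> borel_measurable M" and g_measurable [measurable]: "g \<in> borel_measurable M"
    and f_q: "integrable M (\<lambda>x. norm (f x) powr q)" and g_q: "integrable M (\<lambda>x. norm (g x) powr q)"
begin

lemma f_int: "integrable M f" and g_int: "integrable M g"
  by (rule integrable_of_integrable_powr[OF q(1) f_measurable f_q], rule integrable_of_integrable_powr[OF q(1) g_measurable g_q])

text \<open>The condition 0 < r lets the layers be integrated over all of
  \<open>lborel\<close>.\<close>

definition "slice r x = (if 0 < r \<and> r < norm (f x) then sgn (f x) else 0)"

lemma slice_measurable [measurable]: "case_prod slice \<in> borel_measurable (lborel \<Otimes>\<^sub>M M)"
  unfolding slice_def[abs_def] by measurable

lemma slice_measurable' [measurable]: "slice r \<in> borel_measurable M"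
  unfolding slice_def[abs_def] by measurable

lemma slice_measurable'' [measurable]: "(\<lambda>r. slice r x) \<in> borel_measurable borel"
  unfolding slice_def[abs_def] by measurable

lemma norm_slice: "norm (slice r x) = (if 0 < r \<and> r < norm (f x) then 1 else 0)"
  unfolding slice_def by (auto simp: norm_sgn)

lemma norm_slice_le: "norm (slice r x) \<le> 1"
  by (simp add: norm_slice)

lemma integrable_bounded_M:
  assumes "h \<in> borel_measurable M" "\<And>x. norm (h x :: 'b::{banach, second_countable_topology}) \<le> B"
  shows "integrable M h"
  using assms by (intro integrable_const_bound[of _ B]) auto

lemma integral_slice: "(\<integral>r. slice r x \<partial>lborel) = f x" 
proof -
  have "(\<integral>r. slice r x \<partial>lborel) = (\<integral>r. indicator {0<..<norm (f x)} r *\<^sub>R sgn (f x) \<partial>lborel)"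
    by (intro Bochner_Integration.integral_cong) (auto simp: slice_def indicator_def)
  also have "\<dots> = norm (f x) *\<^sub>R sgn (f x)" by simp
  also have "\<dots> = f x" by (cases "f x = 0") (auto simp: sgn_div_norm)
  finally show ?thesis .
qed

lemma nn_integral_norm_slice: "(\<integral>\<^sup>+r. ennreal (norm (slice r x)) \<partial>lborel) = ennreal (norm (f x))"
proof -
  have "(\<integral>\<^sup>+r. ennreal (norm (slice r x)) \<partial>lborel) = (\<integral>\<^sup>+r. indicator {0<..<norm (f x)} r \<partial>lborel)"
    by (intro nn_integral_cong) (auto simp: norm_slice indicator_def)
  then show ?thesis by simp
qed

text \<open>The layer-cake decomposition \<open>f = \<integral> slice r dr\<close> reduces the form to unimodular functions.\<close>
lemma slice_Fubini:
  "integrable lborel (\<lambda>r. \<integral>x. slice r x * T g x \<partial>M)"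
  "(\<integral>x. f x * T g x \<partial>M) = (\<integral>r. (\<integral>x. slice r x * T g x \<partial>M) \<partial>lborel)"
proof -
  interpret P: pair_sigma_finite lborel M by unfold_locales
  define B where "B = \<kappa> * (\<integral>y. norm (g y) \<partial>M)"
  have B: "B \<ge> 0" using \<kappa> by (simp add: B_def)
  have int: "integrable (lborel \<Otimes>\<^sub>M M) (\<lambda>(r, x). slice r x * T g x)"
  proof (rule integrableI_bounded)
    show "(\<lambda>(r, x). slice r x * T g x) \<in> borel_measurable (lborel \<Otimes>\<^sub>M M)" by measurable
    have "(\<integral>\<^sup>+z. ennreal (norm (case z of (r, x) \<Rightarrow> slice r x * T g x)) \<partial>(lborel \<Otimes>\<^sub>M M)) =
      (\<integral>\<^sup>+x. \<integral>\<^sup>+r. ennreal (norm (slice r x * T g x)) \<partial>lborel \<partial>M)"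
      by (subst P.nn_integral_snd[symmetric]) auto
    also have "\<dots> \<le> (\<integral>\<^sup>+x. \<integral>\<^sup>+r. ennreal (norm (slice r x)) * ennreal B \<partial>lborel \<partial>M)"
      using norm_T_le[OF g_int] B unfolding B_def[symmetric]
      by (intro nn_integral_mono) (auto simp: norm_mult ennreal_mult[symmetric] intro!: ennreal_leI mult_left_mono)
    also have "\<dots> = (\<integral>\<^sup>+x. ennreal (norm (f x)) * ennreal B \<partial>M)"
      by (subst nn_integral_multc) (auto simp: nn_integral_norm_slice)
    also have "\<dots> = (\<integral>\<^sup>+x. ennreal (norm (f x)) \<partial>M) * ennreal B"
      by (rule nn_integral_multc) auto
    also have "\<dots> < \<infinity>" using f_int by (simp add: integrable_iff_bounded ennreal_mult_less_top)
    finally show "(\<integral>\<^sup>+z. ennreal (norm (case z of (r, x) \<Rightarrow> slice r x * T g x)) \<partial>(lborel \<Otimes>\<^sub>M M)) < \<infinity>" .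
  qed
  show "integrable lborel (\<lambda>r. \<integral>x. slice r x * T g x \<partial>M)"
    using P.integrable_fst[OF int] by simp
  have "(\<integral>x. f x * T g x \<partial>M) = (\<integral>x. (\<integral>r. slice r x * T g x \<partial>lborel) \<partial>M)"
    by (simp add: integral_slice)
  also have "\<dots> = (\<integral>r. (\<integral>x. slice r x * T g x \<partial>M) \<partial>lborel)"
    by (rule P.Fubini_integral[OF int])
  finally show "(\<integral>x. f x * T g x \<partial>M) = (\<integral>r. (\<integral>x. slice r x * T g x \<partial>M) \<partial>lborel)" .
qed

context
  fixes e l :: real
  assumes e: "e > 0" and l: "l > 0"
begin

text \<open>At level r the function g is cut at height l/r: the lower part goes to the L^2 bound,
  the upper part to the L^1 bound. This height guarantees |f| |g| > l wherever the upper part meets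
  the layer of f.\<close>

lemma slice_bound:
  assumes r: "r > 0"
  shows "ennreal (norm (\<integral>x. slice r x * T g x \<partial>M)) \<le>
     (\<integral>\<^sup>+x. ennreal (e / 2) * (ennreal (r powr (q - 1)) * indicator {0..norm (f x)} r) \<partial>M) +
     (\<integral>\<^sup>+y. ennreal ((norm (g y))\<^sup>2 / (2 * e)) * (ennreal (r powr (1 - q)) * indicator {0..l / norm (g y)} r) \<partial>M) +
     (\<integral>\<^sup>+x. (\<integral>\<^sup>+y. ennreal (\<kappa> * l powr (1 - q) * norm (f x) powr (q - 1) * norm (g y) powr q) * ennreal (norm (slice r x)) \<partial>M) \<partial>M)"
proof -
  define g1 where "g1 y = (if r * norm (g y) \<le> l then g y else 0)" for y
  define g2 where "g2 y = (if r * norm (g y) \<le> l then 0 else g y)" for y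
  have [measurable]: "g1 \<in> borel_measurable M" "g2 \<in> borel_measurable M"
    unfolding g1_def[abs_def] g2_def[abs_def] by measurable
  have g1_le: "norm (g1 y) \<le> l / r" for y using r l by (auto simp: g1_def field_simps)
  have g1_int: "integrable M g1" by (rule integrable_bounded_M[OF _ g1_le]) simp
  have g2_int: "integrable M g2"
    by (rule Bochner_Integration.integrable_bound[OF g_int]) (auto simp: g2_def)
  have s_int: "integrable M (slice r)" by (rule integrable_bounded_M[OF _ norm_slice_le]) simp
  have Tadd: "T g x = T g1 x + T g2 x" if "x \<in> space M" for x
  proof -
    have "T g x = (\<integral>y. k (x, y) * g1 y + k (x, y) * g2 y \<partial>M)"
      unfolding T_def by (intro Bochner_Integration.integral_cong) (auto simp: g1_def g2_def)
    also have "\<dots> = T g1 x + T g2 x" unfolding T_def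
      by (intro Bochner_Integration.integral_add integrable_k_mult g1_int g2_int that)
    finally show ?thesis .
  qed
  have "(\<integral>x. slice r x * T g x \<partial>M) = (\<integral>x. slice r x * T g1 x + slice r x * T g2 x \<partial>M)"
    by (intro Bochner_Integration.integral_cong) (auto simp: Tadd distrib_left)
  also have "\<dots> = (\<integral>x. slice r x * T g1 x \<partial>M) + (\<integral>x. slice r x * T g2 x \<partial>M)"
    by (intro Bochner_Integration.integral_add integrable_mult_T s_int g1_int g2_int)
  finally have eq: "(\<integral>x. slice r x * T g x \<partial>M) = \<dots>" .
  have int1: "integrable M (\<lambda>x. (norm (slice r x))\<^sup>2)"
    by (rule integrable_bounded_M[where B = 1]) (auto simp: norm_slice)
  have int2: "integrable M (\<lambda>y. (norm (g1 y))\<^sup>2)"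
    by (rule integrable_bounded_M[where B = "(l / r)\<^sup>2"]) (auto intro!: power_mono g1_le)
  \<comment> \<open>With the weight r^(q - 1), integration over r gives |f|^q from the first term
    and, because 1 - q > -1, a multiple of |g|^q from the second.\<close>
  define e' where "e' = e * r powr (q - 1)"
  have e': "e' > 0" using e r by (simp add: e'_def)
  have "norm (\<integral>x. slice r x * T g1 x \<partial>M) \<le> (e' * (\<integral>x. (norm (slice r x))\<^sup>2 \<partial>M) + (\<integral>y. (norm (g1 y))\<^sup>2 \<partial>M) / e') / 2"
    unfolding T_def using norm_slice_le g1_le e' by (intro L2_bound) auto
  also have "\<dots> = (\<integral>x. e' / 2 * (norm (slice r x))\<^sup>2 \<partial>M) + (\<integral>y. (norm (g1 y))\<^sup>2 / (2 * e') \<partial>M)"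
    using int1 int2 by (simp add: field_simps)
  finally have 1: "ennreal (norm (\<integral>x. slice r x * T g1 x \<partial>M)) \<le>
     (\<integral>\<^sup>+x. ennreal (e' / 2 * (norm (slice r x))\<^sup>2) \<partial>M) + (\<integral>\<^sup>+y. ennreal ((norm (g1 y))\<^sup>2 / (2 * e')) \<partial>M)"
    using int1 int2 e' by (subst (1 2) nn_integral_eq_integral) (auto simp: ennreal_plus[symmetric] ennreal_leI simp del: ennreal_plus)
  have 1: "ennreal (norm (\<integral>x. slice r x * T g1 x \<partial>M)) \<le>
     (\<integral>\<^sup>+x. ennreal (e / 2) * (ennreal (r powr (q - 1)) * indicator {0..norm (f x)} r) \<partial>M) +
     (\<integral>\<^sup>+y. ennreal ((norm (g y))\<^sup>2 / (2 * e)) * (ennreal (r powr (1 - q)) * indicator {0..l / norm (g y)} r) \<partial>M)"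
  proof (rule order.trans[OF 1], intro add_mono nn_integral_mono)
    fix x
    show "ennreal (e' / 2 * (norm (slice r x))\<^sup>2) \<le> ennreal (e / 2) * (ennreal (r powr (q - 1)) * indicator {0..norm (f x)} r)"
      using r e by (auto simp: norm_slice e'_def ennreal_mult[symmetric] indicator_def)
    show "ennreal ((norm (g1 x))\<^sup>2 / (2 * e')) \<le> ennreal ((norm (g x))\<^sup>2 / (2 * e)) * (ennreal (r powr (1 - q)) * indicator {0..l / norm (g x)} r)"
    proof (cases "r * norm (g x) \<le> l \<and> g x \<noteq> 0")
      case True
      then have "r \<in> {0..l / norm (g x)}" using r by (simp add: field_simps)
      moreover have "r powr (1 - q) = 1 / r powr (q - 1)" using r by (simp add: powr_diff)
      ultimately show ?thesis using True r e by (simp add: g1_def e'_def ennreal_mult[symmetric])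
    qed (auto simp: g1_def)
  qed
  have "norm (\<integral>x. slice r x * T g2 x \<partial>M) \<le> \<kappa> * (\<integral>x. norm (slice r x) \<partial>M) * (\<integral>y. norm (g2 y) \<partial>M)"
    by (rule norm_integral_T_le_L1[OF s_int g2_int])
  then have "ennreal (norm (\<integral>x. slice r x * T g2 x \<partial>M)) \<le> ennreal \<kappa> * (\<integral>\<^sup>+x. ennreal (norm (slice r x)) \<partial>M) * (\<integral>\<^sup>+y. ennreal (norm (g2 y)) \<partial>M)"
    using s_int g2_int \<kappa> by (subst (1 2) nn_integral_eq_integral) (auto simp: ennreal_mult[symmetric] ennreal_leI)
  also have "\<dots> = (\<integral>\<^sup>+x. (\<integral>\<^sup>+y. ennreal \<kappa> * ennreal (norm (slice r x)) * ennreal (norm (g2 y)) \<partial>M) \<partial>M)"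
    by (simp add: nn_integral_cmult nn_integral_multc)
  also have "\<dots> \<le> (\<integral>\<^sup>+x. (\<integral>\<^sup>+y. ennreal (\<kappa> * l powr (1 - q) * norm (f x) powr (q - 1) * norm (g y) powr q) * ennreal (norm (slice r x)) \<partial>M) \<partial>M)"
  proof (intro nn_integral_mono)
    fix x y
    show "ennreal \<kappa> * ennreal (norm (slice r x)) * ennreal (norm (g2 y)) \<le>
       ennreal (\<kappa> * l powr (1 - q) * norm (f x) powr (q - 1) * norm (g y) powr q) * ennreal (norm (slice r x))"
    proof (cases "r < norm (f x) \<and> r * norm (g y) > l")
      case True
      \<comment> \<open>On this set |f| |g| > l, so the factor (|f| |g| / l)^(q - 1) is at least 1
        and may be inserted; it turns |g| into |f|^(q - 1) |g|^q.\<close>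
      define u where "u = norm (f x) * norm (g y)"
      have gp: "norm (g y) > 0" using True l r by (cases "g y = 0") auto
      have fp: "norm (f x) > 0" using True r by linarith
      have "l < r * norm (g y)" using True by simp
      also have "\<dots> \<le> u" unfolding u_def using True gp by (intro mult_right_mono) auto
      finally have "l powr (q - 1) \<le> u powr (q - 1)" using l q by (intro powr_mono2) auto
      then have "l powr (1 - q) * l powr (q - 1) \<le> l powr (1 - q) * u powr (q - 1)"
        by (intro mult_left_mono) auto
      moreover have "l powr (1 - q) * l powr (q - 1) = 1" using l by (simp add: powr_add[symmetric])
      ultimately have "1 \<le> l powr (1 - q) * u powr (q - 1)" by simp
      then have "norm (g y) * 1 \<le> norm (g y) * (l powr (1 - q) * u powr (q - 1))"
        by (intro mult_left_mono) auto
      also have "\<dots> = l powr (1 - q) * norm (f x) powr (q - 1) * norm (g y) powr q"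
        using gp fp unfolding u_def by (simp add: powr_mult powr_diff)
      finally have "\<kappa> * norm (g y) \<le> \<kappa> * (l powr (1 - q) * norm (f x) powr (q - 1) * norm (g y) powr q)"
        using \<kappa> by (intro mult_left_mono) auto
      then show ?thesis using True r \<kappa>
        by (auto simp: norm_slice g2_def ennreal_mult[symmetric] mult.assoc intro!: ennreal_leI)
    qed (auto simp: norm_slice g2_def)
  qed
  finally have 2: "ennreal (norm (\<integral>x. slice r x * T g2 x \<partial>M)) \<le>
     (\<integral>\<^sup>+x. (\<integral>\<^sup>+y. ennreal (\<kappa> * l powr (1 - q) * norm (f x) powr (q - 1) * norm (g y) powr q) * ennreal (norm (slice r x)) \<partial>M) \<partial>M)" .
  have "ennreal (norm (\<integral>x. slice r x * T g x \<partial>M)) \<le>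
      ennreal (norm (\<integral>x. slice r x * T g1 x \<partial>M)) + ennreal (norm (\<integral>x. slice r x * T g2 x \<partial>M))"
    unfolding eq by (simp only: ennreal_plus[symmetric] norm_ge_zero) (rule ennreal_leI[OF norm_triangle_ineq])
  also have "\<dots> \<le> (\<integral>\<^sup>+x. ennreal (e / 2) * (ennreal (r powr (q - 1)) * indicator {0..norm (f x)} r) \<partial>M) +
     (\<integral>\<^sup>+y. ennreal ((norm (g y))\<^sup>2 / (2 * e)) * (ennreal (r powr (1 - q)) * indicator {0..l / norm (g y)} r) \<partial>M) +
     (\<integral>\<^sup>+x. (\<integral>\<^sup>+y. ennreal (\<kappa> * l powr (1 - q) * norm (f x) powr (q - 1) * norm (g y) powr q) * ennreal (norm (slice r x)) \<partial>M) \<partial>M)"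
    by (rule add_mono[OF 1 2])
  finally show ?thesis .
qed

text \<open>Each term of \<open>slice_bound\<close> is integrated over r first, by Tonelli: the
  first two are integrals of powers of r, and in the third the layers integrate to |f|, which
  completes |f|^(q - 1) to |f|^q.\<close>

lemma form_le_parameters:
  "norm (\<integral>x. f x * T g x \<partial>M) \<le>
     e / (2 * q) * (\<integral>x. norm (f x) powr q \<partial>M) + l powr (2 - q) / (2 * e * (2 - q)) * (\<integral>y. norm (g y) powr q \<partial>M)
     + \<kappa> * l powr (1 - q) * (\<integral>x. norm (f x) powr q \<partial>M) * (\<integral>y. norm (g y) powr q \<partial>M)"
proof -
  interpret P: pair_sigma_finite lborel M by unfold_locales
  interpret Q: pair_sigma_finite M M by unfold_locales
  define A where "A = (\<integral>x. norm (f x) powr q \<partial>M)"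
  define B where "B = (\<integral>y. norm (g y) powr q \<partial>M)"
  have AB: "0 \<le> A" "0 \<le> B" by (auto simp: A_def B_def)
  have nnA: "(\<integral>\<^sup>+x. ennreal (norm (f x) powr q) \<partial>M) = ennreal A"
    unfolding A_def by (rule nn_integral_eq_integral[OF f_q]) auto
  have nnB: "(\<integral>\<^sup>+x. ennreal (norm (g x) powr q) \<partial>M) = ennreal B"
    unfolding B_def by (rule nn_integral_eq_integral[OF g_q]) auto
  let ?a = "\<lambda>r x. ennreal (e / 2) * (ennreal (r powr (q - 1)) * indicator {0..norm (f x)} r)"
  let ?b = "\<lambda>r y. ennreal ((norm (g y))\<^sup>2 / (2 * e)) * (ennreal (r powr (1 - q)) * indicator {0..l / norm (g y)} r)"
  let ?c = "\<lambda>r x y. ennreal (\<kappa> * l powr (1 - q) * norm (f x) powr (q - 1) * norm (g y) powr q) * ennreal (norm (slice r x))"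
  have ma: "(\<lambda>(r, x). ?a r x) \<in> borel_measurable (lborel \<Otimes>\<^sub>M M)"
    and mb: "(\<lambda>(r, x). ?b r x) \<in> borel_measurable (lborel \<Otimes>\<^sub>M M)"
    unfolding indicator_def of_bool_def atLeastAtMost_iff by measurable
  have mc: "(\<lambda>(r, x). \<integral>\<^sup>+y. ?c r x y \<partial>M) \<in> borel_measurable (lborel \<Otimes>\<^sub>M M)" by measurable
  have ma': "(\<lambda>r. \<integral>\<^sup>+x. ?a r x \<partial>M) \<in> borel_measurable lborel"
    using ma by (intro borel_measurable_nn_integral) simp
  have mb': "(\<lambda>r. \<integral>\<^sup>+x. ?b r x \<partial>M) \<in> borel_measurable lborel"
    using mb by (intro borel_measurable_nn_integral) simp
  have mc': "(\<lambda>r. \<integral>\<^sup>+x. \<integral>\<^sup>+y. ?c r x y \<partial>M \<partial>M) \<in> borel_measurable lborel"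
    using mc by (intro borel_measurable_nn_integral) simp
  have "ennreal (norm (\<integral>x. f x * T g x \<partial>M)) \<le> (\<integral>\<^sup>+r. ennreal (norm (\<integral>x. slice r x * T g x \<partial>M)) \<partial>lborel)"
    unfolding slice_Fubini(2) by (rule integral_norm_bound_ennreal[OF slice_Fubini(1)])
  also have "\<dots> \<le> (\<integral>\<^sup>+r. (\<integral>\<^sup>+x. ?a r x \<partial>M) + (\<integral>\<^sup>+y. ?b r y \<partial>M) + (\<integral>\<^sup>+x. \<integral>\<^sup>+y. ?c r x y \<partial>M \<partial>M) \<partial>lborel)"
  proof (rule nn_integral_mono)
    fix r :: real
    show "ennreal (norm (\<integral>x. slice r x * T g x \<partial>M)) \<le> (\<integral>\<^sup>+x. ?a r x \<partial>M) + (\<integral>\<^sup>+y. ?b r y \<partial>M) + (\<integral>\<^sup>+x. \<integral>\<^sup>+y. ?c r x y \<partial>M \<partial>M)"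
    proof (cases "r > 0")
      case True then show ?thesis by (rule slice_bound)
    qed (simp add: slice_def)
  qed
  also have "\<dots> = (\<integral>\<^sup>+r. \<integral>\<^sup>+x. ?a r x \<partial>M \<partial>lborel) + (\<integral>\<^sup>+r. \<integral>\<^sup>+y. ?b r y \<partial>M \<partial>lborel) + (\<integral>\<^sup>+r. \<integral>\<^sup>+x. \<integral>\<^sup>+y. ?c r x y \<partial>M \<partial>M \<partial>lborel)"
    using ma' mb' mc' by (simp add: nn_integral_add)
  also have "(\<integral>\<^sup>+r. \<integral>\<^sup>+x. ?a r x \<partial>M \<partial>lborel) = ennreal (e / (2 * q) * A)"
  proof -
    have "(\<integral>\<^sup>+r. \<integral>\<^sup>+x. ?a r x \<partial>M \<partial>lborel) = (\<integral>\<^sup>+x. \<integral>\<^sup>+r. ?a r x \<partial>lborel \<partial>M)"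
      by (rule P.Fubini'[OF ma, symmetric])
    also have "\<dots> = (\<integral>\<^sup>+x. ennreal (e / (2 * q)) * ennreal (norm (f x) powr q) \<partial>M)"
      using q e by (intro nn_integral_cong, subst nn_integral_cmult)
        (auto simp: nn_integral_powr_Icc ennreal_mult[symmetric])
    also have "\<dots> = ennreal (e / (2 * q) * A)"
      using e q AB by (subst nn_integral_cmult) (auto simp: nnA ennreal_mult[symmetric])
    finally show ?thesis .
  qed
  also have "(\<integral>\<^sup>+r. \<integral>\<^sup>+y. ?b r y \<partial>M \<partial>lborel) = ennreal (l powr (2 - q) / (2 * e * (2 - q)) * B)"
  proof -
    have "(\<integral>\<^sup>+r. \<integral>\<^sup>+y. ?b r y \<partial>M \<partial>lborel) = (\<integral>\<^sup>+y. \<integral>\<^sup>+r. ?b r y \<partial>lborel \<partial>M)"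
      by (rule P.Fubini'[OF mb, symmetric])
    also have "\<dots> = (\<integral>\<^sup>+y. ennreal (l powr (2 - q) / (2 * e * (2 - q))) * ennreal (norm (g y) powr q) \<partial>M)"
    proof (rule nn_integral_cong)
      fix y
      show "(\<integral>\<^sup>+r. ?b r y \<partial>lborel) = ennreal (l powr (2 - q) / (2 * e * (2 - q))) * ennreal (norm (g y) powr q)"
      proof (cases "g y = 0")
        case False
        have "(\<integral>\<^sup>+r. ?b r y \<partial>lborel) = ennreal ((norm (g y))\<^sup>2 / (2 * e)) * ennreal ((l / norm (g y)) powr ((1 - q) + 1) / ((1 - q) + 1))"
          using q l by (subst nn_integral_cmult) (auto simp: nn_integral_powr_Icc)
        also have "\<dots> = ennreal ((norm (g y))\<^sup>2 / (2 * e) * ((l / norm (g y)) powr (2 - q) / (2 - q)))"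
          using q e by (simp add: ennreal_mult[symmetric])
        also have "(norm (g y))\<^sup>2 / (2 * e) * ((l / norm (g y)) powr (2 - q) / (2 - q)) = l powr (2 - q) / (2 * e * (2 - q)) * norm (g y) powr q"
        proof -
          have "norm (g y) powr (2 - q) * norm (g y) powr q = (norm (g y))\<^sup>2"
            using False by (simp add: powr_add[symmetric] powr_numeral)
          then have "(norm (g y))\<^sup>2 / norm (g y) powr (2 - q) = norm (g y) powr q"
            using False by (simp add: field_simps)
          moreover have "(norm (g y))\<^sup>2 / (2 * e) * ((l / norm (g y)) powr (2 - q) / (2 - q)) =
             l powr (2 - q) / (2 * e * (2 - q)) * ((norm (g y))\<^sup>2 / norm (g y) powr (2 - q))"
            using l by (simp add: powr_divide mult_ac)
          ultimately show ?thesis by simp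
        qed
        finally show ?thesis using q e by (simp add: ennreal_mult[symmetric])
      qed simp
    qed
    also have "\<dots> = ennreal (l powr (2 - q) / (2 * e * (2 - q)) * B)"
      using e q AB by (subst nn_integral_cmult) (auto simp: nnB ennreal_mult[symmetric])
    finally show ?thesis .
  qed
  also have "(\<integral>\<^sup>+r. \<integral>\<^sup>+x. \<integral>\<^sup>+y. ?c r x y \<partial>M \<partial>M \<partial>lborel) = ennreal (\<kappa> * l powr (1 - q) * A * B)"
  proof -
    have c: "(\<integral>\<^sup>+y. ?c r x y \<partial>M) = ennreal (\<kappa> * l powr (1 - q) * norm (f x) powr (q - 1) * B) * ennreal (norm (slice r x))" for r x
    proof -
      have "(\<integral>\<^sup>+y. ?c r x y \<partial>M) = (\<integral>\<^sup>+y. ennreal (\<kappa> * l powr (1 - q) * norm (f x) powr (q - 1) * norm (slice r x)) * ennreal (norm (g y) powr q) \<partial>M)"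
        using \<kappa> by (intro nn_integral_cong) (auto simp: ennreal_mult[symmetric] mult_ac)
      also have "\<dots> = ennreal (\<kappa> * l powr (1 - q) * norm (f x) powr (q - 1) * norm (slice r x)) * ennreal B"
        by (subst nn_integral_cmult) (auto simp: nnB)
      also have "\<dots> = ennreal (\<kappa> * l powr (1 - q) * norm (f x) powr (q - 1) * B) * ennreal (norm (slice r x))"
        using \<kappa> AB by (simp add: ennreal_mult[symmetric] mult_ac)
      finally show ?thesis .
    qed
    have "(\<integral>\<^sup>+r. \<integral>\<^sup>+x. \<integral>\<^sup>+y. ?c r x y \<partial>M \<partial>M \<partial>lborel) = (\<integral>\<^sup>+x. \<integral>\<^sup>+r. \<integral>\<^sup>+y. ?c r x y \<partial>M \<partial>lborel \<partial>M)"
      by (rule P.Fubini'[OF mc, symmetric])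
    also have "\<dots> = (\<integral>\<^sup>+x. ennreal (\<kappa> * l powr (1 - q) * B) * ennreal (norm (f x) powr q) \<partial>M)"
      unfolding c
    proof (rule nn_integral_cong)
      fix x
      have "(\<integral>\<^sup>+r. ennreal (\<kappa> * l powr (1 - q) * norm (f x) powr (q - 1) * B) * ennreal (norm (slice r x)) \<partial>lborel) =
         ennreal (\<kappa> * l powr (1 - q) * norm (f x) powr (q - 1) * B) * ennreal (norm (f x))"
        by (subst nn_integral_cmult) (simp_all add: nn_integral_norm_slice)
      also have "\<dots> = ennreal (\<kappa> * l powr (1 - q) * norm (f x) powr (q - 1) * B * norm (f x))"
        using \<kappa> AB by (intro ennreal_mult[symmetric]) auto
      also have "\<kappa> * l powr (1 - q) * norm (f x) powr (q - 1) * B * norm (f x) = \<kappa> * l powr (1 - q) * B * (norm (f x) powr (q - 1) * norm (f x) powr 1)"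
        by simp
      also have "norm (f x) powr (q - 1) * norm (f x) powr 1 = norm (f x) powr q"
        by (simp only: powr_add[symmetric]) simp
      finally show "(\<integral>\<^sup>+r. ennreal (\<kappa> * l powr (1 - q) * norm (f x) powr (q - 1) * B) * ennreal (norm (slice r x)) \<partial>lborel) =
         ennreal (\<kappa> * l powr (1 - q) * B) * ennreal (norm (f x) powr q)"
        using \<kappa> AB by (simp add: ennreal_mult[symmetric])
    qed
    also have "\<dots> = ennreal (\<kappa> * l powr (1 - q) * B) * ennreal A"
      by (subst nn_integral_cmult) (auto simp: nnA)
    also have "\<dots> = ennreal (\<kappa> * l powr (1 - q) * A * B)"
      using \<kappa> AB by (simp add: ennreal_mult[symmetric] mult_ac)
    finally show ?thesis .
  qed
  also have "ennreal (e / (2 * q) * A) + ennreal (l powr (2 - q) / (2 * e * (2 - q)) * B) + ennreal (\<kappa> * l powr (1 - q) * A * B) =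
     ennreal (e / (2 * q) * A + l powr (2 - q) / (2 * e * (2 - q)) * B + \<kappa> * l powr (1 - q) * A * B)"
    using AB \<kappa> e q by (simp add: ennreal_plus[symmetric] del: ennreal_plus)
  finally have "norm (\<integral>x. f x * T g x \<partial>M) \<le> e / (2 * q) * A + l powr (2 - q) / (2 * e * (2 - q)) * B + \<kappa> * l powr (1 - q) * A * B"
    using AB \<kappa> e q by (subst (asm) ennreal_le_iff) (auto intro!: add_nonneg_nonneg)
  then show ?thesis by (simp add: A_def B_def)
qed

end

text \<open>Balancing the three terms produces the exponent 2/q - 1 of \<kappa>, which interpolates
  between 0 on L^2 and 1 on L^1. The constant blows up as q tends to 2, so the endpoint is
  excluded.\<close>

lemma form_le:
  "norm (\<integral>x. f x * T g x \<partial>M) \<le> (1 / (2 * q) + 1 / (2 * (2 - q)) + 1) * \<kappa> powr (2 / q - 1)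
     * (\<integral>x. norm (f x) powr q \<partial>M) powr (1 / q) * (\<integral>y. norm (g y) powr q \<partial>M) powr (1 / q)"
proof -
  define A where "A = (\<integral>x. norm (f x) powr q \<partial>M)"
  define B where "B = (\<integral>y. norm (g y) powr q \<partial>M)"
  have AB: "0 \<le> A" "0 \<le> B" by (auto simp: A_def B_def)
  \<comment> \<open>The balancing choice of e and l needs A and B positive.\<close>
  consider "A = 0" | "B = 0" | "A > 0" "B > 0" using AB by fastforce
  then show ?thesis
  proof cases
    case 1
    then have "AE x in M. norm (f x) powr q = 0"
      unfolding A_def using integral_nonneg_eq_0_iff_AE[OF f_q] by simp
    then have "AE x in M. f x * T g x = 0" by eventually_elim simp
    then have "(\<integral>x. f x * T g x \<partial>M) = 0" by (rule integral_eq_zero_AE)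
    with q show ?thesis by simp
  next
    case 2
    then have "AE x in M. norm (g x) powr q = 0"
      unfolding B_def using integral_nonneg_eq_0_iff_AE[OF g_q] by simp
    then have "AE y in M. k (x, y) * g y = 0" for x by eventually_elim simp
    then have "T g x = 0" for x unfolding T_def by (rule integral_eq_zero_AE)
    with q show ?thesis by simp
  next
    case 3
    \<comment> \<open>The ratio sqrt(B/A) in e balances the first two terms, and l^(q/2) = m
      balances them with the third: all three become multiples of the same D.\<close>
    define m where "m = \<kappa> * sqrt (A * B)"
    have m: "m > 0" using \<kappa> 3 by (simp add: m_def)
    define l where "l = m powr (2 / q)"
    have l: "l > 0" using m by (simp add: l_def)
    define e where "e = l powr (1 - q / 2) * sqrt (B / A)"
    have e: "e > 0" using l 3 by (simp add: e_def)
    define D where "D = l powr (1 - q / 2) * sqrt (A * B)"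
    have "e * A = D" using 3 by (simp add: e_def D_def real_sqrt_divide real_sqrt_mult real_div_sqrt field_simps)
    then have 1: "e / (2 * q) * A = 1 / (2 * q) * D" by simp
    have "l powr (2 - q) = l powr (1 - q / 2) * l powr (1 - q / 2)" by (simp add: powr_add[symmetric])
    then have "l powr (2 - q) / e * B = D" using 3 l
      by (simp add: e_def D_def real_sqrt_divide real_sqrt_mult field_simps)
    moreover have "l powr (2 - q) / (2 * e * (2 - q)) * B = 1 / (2 * (2 - q)) * (l powr (2 - q) / e * B)"
      by simp
    ultimately have 2: "l powr (2 - q) / (2 * e * (2 - q)) * B = 1 / (2 * (2 - q)) * D"
      by simp
    have "m = l powr (q / 2)" using m q by (simp add: l_def powr_powr)
    moreover have "\<kappa> * l powr (1 - q) * A * B = l powr (1 - q) * m * sqrt (A * B)"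
      using 3 by (simp add: m_def)
    ultimately have 3: "\<kappa> * l powr (1 - q) * A * B = D"
      by (simp add: D_def powr_add[symmetric])
    have "norm (\<integral>x. f x * T g x \<partial>M) \<le> (1 / (2 * q) + 1 / (2 * (2 - q)) + 1) * D"
      using form_le_parameters[OF e l] unfolding A_def[symmetric] B_def[symmetric] 1 2 3
      by (simp add: distrib_right)
    also have "D = \<kappa> powr (2 / q - 1) * A powr (1 / q) * B powr (1 / q)"
    proof -
      have half: "1 / 2 * (2 / q - 1) = 1 / q - 1 / 2" using q by (simp add: field_simps)
      have sq: "sqrt (A * B) = (A * B) powr (1 / 2)" using AB by (simp add: powr_half_sqrt)
      have "2 / q * (1 - q / 2) = 2 / q - 1" using q by (simp add: field_simps)
      then have l1: "l powr (1 - q / 2) = m powr (2 / q - 1)" by (simp only: l_def powr_powr)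
      have m1: "m powr (2 / q - 1) = \<kappa> powr (2 / q - 1) * ((A * B) powr (1 / 2)) powr (2 / q - 1)"
        unfolding m_def sq by (rule powr_mult)
      have m2: "((A * B) powr (1 / 2)) powr (2 / q - 1) = (A * B) powr (1 / q - 1 / 2)"
        unfolding powr_powr half ..
      have m3: "(A * B) powr (1 / q - 1 / 2) * (A * B) powr (1 / 2) = (A * B) powr (1 / q)"
        unfolding powr_add[symmetric] by simp
      have m4: "(A * B) powr (1 / q) = A powr (1 / q) * B powr (1 / q)"
        by (rule powr_mult)
      show ?thesis unfolding D_def l1 m1 m2 sq mult.assoc m3 m4 ..
    qed
    finally show ?thesis by (simp add: A_def B_def mult_ac)
  qed
qed

end

end

section \<open>Fourier analysis on the torus\<close>

text \<open>Padding with 0 off the range of \<open>to_nat\<close> turns an unordered sum over a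
  countable index set into a series, the form to which \<open>integrable_suminf\<close> and
  \<open>integral_suminf\<close> apply.\<close>

lemma sums_to_nat:
  fixes f :: "'n::countable \<Rightarrow> 'a::banach"
  assumes "(\<lambda>n. norm (f n)) summable_on UNIV"
  defines "F \<equiv> \<lambda>k. if k \<in> range (to_nat :: 'n \<Rightarrow> nat) then f (from_nat k) else 0"
  shows "summable (\<lambda>k. norm (F k))" "(\<Sum>\<^sub>\<infinity>n. f n) = (\<Sum>k. F k)"
proof -
  have inj: "inj (to_nat :: 'n \<Rightarrow> nat)" by simp
  have "(\<lambda>k. norm (f (from_nat k))) summable_on range (to_nat :: 'n \<Rightarrow> nat)"
    using assms by (subst summable_on_reindex[OF inj]) (simp add: o_def)
  then have F: "(\<lambda>k. norm (F k)) summable_on UNIV"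
    by (rule summable_on_cong_neutral[THEN iffD1, rotated -1]) (auto simp: F_def)
  then show "summable (\<lambda>k. norm (F k))" by (rule summable_on_imp_summable)
  have "(\<Sum>\<^sub>\<infinity>n. f n) = (\<Sum>\<^sub>\<infinity>k\<in>range (to_nat :: 'n \<Rightarrow> nat). f (from_nat k))"
    by (subst infsum_reindex[OF inj]) (simp add: o_def)
  also have "\<dots> = (\<Sum>\<^sub>\<infinity>k. F k)"
    by (rule infsum_cong_neutral) (auto simp: F_def)
  also have "\<dots> = (\<Sum>k. F k)"
    using has_sum_imp_sums[OF has_sum_infsum[OF abs_summable_summable[OF F]]] by (rule sums_unique)
  finally show "(\<Sum>\<^sub>\<infinity>n. f n) = (\<Sum>k. F k)" .
qed

text \<open>The product form of the dominating function separates summability in n from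
  integrability in x; in all uses w is the Gaussian weight.\<close>

lemma integral_infsum:
  fixes c :: "'n::countable \<Rightarrow> 'a \<Rightarrow> 'b::{banach, second_countable_topology}"
  assumes g: "integrable M g" and w: "w summable_on UNIV" "\<And>n. 0 \<le> (w n :: real)"
    and meas: "\<And>n. c n \<in> borel_measurable M"
    and le: "\<And>n x. x \<in> space M \<Longrightarrow> norm (c n x) \<le> w n * g x"
  shows "integrable M (\<lambda>x. \<Sum>\<^sub>\<infinity>n. c n x)"
    "(\<integral>x. (\<Sum>\<^sub>\<infinity>n. c n x) \<partial>M) = (\<Sum>\<^sub>\<infinity>n. \<integral>x. c n x \<partial>M)"
    "(\<lambda>n. norm (\<integral>x. c n x \<partial>M)) summable_on UNIV"
proof -
  define F where "F k x = (if k \<in> range (to_nat :: 'n \<Rightarrow> nat) then c (from_nat k) x else 0)" for k x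
  have ci: "integrable M (c n)" for n
  proof (rule Bochner_Integration.integrable_bound)
    show "integrable M (\<lambda>x. w n * g x)" using g by simp
    show "AE x in M. norm (c n x) \<le> norm (w n * g x)"
      using le by (intro AE_I2) (fastforce intro: order.trans)
  qed (rule meas)
  have Fi: "integrable M (F k)" for k unfolding F_def by (cases "k \<in> range (to_nat :: 'n \<Rightarrow> nat)") (auto simp: ci)
  have cn: "(\<lambda>n. norm (c n x)) summable_on UNIV" if "x \<in> space M" for x
    by (rule summable_on_comparison_test[of "\<lambda>n. w n * g x"])
       (use w le that in \<open>auto intro: summable_on_cmult_left\<close>)
  have s1: "summable (\<lambda>k. norm (F k x))" if "x \<in> space M" for x
    using sums_to_nat(1)[OF cn[OF that]] unfolding F_def .
  have e1: "(\<Sum>\<^sub>\<infinity>n. c n x) = (\<Sum>k. F k x)" if "x \<in> space M" for x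
    using sums_to_nat(2)[OF cn[OF that]] unfolding F_def .
  have nle: "(\<integral>x. norm (c n x) \<partial>M) \<le> w n * (\<integral>x. g x \<partial>M)" for n
  proof -
    have "(\<integral>x. norm (c n x) \<partial>M) \<le> (\<integral>x. w n * g x \<partial>M)"
      using ci g le by (intro integral_mono) auto
    then show ?thesis by simp
  qed
  have sI: "(\<lambda>n. \<integral>x. norm (c n x) \<partial>M) summable_on UNIV"
    by (rule summable_on_comparison_test[of "\<lambda>n. w n * (\<integral>x. g x \<partial>M)"])
       (use w nle in \<open>auto intro: summable_on_cmult_left\<close>)
  show sJ: "(\<lambda>n. norm (\<integral>x. c n x \<partial>M)) summable_on UNIV"
    by (rule summable_on_comparison_test[OF sI]) (auto intro: integral_norm_bound)
  have s2: "summable (\<lambda>k. \<integral>x. norm (F k x) \<partial>M)"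
  proof -
    have "summable (\<lambda>k. norm (if k \<in> range (to_nat :: 'n \<Rightarrow> nat) then \<integral>x. norm (c (from_nat k) x) \<partial>M else 0))"
      using sI by (intro sums_to_nat(1)) simp
    also have "(\<lambda>k. norm (if k \<in> range (to_nat :: 'n \<Rightarrow> nat) then \<integral>x. norm (c (from_nat k) x) \<partial>M else 0)) =
        (\<lambda>k. \<integral>x. norm (F k x) \<partial>M)"
      by (auto simp: F_def fun_eq_iff)
    finally show ?thesis .
  qed
  have "integrable M (\<lambda>x. \<Sum>k. F k x)"
    using s1 s2 by (intro integrable_suminf Fi AE_I2) auto
  then show "integrable M (\<lambda>x. \<Sum>\<^sub>\<infinity>n. c n x)"
    by (subst Bochner_Integration.integrable_cong[OF refl e1])
  have "(\<integral>x. (\<Sum>\<^sub>\<infinity>n. c n x) \<partial>M) = (\<integral>x. (\<Sum>k. F k x) \<partial>M)"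
    by (intro Bochner_Integration.integral_cong refl e1)
  also have "\<dots> = (\<Sum>k. \<integral>x. F k x \<partial>M)"
    using s1 s2 by (intro integral_suminf Fi AE_I2) auto
  also have "\<dots> = (\<Sum>k. if k \<in> range (to_nat :: 'n \<Rightarrow> nat) then \<integral>x. c (from_nat k) x \<partial>M else 0)"
    by (rule arg_cong[where f = suminf]) (auto simp: F_def fun_eq_iff)
  also have "\<dots> = (\<Sum>\<^sub>\<infinity>n. \<integral>x. c n x \<partial>M)"
    by (rule sums_to_nat(2)[OF sJ, symmetric])
  finally show "(\<integral>x. (\<Sum>\<^sub>\<infinity>n. c n x) \<partial>M) = (\<Sum>\<^sub>\<infinity>n. \<integral>x. c n x \<partial>M)" .
qed

lemma cnj_measurable [measurable]: "cnj \<in> borel_measurable borel"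
  by (intro borel_measurable_continuous_onI continuous_intros)

lemma echar_measurable [measurable]: "echar \<in> borel_measurable borel"
  unfolding echar_def[abs_def] by (intro borel_measurable_continuous_onI continuous_intros)

section \<open>The spatial torus, orthogonality of characters and Bessel's inequality\<close>

definition cube :: "(real ^ 'd) set" where
  "cube = {x. \<forall>i. 0 \<le> x $ i \<and> x $ i < 1}"

text \<open>A density rather than a restricted space, so that the space stays UNIV, the sets stay
  Borel, and products of such measures are again densities.\<close>

definition torus_d :: "(real ^ 'd) measure" where
  "torus_d = density lborel (indicator cube)"

lemma cube_measurable [measurable]: "cube \<in> sets borel"
proof -
  have "cube = (\<Inter>i. {x :: real ^ 'a. 0 \<le> x $ i \<and> x $ i < 1})" by (auto simp: cube_def)
  also have "\<dots> \<in> sets borel"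
    by (intro sets.countable_INT'') (auto intro!: borel_closed borel_open simp: Collect_conj_eq
        intro: closed_Collect_le open_Collect_less continuous_intros)
  finally show ?thesis .
qed

lemma sets_torus_d [simp, measurable_cong]: "sets torus_d = sets borel"
  by (simp add: torus_d_def)

lemma space_torus_d [simp]: "space torus_d = UNIV"
  by (simp add: torus_d_def)

interpretation torus_d: finite_measure "torus_d :: (real ^ 'd::finite) measure"
proof
  have "emeasure (torus_d :: (real ^ 'd) measure) UNIV = emeasure lborel (cube :: (real ^ 'd) set)"
    unfolding torus_d_def by (subst emeasure_density) (auto simp: nn_integral_indicator)
  also have "\<dots> \<le> emeasure lborel (cbox 0 1 :: (real ^ 'd) set)"
    by (intro emeasure_mono) (auto simp: cube_def mem_box_cart less_imp_le)
  also have "\<dots> < \<infinity>" by (simp add: emeasure_lborel_cbox_eq)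
  finally show "emeasure (torus_d :: (real ^ 'd) measure) (space torus_d) \<noteq> \<infinity>" by simp
qed

lemma integral_echar_interval:
  "(\<integral>u. indicator {0..<1} u *\<^sub>R echar (of_int c * u) \<partial>lborel) = (if c = 0 then 1 else 0)"
proof -
  have "(\<integral>u. indicator {0..<1} u *\<^sub>R echar (of_int c * u) \<partial>lborel) = (\<integral>u. indicator {0..1} u *\<^sub>R echar (of_int c * u) \<partial>lborel)"
    by (rule integral_cong_AE, measurable, rule AE_I[where N = "{1}"]) (auto simp: indicator_def split: if_splits)
  also have "\<dots> = (if c = 0 then 1 else 0)"
  proof (cases "c = 0")
    case False
    define F where "F u = echar (of_int c * u) / (2 * pi * \<i> * of_int c)" for u :: real
    have "(\<integral>u. indicator {0..1} u *\<^sub>R echar (of_int c * u) \<partial>lborel) = F 1 - F 0"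
    proof (rule integral_FTC_Icc)
      show "(F has_vector_derivative echar (of_int c * x)) (at x within {0..1})" for x
      proof -
        define a where "a = 2 * of_real pi * \<i> * of_int c"
        have a: "a \<noteq> 0" using False by (simp add: a_def)
        have e: "echar (of_int c * u) = exp (a * of_real u)" for u
          by (simp add: echar_def cis_conv_exp a_def mult_ac)
        have "((\<lambda>z. exp (a * z) / a) has_field_derivative exp (a * of_real x)) (at (of_real x))"
          using a by (auto intro!: derivative_eq_intros)
        from has_vector_derivative_real_field[OF this] show ?thesis
          unfolding F_def[abs_def] e a_def by simp
      qed
      show "continuous_on {0..1} (\<lambda>u. echar (of_int c * u))"
        unfolding echar_def by (intro continuous_intros)
    qed simp
    moreover have "echar (of_int c) = 1"
      unfolding echar_def by (metis cis_multiple_2pi Ints_of_int mult.commute)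
    ultimately show ?thesis using False by (simp add: F_def)
  qed simp
  finally show ?thesis .
qed

text \<open>\<open>lborel\<close> is by definition the image of a product of one-dimensional
  measures indexed by \<open>Basis\<close>; on that product the integral of a product
  splits.\<close>

lemma integral_lborel_prod_Basis:
  fixes H :: "'a::euclidean_space \<Rightarrow> real \<Rightarrow> complex"
  assumes "\<And>b. b \<in> Basis \<Longrightarrow> integrable lborel (H b)"
  shows "(\<integral>x. (\<Prod>b\<in>Basis. H b (x \<bullet> b)) \<partial>lborel) = (\<Prod>b\<in>Basis. \<integral>u. H b u \<partial>lborel)"
proof -
  interpret product_sigma_finite "\<lambda>_::'a. lborel :: real measure" by unfold_locales
  have [measurable]: "b \<in> Basis \<Longrightarrow> H b \<in> borel_measurable borel" for b using assms[of b] by auto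
  have L: "(lborel :: 'a measure) = distr (\<Pi>\<^sub>M b\<in>(Basis :: 'a set). (lborel :: real measure)) borel (\<lambda>f. \<Sum>b\<in>Basis. f b *\<^sub>R b)"
    unfolding lborel_def[where 'a = 'a] lborel_eq_real ..
  have "(\<integral>x. (\<Prod>b\<in>Basis. H b (x \<bullet> b)) \<partial>lborel) =
    (\<integral>f. (\<Prod>b\<in>Basis. H b ((\<Sum>b'\<in>Basis. f b' *\<^sub>R b') \<bullet> b)) \<partial>(\<Pi>\<^sub>M b\<in>Basis. lborel))"
    by (subst L, subst integral_distr) (auto intro!: borel_measurable_prod)
  also have "\<dots> = (\<integral>f. (\<Prod>b\<in>Basis. H b (f b)) \<partial>(\<Pi>\<^sub>M b\<in>Basis. lborel))"
    by (intro Bochner_Integration.integral_cong refl prod.cong) (simp add: inner_sum_left_Basis)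
  also have "\<dots> = (\<Prod>b\<in>Basis. \<integral>u. H b u \<partial>lborel)"
    by (rule product_integral_prod) (use assms in auto)
  finally show ?thesis .
qed

lemma integral_torus_d:
  fixes f :: "real ^ 'd::finite \<Rightarrow> 'b::{banach, second_countable_topology}"
  assumes [measurable]: "f \<in> borel_measurable borel"
  shows "(\<integral>x. f x \<partial>torus_d) = (\<integral>x. indicator cube x *\<^sub>R f x \<partial>lborel)"
proof -
  have T: "(torus_d :: (real ^ 'd) measure) = density lborel (\<lambda>x. ennreal (indicator cube x))"
    unfolding torus_d_def by (intro density_cong) (auto simp: ennreal_indicator)
  show ?thesis unfolding T by (rule integral_density) auto
qed

lemma echar_sum: "finite A \<Longrightarrow> echar (\<Sum>i\<in>A. f i) = (\<Prod>i\<in>A. echar (f i))"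
  by (induction A rule: finite_induct) (auto simp: echar_add)

lemma integral_echar_torus_d:
  fixes n :: "int ^ 'd::finite"
  shows "(\<integral>x. echar (int_vec n \<bullet> x) \<partial>torus_d) = (if n = 0 then 1 else 0)"
proof -
  \<comment> \<open>Recovers the coordinate index from a basis vector, so that the frequency
    \<open>n $ i\<close> can be attached to elements of \<open>Basis\<close>.\<close>
  define co where "co b = (THE i. b = axis i (1::real))" for b :: "real ^ 'd"
  have co: "co (axis i 1) = i" for i unfolding co_def by (auto simp: axis_eq_axis)
  define H where "H b u = indicator {0..<1} u *\<^sub>R echar (of_int (n $ co b) * u)" for b :: "real ^ 'd" and u :: real
  have Bs: "(Basis :: (real ^ 'd) set) = (\<lambda>i. axis i 1) ` UNIV" by (auto simp: Basis_vec_def)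
  have inj: "inj (\<lambda>i::'d. axis i (1::real))" by (auto simp: inj_on_def axis_eq_axis)
  have "(\<integral>x. echar (int_vec n \<bullet> x) \<partial>torus_d) = (\<integral>x. indicator cube x *\<^sub>R echar (int_vec n \<bullet> x) \<partial>lborel)"
    by (rule integral_torus_d) measurable
  also have "\<dots> = (\<integral>x. (\<Prod>b\<in>Basis. H b (x \<bullet> b)) \<partial>lborel)"
  proof (intro Bochner_Integration.integral_cong refl)
    fix x :: "real ^ 'd"
    have "(\<Prod>b\<in>Basis. H b (x \<bullet> b)) = (\<Prod>i\<in>UNIV. indicator {0..<1} (x $ i) *\<^sub>R echar (of_int (n $ i) * (x $ i)))"
      unfolding Bs by (subst prod.reindex[OF inj]) (simp add: H_def co inner_axis)
    also have "\<dots> = (\<Prod>i\<in>UNIV. of_real (indicator {0..<1} (x $ i))) * (\<Prod>i\<in>UNIV. echar (of_int (n $ i) * (x $ i)))"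
      by (simp add: scaleR_conv_of_real prod.distrib)
    also have "(\<Prod>i\<in>UNIV. echar (of_int (n $ i) * (x $ i))) = echar (int_vec n \<bullet> x)"
      by (simp add: echar_sum[symmetric] inner_vec_def int_vec_def)
    also have "(\<Prod>i\<in>UNIV. of_real (indicator {0..<1} (x $ i))) = (of_real (indicator cube x) :: complex)"
    proof (cases "x \<in> cube")
      case False
      then obtain i where "x $ i \<notin> {0..<1}" by (auto simp: cube_def)
      then have "(\<Prod>i\<in>UNIV. of_real (indicator {0..<1} (x $ i))) = (0::complex)"
        by (intro prod_zero bexI[of _ i]) auto
      with False show ?thesis by simp
    qed (auto simp: cube_def)
    finally show "indicator cube x *\<^sub>R echar (int_vec n \<bullet> x) = (\<Prod>b\<in>Basis. H b (x \<bullet> b))"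
      by (simp add: scaleR_conv_of_real)
  qed
  also have "\<dots> = (\<Prod>b\<in>Basis. \<integral>u. H b u \<partial>lborel)"
  proof (rule integral_lborel_prod_Basis)
    fix b :: "real ^ 'd"
    show "integrable lborel (H b)"
    proof (rule integrableI_bounded_set[where A = "{0..<1}" and B = 1])
      show "H b \<in> borel_measurable lborel" unfolding H_def[abs_def] by measurable
    qed (auto simp: H_def indicator_def)
  qed
  also have "\<dots> = (\<Prod>i\<in>UNIV. if n $ i = 0 then 1 else 0)"
    unfolding Bs by (subst prod.reindex[OF inj]) (simp add: H_def[abs_def] co integral_echar_interval)
  also have "\<dots> = (if n = 0 then 1 else 0)"
  proof (cases "n = 0")
    case False
    then obtain i where "n $ i \<noteq> 0" by (auto simp: vec_eq_iff)
    then have "(\<Prod>i\<in>UNIV. if n $ i = 0 then 1 else 0) = (0::complex)" by (intro prod_zero) auto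
    with False show ?thesis by simp
  qed simp
  finally show ?thesis .
qed

text \<open>Expanding the integral of |\<phi> - s|^2, with s the partial Fourier sum, the three
  terms that involve s all equal S. Boundedness makes every product integrable on a finite measure
  space.\<close>

lemma (in finite_measure) Bessel_le:
  fixes \<phi> :: "'a \<Rightarrow> complex" and u :: "'i \<Rightarrow> 'a \<Rightarrow> complex"
  assumes [measurable]: "\<phi> \<in> borel_measurable M" and \<phi>: "\<And>x. norm (\<phi> x) \<le> B"
    and [measurable]: "\<And>n. u n \<in> borel_measurable M" and u: "\<And>n x. norm (u n x) \<le> 1"
    and orth: "\<And>n m. (\<integral>x. u n x * cnj (u m x) \<partial>M) = (if n = m then 1 else 0)"
    and A: "finite A"
  shows "(\<Sum>n\<in>A. (norm (\<integral>x. \<phi> x * cnj (u n x) \<partial>M))\<^sup>2) \<le> (\<integral>x. (norm (\<phi> x))\<^sup>2 \<partial>M)"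
proof -
  define c where "c n = (\<integral>x. \<phi> x * cnj (u n x) \<partial>M)" for n
  define s where "s x = (\<Sum>n\<in>A. c n * u n x)" for x
  have B: "B \<ge> 0" using \<phi> norm_ge_zero order.trans by blast
  have [measurable]: "s \<in> borel_measurable M" unfolding s_def[abs_def] by measurable
  have sb: "norm (s x) \<le> (\<Sum>n\<in>A. norm (c n))" for x
    unfolding s_def by (rule order.trans[OF norm_sum], intro sum_mono)
      (use u in \<open>auto simp: norm_mult mult_left_le\<close>)
  have bi: "integrable M (\<lambda>x. a x * cnj (b x))" if [measurable]: "a \<in> borel_measurable M" "b \<in> borel_measurable M"
    and "\<And>x. norm (a x) \<le> K" "\<And>x. norm (b x) \<le> L" for a b :: "'a \<Rightarrow> complex" and K L
  proof (rule integrable_const_bound[of _ "K * L"])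
    have "0 \<le> K" using that(3) norm_ge_zero order.trans by blast
    then show "AE x in M. norm (a x * cnj (b x)) \<le> K * L"
      using that by (auto simp: norm_mult intro!: mult_mono)
  qed measurable
  define S where "S = (\<Sum>n\<in>A. (norm (c n))\<^sup>2)"
  have i1: "(\<integral>x. \<phi> x * cnj (s x) \<partial>M) = of_real S"
  proof -
    have "(\<integral>x. \<phi> x * cnj (s x) \<partial>M) = (\<integral>x. (\<Sum>n\<in>A. cnj (c n) * (\<phi> x * cnj (u n x))) \<partial>M)"
      by (intro Bochner_Integration.integral_cong) (auto simp: s_def sum_distrib_left mult_ac)
    also have "\<dots> = (\<Sum>n\<in>A. cnj (c n) * c n)"
      using bi[OF _ _ \<phi> u] unfolding c_def by (subst Bochner_Integration.integral_sum) auto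
    also have "\<dots> = of_real S" by (simp add: S_def complex_norm_square mult.commute del: of_real_power)
    finally show ?thesis .
  qed
  have i2: "(\<integral>x. s x * cnj (s x) \<partial>M) = of_real S"
  proof -
    have "(\<integral>x. s x * cnj (s x) \<partial>M) = (\<integral>x. (\<Sum>n\<in>A. \<Sum>m\<in>A. (c n * cnj (c m)) * (u n x * cnj (u m x))) \<partial>M)"
      by (intro Bochner_Integration.integral_cong) (auto simp: s_def sum_product mult_ac)
    also have "\<dots> = (\<Sum>n\<in>A. \<Sum>m\<in>A. (c n * cnj (c m)) * (if n = m then 1 else 0))"
      using bi[OF _ _ u u] by (simp add: orth)
    also have "\<dots> = (\<Sum>n\<in>A. c n * cnj (c n))"
      using A by (intro sum.cong refl) (simp add: if_distrib cong: if_cong)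
    also have "\<dots> = of_real S" by (simp add: S_def complex_norm_square del: of_real_power)
    finally show ?thesis .
  qed
  have i3: "(\<integral>x. s x * cnj (\<phi> x) \<partial>M) = of_real S"
  proof -
    have "(\<integral>x. s x * cnj (\<phi> x) \<partial>M) = (\<integral>x. cnj (\<phi> x * cnj (s x)) \<partial>M)" by (simp add: mult.commute)
    also have "\<dots> = cnj (of_real S)" unfolding i1[symmetric] by (rule Bochner_Integration.integral_cnj)
    finally show ?thesis by simp
  qed
  have "of_real (\<integral>x. (norm (\<phi> x - s x))\<^sup>2 \<partial>M) = (\<integral>x. (\<phi> x * cnj (\<phi> x) - \<phi> x * cnj (s x)) - (s x * cnj (\<phi> x) - s x * cnj (s x)) \<partial>M)"
    unfolding integral_complex_of_real[symmetric]
    by (intro Bochner_Integration.integral_cong) (auto simp: complex_norm_square algebra_simps simp del: of_real_power)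
  also have "\<dots> = ((\<integral>x. \<phi> x * cnj (\<phi> x) \<partial>M) - of_real S) - (of_real S - of_real S)"
    using bi[OF _ _ \<phi> \<phi>] bi[OF _ _ \<phi> sb] bi[OF _ _ sb \<phi>] bi[OF _ _ sb sb]
    by (simp add: i1 i2 i3)
  also have "(\<integral>x. \<phi> x * cnj (\<phi> x) \<partial>M) = of_real (\<integral>x. (norm (\<phi> x))\<^sup>2 \<partial>M)"
    unfolding integral_complex_of_real[symmetric]
    by (intro Bochner_Integration.integral_cong) (auto simp: complex_norm_square simp del: of_real_power)
  finally have "(\<integral>x. (norm (\<phi> x - s x))\<^sup>2 \<partial>M) = (\<integral>x. (norm (\<phi> x))\<^sup>2 \<partial>M) - S"
    by (simp only: of_real_diff[symmetric] of_real_eq_iff diff_self of_real_0 diff_zero)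
  moreover have "0 \<le> (\<integral>x. (norm (\<phi> x - s x))\<^sup>2 \<partial>M)" by simp
  ultimately show ?thesis by (simp add: S_def c_def)
qed

section \<open>The Gaussian kernel\<close>

lemma infsum_measurable:
  fixes c :: "'n::countable \<Rightarrow> 'a \<Rightarrow> 'b::{banach, second_countable_topology}"
  assumes [measurable]: "\<And>n. c n \<in> borel_measurable M"
    and "\<And>x. x \<in> space M \<Longrightarrow> (\<lambda>n. norm (c n x)) summable_on UNIV"
  shows "(\<lambda>x. \<Sum>\<^sub>\<infinity>n. c n x) \<in> borel_measurable M"
proof -
  have "(\<lambda>x. \<Sum>k. if k \<in> range (to_nat :: 'n \<Rightarrow> nat) then c (from_nat k) x else 0) \<in> borel_measurable M"
    by measurable
  then show ?thesis
    by (subst measurable_cong[OF sums_to_nat(2)[OF assms(2)]])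
qed

text \<open>Written exactly as the weight in the theorem, so that unfolding identifies the
  two.\<close>

definition gauss_vec :: "real \<Rightarrow> nat \<Rightarrow> int ^ 'd \<Rightarrow> real" where
  "gauss_vec s N n = exp (- (s * of_int (sq_length n) / (real N)\<^sup>2))"

lemma gauss_vec_pos: "0 < gauss_vec s N n"
  by (simp add: gauss_vec_def)

lemma gauss_vec_le_1: "s > 0 \<Longrightarrow> gauss_vec s N n \<le> 1"
proof -
  assume "s > 0"
  moreover have "0 \<le> sq_length n" unfolding sq_length_def by (intro sum_nonneg) auto
  ultimately show ?thesis by (simp add: gauss_vec_def)
qed

lemma gauss_vec_prod: "gauss_vec s N n = (\<Prod>i\<in>UNIV. gauss_wt s N (n $ i))"
proof -
  have "- (s * of_int (sq_length n) / (real N)\<^sup>2) = (\<Sum>i\<in>UNIV. - s * (of_int (n $ i))\<^sup>2 / (real N)\<^sup>2)"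
    by (simp add: sq_length_def sum_distrib_left sum_divide_distrib sum_negf)
  then show ?thesis unfolding gauss_vec_def gauss_wt_def by (simp add: exp_sum)
qed

text \<open>A finite set of vectors lies in the product of its coordinate projections, over which
  the sum of products factors.\<close>

lemma gauss_vec_summable:
  assumes "s > 0" "N \<ge> 1"
  shows "(gauss_vec s N :: int ^ 'd::finite \<Rightarrow> real) summable_on UNIV"
proof (rule nonneg_bdd_above_summable_on)
  define C where "C = infsum (gauss_wt s N) UNIV"
  show "bdd_above (sum (gauss_vec s N) ` {F. F \<subseteq> (UNIV :: (int ^ 'd) set) \<and> finite F})"
  proof (rule bdd_aboveI2)
    fix F :: "(int ^ 'd) set" assume "F \<in> {F. F \<subseteq> UNIV \<and> finite F}"
    then have F: "finite F" by simp
    define S where "S i = (\<lambda>n. n $ i) ` F" for i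
    have fS: "finite (S i)" for i using F by (simp add: S_def)
    have "sum (gauss_vec s N) F = (\<Sum>g\<in>vec_nth ` F. \<Prod>i\<in>UNIV. gauss_wt s N (g i))"
      by (subst sum.reindex) (auto simp: inj_on_def vec_nth_inject gauss_vec_prod)
    also have "\<dots> \<le> (\<Sum>g\<in>PiE UNIV S. \<Prod>i\<in>UNIV. gauss_wt s N (g i))"
      using F fS by (intro sum_mono2 finite_PiE prod_nonneg) (auto simp: S_def gauss_wt_pos less_imp_le)
    also have "\<dots> = (\<Prod>i\<in>UNIV. \<Sum>m\<in>S i. gauss_wt s N m)"
      by (rule prod_sum_PiE[symmetric]) (auto simp: fS)
    also have "\<dots> \<le> (\<Prod>i\<in>(UNIV :: 'd set). C)" unfolding C_def
      using gauss_wt_summable[OF assms] fS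
      by (intro prod_mono conjI sum_nonneg finite_sum_le_infsum) (auto simp: gauss_wt_pos less_imp_le)
    finally show "sum (gauss_vec s N) F \<le> (\<Prod>i\<in>(UNIV :: 'd set). C)" .
  qed
qed (auto simp: gauss_vec_pos less_imp_le)

definition kernel :: "real \<Rightarrow> nat \<Rightarrow> real \<Rightarrow> real ^ 'd \<Rightarrow> complex" where
  "kernel s N \<rho> x = (\<Sum>\<^sub>\<infinity>n. of_real (gauss_vec s N n) * echar (int_vec n \<bullet> x + of_int (sq_length n) * \<rho>))"

lemma kernel_measurable [measurable]:
  assumes "s > 0" "N \<ge> 1"
  shows "kernel s N \<rho> \<in> borel_measurable (borel :: (real ^ 'd::finite) measure)"
  unfolding kernel_def[abs_def]
  by (rule infsum_measurable) (use gauss_vec_summable[OF assms] in \<open>auto simp: norm_mult gauss_vec_pos less_imp_le\<close>)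

lemma kernel_prod:
  fixes x :: "real ^ 'd::finite"
  assumes "s > 0" "N \<ge> 1"
  shows "kernel s N \<rho> x = (\<Prod>i\<in>UNIV. theta s N (x $ i) \<rho>)"
proof -
  let ?f = "\<lambda>i (m::int). of_real (gauss_wt s N m) * echar (of_int m * x $ i + (of_int m)\<^sup>2 * \<rho>)"
  have bij: "bij (vec_nth :: int ^ 'd \<Rightarrow> 'd \<Rightarrow> int)"
    by (rule bij_betwI[of _ _ _ vec_lambda]) auto
  have "(\<Prod>i\<in>UNIV. theta s N (x $ i) \<rho>) = (\<Prod>i\<in>UNIV. infsum (?f i) UNIV)"
    by (simp add: theta_def)
  also have "\<dots> = infsum (\<lambda>g. \<Prod>i\<in>UNIV. ?f i (g i)) (PiE UNIV (\<lambda>_. UNIV))"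
    by (rule infsum_prod_PiE_abs[symmetric])
       (use gauss_wt_summable[OF assms] in \<open>auto simp: norm_mult gauss_wt_pos less_imp_le\<close>)
  also have "PiE UNIV (\<lambda>_. UNIV) = (UNIV :: ('d \<Rightarrow> int) set)" by auto
  also have "infsum (\<lambda>g. \<Prod>i\<in>UNIV. ?f i (g i)) (UNIV :: ('d \<Rightarrow> int) set) = (\<Sum>\<^sub>\<infinity>n. \<Prod>i\<in>UNIV. ?f i (vec_nth n i))"
    by (rule infsum_reindex_bij_betw[OF bij, symmetric])
  also have "\<dots> = kernel s N \<rho> x" unfolding kernel_def
  proof (rule infsum_cong)
    fix n :: "int ^ 'd"
    have "int_vec n \<bullet> x + of_int (sq_length n) * \<rho> = (\<Sum>i\<in>UNIV. of_int (n $ i) * x $ i + (of_int (n $ i))\<^sup>2 * \<rho>)"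
      by (simp add: int_vec_def inner_vec_def sq_length_def sum.distrib sum_distrib_right)
    then show "(\<Prod>i\<in>UNIV. ?f i (n $ i)) = of_real (gauss_vec s N n) * echar (int_vec n \<bullet> x + of_int (sq_length n) * \<rho>)"
      by (simp add: prod.distrib gauss_vec_prod echar_sum)
  qed
  finally show ?thesis by simp
qed

lemma norm_kernel_le:
  fixes s v :: real
  assumes s: "s > 0" and v: "v > 0"
  shows "\<exists>C>0. \<forall>N\<ge>1. \<forall>\<rho>. \<forall>x :: real ^ 'd::finite. \<bar>\<rho>\<bar> \<le> 1 \<longrightarrow>
     0 < arc_sum N v \<rho> \<and> norm (kernel s N \<rho> x) \<le> (C * arc_sum N v \<rho> powr (1 / v)) powr (real CARD('d) / 2)"
proof -
  obtain C where C: "C > 0" "\<And>N x t. N \<ge> 1 \<Longrightarrow> \<bar>t\<bar> \<le> 1 \<Longrightarrow> 0 < arc_sum N v t \<and> (norm (theta s N x t))\<^sup>2 \<le> C * arc_sum N v t powr (1 / v)"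
    using theta_sq_le_arc_sum[OF s v] by auto
  have "0 < arc_sum N v \<rho> \<and> norm (kernel s N \<rho> x) \<le> (C * arc_sum N v \<rho> powr (1 / v)) powr (real CARD('d) / 2)"
    if N: "N \<ge> 1" and \<rho>: "\<bar>\<rho>\<bar> \<le> 1" for N \<rho> and x :: "real ^ 'd"
  proof -
    define Y where "Y = C * arc_sum N v \<rho> powr (1 / v)"
    have Gpos: "0 < arc_sum N v \<rho>" using C(2)[OF N \<rho>] by blast
    then have Y: "Y > 0" using C(1) by (simp add: Y_def)
    have th: "norm (theta s N y \<rho>) \<le> Y powr (1 / 2)" for y
      using C(2)[OF N \<rho>, of y] Y unfolding Y_def[symmetric] by (simp add: powr_half_sqrt real_le_rsqrt)
    have "norm (kernel s N \<rho> x) = (\<Prod>i\<in>UNIV. norm (theta s N (x $ i) \<rho>))"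
      unfolding kernel_prod[OF s N] by (rule prod_norm[symmetric])
    also have "\<dots> \<le> (\<Prod>i\<in>(UNIV :: 'd set). Y powr (1 / 2))"
      by (intro prod_mono) (auto simp: th)
    also have "\<dots> = Y powr (real CARD('d) / 2)"
      using Y by (simp add: powr_realpow[symmetric] powr_powr)
    finally show ?thesis using Gpos by (simp add: Y_def)
  qed
  with C(1) show ?thesis by blast
qed

text \<open>With y - x as argument the expansion carries e(-n.x) on the first variable and e(n.y) on
  the second, so the first function meets \<open>fcoeff\<close> and the second
  \<open>fcoeff_pos\<close>.\<close>

definition diff_kernel :: "real \<Rightarrow> nat \<Rightarrow> real \<Rightarrow> (real ^ 'd::finite) \<times> (real ^ 'd) \<Rightarrow> complex" where
  "diff_kernel s N \<rho> z = kernel s N \<rho> (snd z - fst z)"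

definition fcoeff :: "(real ^ 'd::finite \<Rightarrow> complex) \<Rightarrow> int ^ 'd \<Rightarrow> complex" where
  "fcoeff \<phi> n = (\<integral>x. \<phi> x * echar (- (int_vec n \<bullet> x)) \<partial>torus_d)"

text \<open>The coefficient at -n. On a complex conjugate it returns the conjugate of
  \<open>fcoeff\<close>, which lets the bilinear form express the Hermitian pairing of two time
  slices.\<close>

definition fcoeff_pos :: "(real ^ 'd::finite \<Rightarrow> complex) \<Rightarrow> int ^ 'd \<Rightarrow> complex" where
  "fcoeff_pos \<phi> n = (\<integral>x. \<phi> x * echar (int_vec n \<bullet> x) \<partial>torus_d)"

context
  fixes s :: real and N :: nat and \<rho> :: real
  assumes s: "s > 0" and N: "N \<ge> 1"
begin

lemma diff_kernel_measurable [measurable]: "diff_kernel s N \<rho> \<in> borel_measurable (torus_d \<Otimes>\<^sub>M torus_d :: ((real ^ 'd::finite) \<times> (real ^ 'd)) measure)"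
proof -
  have [measurable]: "kernel s N \<rho> \<in> borel_measurable (borel :: (real ^ 'd) measure)" by (rule kernel_measurable[OF s N])
  show ?thesis unfolding diff_kernel_def[abs_def] by measurable
qed

text \<open>Characters diagonalise the convolution: the kernel acts as the multiplier
  \<open>gauss_vec\<close> times a phase. The Gaussian weights dominate both exchanges of sum and
  integral.\<close>

lemma form_expansion:
  fixes \<phi> \<psi> :: "real ^ 'd::finite \<Rightarrow> complex"
  assumes \<phi>: "integrable torus_d \<phi>" and \<psi>: "integrable torus_d \<psi>"
  shows "(\<integral>x. \<phi> x * (\<integral>y. diff_kernel s N \<rho> (x, y) * \<psi> y \<partial>torus_d) \<partial>torus_d) =
    (\<Sum>\<^sub>\<infinity>n. of_real (gauss_vec s N n) * echar (of_int (sq_length n) * \<rho>) * fcoeff \<phi> n * fcoeff_pos \<psi> n)"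
proof -
  have [measurable]: "\<phi> \<in> borel_measurable borel" "\<psi> \<in> borel_measurable borel"
    using borel_measurable_integrable[OF \<phi>] borel_measurable_integrable[OF \<psi>] by (simp_all cong: measurable_cong_sets)
  have sm: "(gauss_vec s N :: int ^ 'd \<Rightarrow> real) summable_on UNIV" by (rule gauss_vec_summable[OF s N])
  have g0: "0 \<le> gauss_vec s N n" for n :: "int ^ 'd" using gauss_vec_pos less_imp_le by blast
  have inner: "(\<integral>y. diff_kernel s N \<rho> (x, y) * \<psi> y \<partial>torus_d) = (\<Sum>\<^sub>\<infinity>n. of_real (gauss_vec s N n) * echar (of_int (sq_length n) * \<rho>) * echar (- (int_vec n \<bullet> x)) * fcoeff_pos \<psi> n)" for x
  proof -
    let ?c = "\<lambda>n y. of_real (gauss_vec s N n) * echar (int_vec n \<bullet> (y - x) + of_int (sq_length n) * \<rho>) * \<psi> y"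
    have "(\<integral>y. diff_kernel s N \<rho> (x, y) * \<psi> y \<partial>torus_d) = (\<integral>y. (\<Sum>\<^sub>\<infinity>n. ?c n y) \<partial>torus_d)"
      unfolding diff_kernel_def kernel_def snd_conv fst_conv infsum_cmult_left' ..
    also have "\<dots> = (\<Sum>\<^sub>\<infinity>n. \<integral>y. ?c n y \<partial>torus_d)"
    proof (rule integral_infsum(2)[OF integrable_norm[OF \<psi>] sm g0])
      show "?c n \<in> borel_measurable torus_d" for n by measurable
    qed (simp add: norm_mult g0)
    also have "\<dots> = (\<Sum>\<^sub>\<infinity>n. of_real (gauss_vec s N n) * echar (of_int (sq_length n) * \<rho>) * echar (- (int_vec n \<bullet> x)) * fcoeff_pos \<psi> n)"
    proof (rule infsum_cong)
      fix n :: "int ^ 'd"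
      have e: "echar (int_vec n \<bullet> (y - x) + of_int (sq_length n) * \<rho>) =
          echar (of_int (sq_length n) * \<rho>) * echar (- (int_vec n \<bullet> x)) * echar (int_vec n \<bullet> y)" for y
        unfolding echar_add[symmetric] by (rule arg_cong[where f = echar]) (simp add: inner_diff_right)
      have "(\<integral>y. ?c n y \<partial>torus_d) = (\<integral>y. (of_real (gauss_vec s N n) * echar (of_int (sq_length n) * \<rho>) * echar (- (int_vec n \<bullet> x))) * (\<psi> y * echar (int_vec n \<bullet> y)) \<partial>torus_d)"
        unfolding e by (intro Bochner_Integration.integral_cong refl) (simp only: mult_ac)
      also have "\<dots> = (of_real (gauss_vec s N n) * echar (of_int (sq_length n) * \<rho>) * echar (- (int_vec n \<bullet> x))) * fcoeff_pos \<psi> n"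
        unfolding fcoeff_pos_def by (rule integral_mult_right_zero)
      finally show "(\<integral>y. ?c n y \<partial>torus_d) = \<dots>" .
    qed
    finally show ?thesis .
  qed
  have fcoeff_pos_le: "norm (fcoeff_pos \<psi> n) \<le> (\<integral>y. norm (\<psi> y) \<partial>torus_d)" for n
    unfolding fcoeff_pos_def by (rule order.trans[OF integral_norm_bound]) (simp add: norm_mult)
  let ?d = "\<lambda>n x. \<phi> x * (of_real (gauss_vec s N n) * echar (of_int (sq_length n) * \<rho>) * echar (- (int_vec n \<bullet> x)) * fcoeff_pos \<psi> n)"
  have "(\<integral>x. \<phi> x * (\<integral>y. diff_kernel s N \<rho> (x, y) * \<psi> y \<partial>torus_d) \<partial>torus_d) = (\<integral>x. (\<Sum>\<^sub>\<infinity>n. ?d n x) \<partial>torus_d)"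
    unfolding inner infsum_cmult_right' ..
  also have "\<dots> = (\<Sum>\<^sub>\<infinity>n. \<integral>x. ?d n x \<partial>torus_d)"
  proof (rule integral_infsum(2)[where g = "\<lambda>x. norm (\<phi> x) * (\<integral>y. norm (\<psi> y) \<partial>torus_d)", OF _ sm g0])
    show "integrable torus_d (\<lambda>x. norm (\<phi> x) * (\<integral>y. norm (\<psi> y) \<partial>torus_d))" using \<phi> by simp
    show "?d n \<in> borel_measurable torus_d" for n by measurable
    show "norm (?d n x) \<le> gauss_vec s N n * (norm (\<phi> x) * (\<integral>y. norm (\<psi> y) \<partial>torus_d))" for n x
      using mult_left_mono[OF fcoeff_pos_le[of n], of "gauss_vec s N n * norm (\<phi> x)"] g0 by (simp add: norm_mult mult_ac)
  qed
  also have "\<dots> = (\<Sum>\<^sub>\<infinity>n. of_real (gauss_vec s N n) * echar (of_int (sq_length n) * \<rho>) * fcoeff \<phi> n * fcoeff_pos \<psi> n)"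
  proof (rule infsum_cong)
    fix n :: "int ^ 'd"
    have "(\<integral>x. ?d n x \<partial>torus_d) = (\<integral>x. (of_real (gauss_vec s N n) * echar (of_int (sq_length n) * \<rho>) * fcoeff_pos \<psi> n) * (\<phi> x * echar (- (int_vec n \<bullet> x))) \<partial>torus_d)"
      by (intro Bochner_Integration.integral_cong refl) (simp only: mult_ac)
    also have "\<dots> = (of_real (gauss_vec s N n) * echar (of_int (sq_length n) * \<rho>) * fcoeff_pos \<psi> n) * fcoeff \<phi> n"
      unfolding fcoeff_def by (rule integral_mult_right_zero)
    finally show "(\<integral>x. ?d n x \<partial>torus_d) = of_real (gauss_vec s N n) * echar (of_int (sq_length n) * \<rho>) * fcoeff \<phi> n * fcoeff_pos \<psi> n"
      by (simp only: mult_ac)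
  qed
  finally show ?thesis .
qed

lemma int_vec_diff: "int_vec (n - m) = int_vec n - (int_vec m :: real ^ 'd::finite)"
  by (simp add: int_vec_def vec_eq_iff)

lemma echar_orthonormal:
  fixes n m :: "int ^ 'd::finite"
  shows "(\<integral>x. echar (int_vec n \<bullet> x) * cnj (echar (int_vec m \<bullet> x)) \<partial>torus_d) = (if n = m then 1 else 0)"
    "(\<integral>x. echar (- (int_vec n \<bullet> x)) * cnj (echar (- (int_vec m \<bullet> x))) \<partial>torus_d) = (if n = m then 1 else 0)"
  using integral_echar_torus_d[of "n - m"] integral_echar_torus_d[of "m - n"]
  by (simp_all add: cnj_echar echar_add[symmetric] int_vec_diff inner_diff_left)

lemma sum_norm_fcoeff_le:
  fixes \<phi> :: "real ^ 'd::finite \<Rightarrow> complex"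
  assumes "\<phi> \<in> borel_measurable torus_d" "\<And>x. norm (\<phi> x) \<le> B" "finite A"
  shows "(\<Sum>n\<in>A. (norm (fcoeff \<phi> n))\<^sup>2) \<le> (\<integral>x. (norm (\<phi> x))\<^sup>2 \<partial>torus_d)"
    "(\<Sum>n\<in>A. (norm (fcoeff_pos \<phi> n))\<^sup>2) \<le> (\<integral>x. (norm (\<phi> x))\<^sup>2 \<partial>torus_d)"
  using torus_d.Bessel_le[of \<phi> B "\<lambda>n x. echar (int_vec n \<bullet> x)" A, OF assms(1,2) _ _ echar_orthonormal(1) assms(3)]
    torus_d.Bessel_le[of \<phi> B "\<lambda>n x. echar (- (int_vec n \<bullet> x))" A, OF assms(1,2) _ _ echar_orthonormal(2) assms(3)]
  by (simp_all add: fcoeff_def fcoeff_pos_def cnj_echar)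

text \<open>The multiplier has modulus at most 1, so AM-GM with weight e in each term, followed by
  Bessel's inequality for both functions, suffices.\<close>

lemma form_L2_bound:
  fixes \<phi> \<psi> :: "real ^ 'd::finite \<Rightarrow> complex"
  assumes \<phi>: "\<phi> \<in> borel_measurable torus_d" "\<And>x. norm (\<phi> x) \<le> B1"
    and \<psi>: "\<psi> \<in> borel_measurable torus_d" "\<And>x. norm (\<psi> x) \<le> B2" and e: "(e::real) > 0"
  shows "norm (\<integral>x. \<phi> x * (\<integral>y. diff_kernel s N \<rho> (x, y) * \<psi> y \<partial>torus_d) \<partial>torus_d)
    \<le> (e * (\<integral>x. (norm (\<phi> x))\<^sup>2 \<partial>torus_d) + (\<integral>x. (norm (\<psi> x))\<^sup>2 \<partial>torus_d) / e) / 2"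
proof -
  define R where "R = (e * (\<integral>x. (norm (\<phi> x))\<^sup>2 \<partial>torus_d) + (\<integral>x. (norm (\<psi> x))\<^sup>2 \<partial>torus_d) / e) / 2"
  have i: "integrable torus_d \<phi>" "integrable torus_d \<psi>"
    using \<phi> \<psi> by (auto intro!: torus_d.integrable_const_bound)
  let ?t = "\<lambda>n. of_real (gauss_vec s N n) * echar (of_int (sq_length n) * \<rho>) * fcoeff \<phi> n * fcoeff_pos \<psi> n"
  have am: "a * b \<le> (e * a\<^sup>2 + b\<^sup>2 / e) / 2" for a b :: real
  proof -
    have "0 \<le> (e * a - b)\<^sup>2 / e" using e by simp
    also have "\<dots> = e * a\<^sup>2 + b\<^sup>2 / e - 2 * (a * b)" using e by (simp add: power2_eq_square field_simps)
    finally show ?thesis by simp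
  qed
  have fin: "(\<Sum>n\<in>A. norm (?t n)) \<le> R" if A: "finite A" for A
  proof -
    have "(\<Sum>n\<in>A. norm (?t n)) \<le> (\<Sum>n\<in>A. (e * (norm (fcoeff \<phi> n))\<^sup>2 + (norm (fcoeff_pos \<psi> n))\<^sup>2 / e) / 2)"
    proof (rule sum_mono)
      fix n
      have "norm (?t n) = gauss_vec s N n * (norm (fcoeff \<phi> n) * norm (fcoeff_pos \<psi> n))"
        using gauss_vec_pos[of s N n] by (simp add: norm_mult)
      also have "\<dots> \<le> 1 * (norm (fcoeff \<phi> n) * norm (fcoeff_pos \<psi> n))"
        using gauss_vec_le_1[OF s] by (intro mult_right_mono) auto
      also have "\<dots> \<le> (e * (norm (fcoeff \<phi> n))\<^sup>2 + (norm (fcoeff_pos \<psi> n))\<^sup>2 / e) / 2"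
        using am by simp
      finally show "norm (?t n) \<le> (e * (norm (fcoeff \<phi> n))\<^sup>2 + (norm (fcoeff_pos \<psi> n))\<^sup>2 / e) / 2" .
    qed
    also have "\<dots> = (e * (\<Sum>n\<in>A. (norm (fcoeff \<phi> n))\<^sup>2) + (\<Sum>n\<in>A. (norm (fcoeff_pos \<psi> n))\<^sup>2) / e) / 2"
      by (simp add: sum.distrib sum_distrib_left sum_divide_distrib add_divide_distrib)
    also have "\<dots> \<le> R" unfolding R_def
      using sum_norm_fcoeff_le(1)[OF \<phi> A] sum_norm_fcoeff_le(2)[OF \<psi> A] e
      by (intro divide_right_mono add_mono mult_left_mono) auto
    finally show ?thesis .
  qed
  have sm: "(\<lambda>n. norm (?t n)) summable_on UNIV"
    by (intro nonneg_bdd_above_summable_on bdd_aboveI2[of _ _ R]) (use fin in auto)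
  have "norm (\<Sum>\<^sub>\<infinity>n. ?t n) \<le> (\<Sum>\<^sub>\<infinity>n. norm (?t n))" by (rule norm_infsum_bound[OF sm])
  also have "\<dots> \<le> R" by (rule infsum_le_finite_sums[OF sm]) (use fin in auto)
  finally show ?thesis unfolding form_expansion[OF i] R_def .
qed

lemma bounded_kernel_diff_kernel:
  assumes "\<kappa> > 0" "\<And>x :: real ^ 'd::finite. norm (kernel s N \<rho> x) \<le> \<kappa>"
  shows "bounded_kernel (torus_d :: (real ^ 'd) measure) (diff_kernel s N \<rho>) \<kappa>"
proof
  fix \<phi> \<psi> :: "real ^ 'd \<Rightarrow> complex" and e :: real
  assume "\<phi> \<in> borel_measurable torus_d" "\<psi> \<in> borel_measurable torus_d"
    "\<exists>B. \<forall>x. norm (\<phi> x) \<le> B" "\<exists>B. \<forall>x. norm (\<psi> x) \<le> B" "e > 0"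
  then show "norm (\<integral>x. \<phi> x * (\<integral>y. diff_kernel s N \<rho> (x, y) * \<psi> y \<partial>torus_d) \<partial>torus_d)
    \<le> (e * (\<integral>x. (norm (\<phi> x))\<^sup>2 \<partial>torus_d) + (\<integral>x. (norm (\<psi> x))\<^sup>2 \<partial>torus_d) / e) / 2"
    using form_L2_bound by blast
qed (use assms in \<open>auto simp: diff_kernel_def\<close>)

end

section \<open>Young inequality and mixed norms\<close>

text \<open>Dividing by the geometric mean m and applying ln w <= w - 1 to each quotient makes the
  logarithms cancel, because the weights sum to 1.\<close>

lemma weighted_AM_GM3:
  fixes x y z a b c :: real
  assumes "0 \<le> x" "0 \<le> y" "0 \<le> z" "0 < a" "0 < b" "0 < c" "a + b + c = 1"
  shows "x powr a * y powr b * z powr c \<le> a * x + b * y + c * z"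
proof (cases "x = 0 \<or> y = 0 \<or> z = 0")
  case True
  then have "x powr a * y powr b * z powr c = 0" by auto
  also have "0 \<le> a * x + b * y + c * z" using assms by simp
  finally show ?thesis .
next
  case False
  then have pos: "x > 0" "y > 0" "z > 0" using assms by auto
  define m where "m = x powr a * y powr b * z powr c"
  have m: "m > 0" using pos by (simp add: m_def)
  have lm: "ln m = a * ln x + b * ln y + c * ln z"
    using pos by (simp add: m_def ln_mult ln_powr)
  have l: "1 + ln w - ln m \<le> w / m" if "w > 0" for w
    using ln_le_minus_one[of "w / m"] that m by (simp add: ln_div)
  have "1 = a * (1 + ln x - ln m) + b * (1 + ln y - ln m) + c * (1 + ln z - ln m)"
  proof -
    have "a * (1 + ln x - ln m) + b * (1 + ln y - ln m) + c * (1 + ln z - ln m) =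
      (a + b + c) + (a * ln x + b * ln y + c * ln z) - (a + b + c) * ln m" by (simp add: algebra_simps)
    then show ?thesis using assms lm by simp
  qed
  also have "\<dots> \<le> a * (x / m) + b * (y / m) + c * (z / m)"
    using assms pos by (intro add_mono mult_left_mono l) auto
  also have "\<dots> = (a * x + b * y + c * z) / m" by (simp add: add_divide_distrib)
  finally show ?thesis using m unfolding m_def[symmetric] by (simp add: pos_le_divide_eq)
qed

definition torus_1 :: "real measure" where
  "torus_1 = density lborel (indicator {0..<1})"

lemma sets_torus_1 [simp, measurable_cong]: "sets torus_1 = sets borel"
  by (simp add: torus_1_def)

lemma space_torus_1 [simp]: "space torus_1 = UNIV"
  by (simp add: torus_1_def)

interpretation torus_1: finite_measure torus_1
proof
  have "emeasure torus_1 UNIV = emeasure lborel {0..<1::real}"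
    unfolding torus_1_def by (subst emeasure_density) (auto simp: nn_integral_indicator)
  then show "emeasure torus_1 (space torus_1) \<noteq> \<infinity>" by simp
qed

lemma nn_integral_torus_1_le:
  assumes [measurable]: "f \<in> borel_measurable borel"
  shows "(\<integral>\<^sup>+t. f t \<partial>torus_1) \<le> (\<integral>\<^sup>+t. f t \<partial>lborel)"
  unfolding torus_1_def by (subst nn_integral_density) (auto intro!: nn_integral_mono simp: indicator_def)

lemma AE_torus_1: "AE t in torus_1. 0 \<le> t \<and> t < 1"
  unfolding torus_1_def by (subst AE_density) (auto intro!: AE_I2 simp: indicator_def split: if_splits)

text \<open>The normalised integrand is a product of powers whose exponents add up to 1, so the weighted
  AM-GM inequality bounds it by terms that integrate to the exponents.\<close>
lemma Young_torus_1:
  fixes G A :: "real \<Rightarrow> real" and p q J L :: real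
  assumes p: "p > 2" and q: "q = p / (p - 1)"
    and [measurable]: "G \<in> borel_measurable borel" "A \<in> borel_measurable borel"
    and G0: "\<And>t. 0 \<le> G t" and A0: "\<And>t. 0 \<le> A t"
    and J: "J > 0" "(\<integral>\<^sup>+t. ennreal (G t) \<partial>lborel) \<le> ennreal J"
    and L: "L > 0" "(\<integral>\<^sup>+t. ennreal (A t) \<partial>torus_1) \<le> ennreal L"
  shows "(\<integral>\<^sup>+t. \<integral>\<^sup>+u. ennreal (G (u - t) powr (2 / p) * A t powr (1 / q) * A u powr (1 / q)) \<partial>torus_1 \<partial>torus_1)
     \<le> ennreal (J powr (2 / p) * L powr (2 / q))"
proof -
  interpret P: pair_sigma_finite torus_1 torus_1 by unfold_locales
  have q1: "1 / q = 1 - 1 / p" using p by (simp add: q field_simps)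
  have q2: "2 / q = 2 - 2 / p" using q1 by simp
  define Q where "Q = J powr (2 / p) * L powr (2 / q)"
  have Q: "Q > 0" using J L by (simp add: Q_def)
  \<comment> \<open>Q is the claimed bound; \<alpha> and \<gamma> are Q times the AM-GM weights 1/p
    and 1 - 2/p, divided by the normalisers J L and L^2 of x, y and z below.\<close>
  define \<alpha> where "\<alpha> = Q / (p * (J * L))"
  define \<gamma> where "\<gamma> = Q * (1 - 2 / p) / L\<^sup>2"
  have \<alpha>: "\<alpha> \<ge> 0" and \<gamma>: "\<gamma> \<ge> 0" using Q J L p by (auto simp: \<alpha>_def \<gamma>_def)
  have pw: "G (u - t) powr (2 / p) * A t powr (1 / q) * A u powr (1 / q) \<le>
     \<alpha> * (G (u - t) * A t) + \<alpha> * (G (u - t) * A u) + \<gamma> * (A t * A u)" for t u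
  proof -
    define x where "x = G (u - t) * A t / (J * L)"
    define y where "y = G (u - t) * A u / (J * L)"
    define z where "z = A t * A u / L\<^sup>2"
    have "x powr (1 / p) * y powr (1 / p) * z powr (1 - 2 / p) \<le> 1 / p * x + 1 / p * y + (1 - 2 / p) * z"
      using G0 A0 J L p by (intro weighted_AM_GM3) (auto simp: x_def y_def z_def)
    then have "Q * (x powr (1 / p) * y powr (1 / p) * z powr (1 - 2 / p)) \<le> Q * (1 / p * x + 1 / p * y + (1 - 2 / p) * z)"
      using Q by (intro mult_left_mono) auto
    moreover have "Q * (1 / p * x + 1 / p * y + (1 - 2 / p) * z) = \<alpha> * (G (u - t) * A t) + \<alpha> * (G (u - t) * A u) + \<gamma> * (A t * A u)"
      by (simp add: x_def y_def z_def \<alpha>_def \<gamma>_def distrib_left mult_ac)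
    moreover have "Q * (x powr (1 / p) * y powr (1 / p) * z powr (1 - 2 / p)) = G (u - t) powr (2 / p) * A t powr (1 / q) * A u powr (1 / q)"
    proof -
      have pp: "w powr (1 / p) * w powr (1 / p) = w powr (2 / p)" for w :: real
        by (simp add: powr_add[symmetric])
      have aa: "w powr (1 / p) * w powr (1 - 2 / p) = w powr (1 / q)" for w :: real
        by (simp add: powr_add[symmetric] q1)
      have LL: "L powr (2 / p) * (L\<^sup>2) powr (1 - 2 / p) = L powr (2 / q)"
      proof -
        have "L\<^sup>2 = L powr 2" using L by (simp add: powr_numeral)
        then have "(L\<^sup>2) powr (1 - 2 / p) = L powr (2 * (1 - 2 / p))" by (simp only: powr_powr)
        then show ?thesis by (simp add: powr_add[symmetric] q2)
      qed
      have "x powr (1 / p) * y powr (1 / p) * z powr (1 - 2 / p) =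
        (G (u - t) powr (1 / p) * G (u - t) powr (1 / p)) * (A t powr (1 / p) * A t powr (1 - 2 / p)) * (A u powr (1 / p) * A u powr (1 - 2 / p))
          / ((J powr (1 / p) * J powr (1 / p)) * ((L powr (1 / p) * L powr (1 / p)) * (L\<^sup>2) powr (1 - 2 / p)))"
        using G0 A0 J L unfolding x_def y_def z_def by (simp add: powr_divide powr_mult mult_ac)
      also have "\<dots> = G (u - t) powr (2 / p) * A t powr (1 / q) * A u powr (1 / q) / Q"
        unfolding pp aa LL Q_def ..
      finally show ?thesis using Q by simp
    qed
    ultimately show ?thesis by simp
  qed
  have I1: "(\<integral>\<^sup>+t. \<integral>\<^sup>+u. ennreal (G (u - t) * A t) \<partial>torus_1 \<partial>torus_1) \<le> ennreal (J * L)"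
  proof -
    have "(\<integral>\<^sup>+t. \<integral>\<^sup>+u. ennreal (G (u - t) * A t) \<partial>torus_1 \<partial>torus_1) \<le> (\<integral>\<^sup>+t. ennreal J * ennreal (A t) \<partial>torus_1)"
    proof (rule nn_integral_mono)
      fix t
      \<comment> \<open>The inner integral is enlarged from the unit interval to the line, where
        translation by t leaves it unchanged; hence J bounds G over the whole line.\<close>
      have "(\<integral>\<^sup>+u. ennreal (G (u - t) * A t) \<partial>torus_1) \<le> (\<integral>\<^sup>+u. ennreal (G (u - t)) * ennreal (A t) \<partial>lborel)"
        by (rule order.trans[OF nn_integral_torus_1_le]) (simp_all add: ennreal_mult G0 A0)
      also have "\<dots> = (\<integral>\<^sup>+u. ennreal (G (u - t)) \<partial>lborel) * ennreal (A t)"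
        by (rule nn_integral_multc) simp
      also have "(\<integral>\<^sup>+u. ennreal (G (u - t)) \<partial>lborel) = (\<integral>\<^sup>+u. ennreal (G u) \<partial>lborel)"
        by (subst nn_integral_real_affine[where c = 1 and t = t]) auto
      also have "\<dots> * ennreal (A t) \<le> ennreal J * ennreal (A t)"
        by (intro mult_right_mono J) auto
      finally show "(\<integral>\<^sup>+u. ennreal (G (u - t) * A t) \<partial>torus_1) \<le> ennreal J * ennreal (A t)" .
    qed
    also have "\<dots> = ennreal J * (\<integral>\<^sup>+t. ennreal (A t) \<partial>torus_1)" by (rule nn_integral_cmult) simp
    also have "\<dots> \<le> ennreal J * ennreal L" by (intro mult_left_mono L) auto
    finally show ?thesis using J L by (simp add: ennreal_mult)
  qed
  have I2: "(\<integral>\<^sup>+t. \<integral>\<^sup>+u. ennreal (G (u - t) * A u) \<partial>torus_1 \<partial>torus_1) \<le> ennreal (J * L)"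
  proof -
    have "(\<integral>\<^sup>+t. \<integral>\<^sup>+u. ennreal (G (u - t) * A u) \<partial>torus_1 \<partial>torus_1) = (\<integral>\<^sup>+u. \<integral>\<^sup>+t. ennreal (G (u - t) * A u) \<partial>torus_1 \<partial>torus_1)"
      by (rule P.Fubini') measurable
    also have "\<dots> \<le> (\<integral>\<^sup>+u. ennreal J * ennreal (A u) \<partial>torus_1)"
    proof (rule nn_integral_mono)
      fix u
      have "(\<integral>\<^sup>+t. ennreal (G (u - t) * A u) \<partial>torus_1) \<le> (\<integral>\<^sup>+t. ennreal (G (u - t)) * ennreal (A u) \<partial>lborel)"
        by (rule order.trans[OF nn_integral_torus_1_le]) (simp_all add: ennreal_mult G0 A0)
      also have "\<dots> = (\<integral>\<^sup>+t. ennreal (G (u - t)) \<partial>lborel) * ennreal (A u)"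
        by (rule nn_integral_multc) simp
      also have "(\<integral>\<^sup>+t. ennreal (G (u - t)) \<partial>lborel) = (\<integral>\<^sup>+t. ennreal (G t) \<partial>lborel)"
        by (subst nn_integral_real_affine[where c = "-1" and t = u]) auto
      also have "\<dots> * ennreal (A u) \<le> ennreal J * ennreal (A u)"
        by (intro mult_right_mono J) auto
      finally show "(\<integral>\<^sup>+t. ennreal (G (u - t) * A u) \<partial>torus_1) \<le> ennreal J * ennreal (A u)" .
    qed
    also have "\<dots> = ennreal J * (\<integral>\<^sup>+t. ennreal (A t) \<partial>torus_1)" by (rule nn_integral_cmult) simp
    also have "\<dots> \<le> ennreal J * ennreal L" by (intro mult_left_mono L) auto
    finally show ?thesis using J L by (simp add: ennreal_mult)
  qed
  have I3: "(\<integral>\<^sup>+t. \<integral>\<^sup>+u. ennreal (A t * A u) \<partial>torus_1 \<partial>torus_1) \<le> ennreal (L\<^sup>2)"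
  proof -
    have "(\<integral>\<^sup>+t. \<integral>\<^sup>+u. ennreal (A t * A u) \<partial>torus_1 \<partial>torus_1) = (\<integral>\<^sup>+t. ennreal (A t) \<partial>torus_1) * (\<integral>\<^sup>+t. ennreal (A t) \<partial>torus_1)"
      by (simp add: ennreal_mult A0 nn_integral_cmult nn_integral_multc)
    also have "\<dots> \<le> ennreal L * ennreal L" by (intro mult_mono L) auto
    finally show ?thesis using L by (simp add: ennreal_mult[symmetric] power2_eq_square)
  qed
  have "(\<integral>\<^sup>+t. \<integral>\<^sup>+u. ennreal (G (u - t) powr (2 / p) * A t powr (1 / q) * A u powr (1 / q)) \<partial>torus_1 \<partial>torus_1)
    \<le> (\<integral>\<^sup>+t. \<integral>\<^sup>+u. ennreal \<alpha> * ennreal (G (u - t) * A t) + ennreal \<alpha> * ennreal (G (u - t) * A u) + ennreal \<gamma> * ennreal (A t * A u) \<partial>torus_1 \<partial>torus_1)"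
    using pw G0 A0 \<alpha> \<gamma>
    by (intro nn_integral_mono) (simp add: ennreal_mult[symmetric] ennreal_plus[symmetric] ennreal_leI del: ennreal_plus)
  also have "\<dots> = ennreal \<alpha> * (\<integral>\<^sup>+t. \<integral>\<^sup>+u. ennreal (G (u - t) * A t) \<partial>torus_1 \<partial>torus_1)
     + ennreal \<alpha> * (\<integral>\<^sup>+t. \<integral>\<^sup>+u. ennreal (G (u - t) * A u) \<partial>torus_1 \<partial>torus_1)
     + ennreal \<gamma> * (\<integral>\<^sup>+t. \<integral>\<^sup>+u. ennreal (A t * A u) \<partial>torus_1 \<partial>torus_1)"
    by (simp add: nn_integral_add nn_integral_cmult)
  also have "\<dots> \<le> ennreal \<alpha> * ennreal (J * L) + ennreal \<alpha> * ennreal (J * L) + ennreal \<gamma> * ennreal (L\<^sup>2)"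
    by (intro add_mono mult_left_mono I1 I2 I3) auto
  also have "\<dots> = ennreal (\<alpha> * (J * L) + \<alpha> * (J * L) + \<gamma> * L\<^sup>2)"
    using \<alpha> \<gamma> J L by (simp add: ennreal_mult[symmetric] ennreal_plus[symmetric] del: ennreal_plus)
  also have "\<alpha> * (J * L) + \<alpha> * (J * L) + \<gamma> * L\<^sup>2 = Q"
    using p J L by (simp add: \<alpha>_def \<gamma>_def) (simp add: field_simps)
  finally show ?thesis by (simp add: Q_def)
qed

section \<open>Fourier coefficients on the paraboloid through time slices\<close>

definition st_fourier :: "((real ^ 'd::finite) \<times> real \<Rightarrow> complex) \<Rightarrow> int ^ 'd \<Rightarrow> complex" where
  "st_fourier F n = (\<integral>z. F z * echar (- (int_vec n \<bullet> fst z + of_int (sq_length n) * snd z)) \<partial>(torus_d \<Otimes>\<^sub>M torus_1))"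

interpretation torus_pair: pair_sigma_finite "torus_d :: (real ^ 'd::finite) measure" torus_1
  by unfold_locales

context
  fixes F :: "(real ^ 'd::finite) \<times> real \<Rightarrow> complex"
  assumes F_int: "integrable (torus_d \<Otimes>\<^sub>M torus_1) F"
begin

lemma F_measurable [measurable]: "F \<in> borel_measurable (torus_d \<Otimes>\<^sub>M torus_1)"
  using F_int by auto

text \<open>The spatial coefficient of the slice at time t with the free Schroedinger phase undone;
  integrating it over time gives the coefficient on the paraboloid.\<close>

definition "time_mode n t = echar (- (of_int (sq_length n) * t)) * fcoeff (\<lambda>x. F (x, t)) n"

lemma time_mode_measurable [measurable]: "time_mode n \<in> borel_measurable torus_1"
  unfolding time_mode_def[abs_def] fcoeff_def by measurable

definition "slice_mass t = (\<integral>x. norm (F (x, t)) \<partial>torus_d)"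

lemma slice_mass_integrable: "integrable torus_1 slice_mass"
proof -
  have "integrable (torus_d \<Otimes>\<^sub>M torus_1) (\<lambda>(x, t). norm (F (x, t)))"
    using integrable_norm[OF F_int] by (simp add: case_prod_unfold)
  from torus_pair.integrable_snd[OF this] show ?thesis unfolding slice_mass_def[abs_def] .
qed

lemma norm_time_mode_le: "norm (time_mode n t) \<le> slice_mass t"
  unfolding time_mode_def fcoeff_def slice_mass_def norm_mult norm_echar mult_1
  by (rule order.trans[OF integral_norm_bound]) (simp add: norm_mult)

lemma st_fourier_eq: "st_fourier F n = (\<integral>t. time_mode n t \<partial>torus_1)"
proof -
  have i: "integrable (torus_d \<Otimes>\<^sub>M torus_1) (\<lambda>(x, t). F (x, t) * echar (- (int_vec n \<bullet> x + of_int (sq_length n) * t)))"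
    by (rule Bochner_Integration.integrable_bound[OF F_int]) (auto simp: norm_mult)
  have "st_fourier F n = (\<integral>t. (\<integral>x. F (x, t) * echar (- (int_vec n \<bullet> x + of_int (sq_length n) * t)) \<partial>torus_d) \<partial>torus_1)"
    unfolding torus_pair.integral_snd[OF i] st_fourier_def by (simp add: case_prod_unfold)
  also have "\<dots> = (\<integral>t. time_mode n t \<partial>torus_1)"
  proof (intro Bochner_Integration.integral_cong refl)
    fix t
    have e: "echar (- (int_vec n \<bullet> x + of_int (sq_length n) * t)) = echar (- (of_int (sq_length n) * t)) * echar (- (int_vec n \<bullet> x))" for x
      unfolding echar_add[symmetric] by (rule arg_cong[where f = echar]) simp
    have "(\<integral>x. F (x, t) * echar (- (int_vec n \<bullet> x + of_int (sq_length n) * t)) \<partial>torus_d) =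
       (\<integral>x. echar (- (of_int (sq_length n) * t)) * (F (x, t) * echar (- (int_vec n \<bullet> x))) \<partial>torus_d)"
      unfolding e by (intro Bochner_Integration.integral_cong refl) (simp only: mult_ac)
    also have "\<dots> = time_mode n t" unfolding time_mode_def fcoeff_def by (rule integral_mult_right_zero)
    finally show "(\<integral>x. F (x, t) * echar (- (int_vec n \<bullet> x + of_int (sq_length n) * t)) \<partial>torus_d) = time_mode n t" .
  qed
  finally show ?thesis .
qed

lemma norm_st_fourier_le: "norm (st_fourier F n) \<le> (\<integral>z. norm (F z) \<partial>(torus_d \<Otimes>\<^sub>M torus_1))"
  unfolding st_fourier_def by (rule order.trans[OF integral_norm_bound]) (simp add: norm_mult)

context
  fixes s :: real and N :: nat
  assumes s: "s > 0" and N: "N \<ge> 1"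
begin

text \<open>Coefficients of an integrable function are bounded, so the Gaussian decides; this also
  supplies the summability clause of the theorem.\<close>

lemma summable_weighted_fourier:
  "(\<lambda>n. gauss_vec s N n * (norm (st_fourier F n))\<^sup>2) summable_on UNIV"
proof (rule summable_on_comparison_test)
  let ?B = "\<integral>z. norm (F z) \<partial>(torus_d \<Otimes>\<^sub>M torus_1)"
  show "(\<lambda>n::int ^ 'd. gauss_vec s N n * ?B\<^sup>2) summable_on UNIV"
    by (intro summable_on_cmult_left gauss_vec_summable s N)
  show "gauss_vec s N n * (norm (st_fourier F n))\<^sup>2 \<le> gauss_vec s N n * ?B\<^sup>2" for n
    using gauss_vec_pos[of s N n] by (intro mult_left_mono power_mono norm_st_fourier_le) auto
qed (auto simp: gauss_vec_pos less_imp_le)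

definition "slice_form t u = (\<Sum>\<^sub>\<infinity>n. of_real (gauss_vec s N n) * (time_mode n t * cnj (time_mode n u)))"

text \<open>One factor of the squared modulus is replaced by its time integral, then the other, and
  each time the Gaussian weights allow the sum to move inside. One variable at a time, only
  integrability on \<open>torus_1\<close> is called for.\<close>

lemma weighted_sum_le_slice_form:
  "ennreal (\<Sum>\<^sub>\<infinity>n. gauss_vec s N n * (norm (st_fourier F n))\<^sup>2) \<le> (\<integral>\<^sup>+t. \<integral>\<^sup>+u. ennreal (norm (slice_form t u)) \<partial>torus_1 \<partial>torus_1)"
proof -
  have sm: "(gauss_vec s N :: int ^ 'd \<Rightarrow> real) summable_on UNIV" by (rule gauss_vec_summable[OF s N])
  have g0: "0 \<le> gauss_vec s N n" for n :: "int ^ 'd" using gauss_vec_pos less_imp_le by blast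
  let ?B = "\<integral>z. norm (F z) \<partial>(torus_d \<Otimes>\<^sub>M torus_1)"
  let ?c = "\<lambda>n t. of_real (gauss_vec s N n) * (time_mode n t * cnj (st_fourier F n))"
  have cle: "norm (?c n t) \<le> gauss_vec s N n * (slice_mass t * ?B)" for n t
  proof -
    have "norm (?c n t) = gauss_vec s N n * (norm (time_mode n t) * norm (st_fourier F n))" using g0[of n] by (simp add: norm_mult)
    also have "\<dots> \<le> gauss_vec s N n * (slice_mass t * ?B)"
      by (intro mult_left_mono mult_mono norm_time_mode_le norm_st_fourier_le g0) (auto simp: slice_mass_def)
    finally show ?thesis .
  qed
  have o: "integrable torus_1 (\<lambda>t. \<Sum>\<^sub>\<infinity>n. ?c n t)" "(\<integral>t. (\<Sum>\<^sub>\<infinity>n. ?c n t) \<partial>torus_1) = (\<Sum>\<^sub>\<infinity>n. \<integral>t. ?c n t \<partial>torus_1)"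
  proof -
    have "integrable torus_1 (\<lambda>t. slice_mass t * ?B)" using slice_mass_integrable by simp
    moreover have "?c n \<in> borel_measurable torus_1" for n by measurable
    ultimately show "integrable torus_1 (\<lambda>t. \<Sum>\<^sub>\<infinity>n. ?c n t)" "(\<integral>t. (\<Sum>\<^sub>\<infinity>n. ?c n t) \<partial>torus_1) = (\<Sum>\<^sub>\<infinity>n. \<integral>t. ?c n t \<partial>torus_1)"
      using integral_infsum(1,2)[where M = torus_1 and g = "\<lambda>t. slice_mass t * ?B" and w = "gauss_vec s N" and c = ?c] sm g0 cle by auto
  qed
  have "(\<Sum>\<^sub>\<infinity>n. \<integral>t. ?c n t \<partial>torus_1) = (\<Sum>\<^sub>\<infinity>n. of_real (gauss_vec s N n * (norm (st_fourier F n))\<^sup>2))"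
  proof (rule infsum_cong)
    fix n :: "int ^ 'd"
    have "(\<integral>t. ?c n t \<partial>torus_1) = (\<integral>t. (of_real (gauss_vec s N n) * cnj (st_fourier F n)) * time_mode n t \<partial>torus_1)"
      by (intro Bochner_Integration.integral_cong refl) (simp only: mult_ac)
    also have "\<dots> = (of_real (gauss_vec s N n) * cnj (st_fourier F n)) * st_fourier F n"
      unfolding st_fourier_eq by (rule integral_mult_right_zero)
    also have "\<dots> = of_real (gauss_vec s N n * (norm (st_fourier F n))\<^sup>2)"
      unfolding of_real_mult complex_norm_square by (simp only: mult_ac)
    finally show "(\<integral>t. ?c n t \<partial>torus_1) = of_real (gauss_vec s N n * (norm (st_fourier F n))\<^sup>2)" .
  qed
  also have "\<dots> = of_real (\<Sum>\<^sub>\<infinity>n. gauss_vec s N n * (norm (st_fourier F n))\<^sup>2)"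
    using has_sum_bounded_linear[OF bounded_linear_of_real has_sum_infsum[OF summable_weighted_fourier]]
    by (intro infsumI) (simp add: o_def)
  finally have e1: "(\<integral>t. (\<Sum>\<^sub>\<infinity>n. ?c n t) \<partial>torus_1) = of_real (\<Sum>\<^sub>\<infinity>n. gauss_vec s N n * (norm (st_fourier F n))\<^sup>2)"
    using o(2) by simp
  have nn: "0 \<le> (\<Sum>\<^sub>\<infinity>n. gauss_vec s N n * (norm (st_fourier F n))\<^sup>2)"
    using g0 by (intro infsum_nonneg) auto
  have "ennreal (\<Sum>\<^sub>\<infinity>n. gauss_vec s N n * (norm (st_fourier F n))\<^sup>2) = ennreal (norm (\<integral>t. (\<Sum>\<^sub>\<infinity>n. ?c n t) \<partial>torus_1))"
    unfolding e1 norm_of_real using nn by simp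
  also have "\<dots> \<le> (\<integral>\<^sup>+t. ennreal (norm (\<Sum>\<^sub>\<infinity>n. ?c n t)) \<partial>torus_1)"
    by (rule integral_norm_bound_ennreal[OF o(1)])
  also have "\<dots> \<le> (\<integral>\<^sup>+t. \<integral>\<^sup>+u. ennreal (norm (slice_form t u)) \<partial>torus_1 \<partial>torus_1)"
  proof (rule nn_integral_mono)
    fix t
    let ?d = "\<lambda>n u. of_real (gauss_vec s N n) * (time_mode n t * cnj (time_mode n u))"
    have dle: "norm (?d n u) \<le> gauss_vec s N n * (slice_mass t * slice_mass u)" for n u
    proof -
      have "norm (?d n u) = gauss_vec s N n * (norm (time_mode n t) * norm (time_mode n u))" using g0[of n] by (simp add: norm_mult)
      also have "\<dots> \<le> gauss_vec s N n * (slice_mass t * slice_mass u)"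
        by (intro mult_left_mono mult_mono norm_time_mode_le g0) (auto simp: slice_mass_def)
      finally show ?thesis .
    qed
    have i: "integrable torus_1 (\<lambda>u. slice_form t u)" "(\<integral>u. slice_form t u \<partial>torus_1) = (\<Sum>\<^sub>\<infinity>n. \<integral>u. ?d n u \<partial>torus_1)"
    proof -
      have "integrable torus_1 (\<lambda>u. slice_mass t * slice_mass u)" using slice_mass_integrable by simp
      moreover have "?d n \<in> borel_measurable torus_1" for n by measurable
      ultimately show "integrable torus_1 (\<lambda>u. slice_form t u)" "(\<integral>u. slice_form t u \<partial>torus_1) = (\<Sum>\<^sub>\<infinity>n. \<integral>u. ?d n u \<partial>torus_1)"
        unfolding slice_form_def
        using integral_infsum(1,2)[where M = torus_1 and g = "\<lambda>u. slice_mass t * slice_mass u" and w = "gauss_vec s N" and c = ?d] sm g0 dle by auto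
    qed
    have "(\<Sum>\<^sub>\<infinity>n. \<integral>u. ?d n u \<partial>torus_1) = (\<Sum>\<^sub>\<infinity>n. ?c n t)"
    proof (rule infsum_cong)
      fix n :: "int ^ 'd"
      have "(\<integral>u. ?d n u \<partial>torus_1) = (\<integral>u. (of_real (gauss_vec s N n) * time_mode n t) * cnj (time_mode n u) \<partial>torus_1)"
        by (intro Bochner_Integration.integral_cong refl) (simp only: mult_ac)
      also have "\<dots> = (of_real (gauss_vec s N n) * time_mode n t) * (\<integral>u. cnj (time_mode n u) \<partial>torus_1)"
        by (rule integral_mult_right_zero)
      also have "(\<integral>u. cnj (time_mode n u) \<partial>torus_1) = cnj (st_fourier F n)"
        unfolding st_fourier_eq by (rule Bochner_Integration.integral_cnj)
      finally show "(\<integral>u. ?d n u \<partial>torus_1) = ?c n t" by (simp only: mult_ac)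
    qed
    then have "ennreal (norm (\<Sum>\<^sub>\<infinity>n. ?c n t)) = ennreal (norm (\<integral>u. slice_form t u \<partial>torus_1))" using i(2) by simp
    also have "\<dots> \<le> (\<integral>\<^sup>+u. ennreal (norm (slice_form t u)) \<partial>torus_1)"
      by (rule integral_norm_bound_ennreal[OF i(1)])
    finally show "ennreal (norm (\<Sum>\<^sub>\<infinity>n. ?c n t)) \<le> (\<integral>\<^sup>+u. ennreal (norm (slice_form t u)) \<partial>torus_1)" .
  qed
  finally show ?thesis .
qed

text \<open>The phases of the two modes combine to e(|n|^2 (u - t)), so only the time difference
  enters the kernel.\<close>

lemma slice_form_form:
  assumes "integrable torus_d (\<lambda>x. F (x, t))" "integrable torus_d (\<lambda>x. F (x, u))"
  shows "slice_form t u = (\<integral>x. F (x, t) * (\<integral>y. diff_kernel s N (u - t) (x, y) * cnj (F (y, u)) \<partial>torus_d) \<partial>torus_d)"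
proof -
  have "(\<integral>x. F (x, t) * (\<integral>y. diff_kernel s N (u - t) (x, y) * cnj (F (y, u)) \<partial>torus_d) \<partial>torus_d) =
    (\<Sum>\<^sub>\<infinity>n. of_real (gauss_vec s N n) * echar (of_int (sq_length n) * (u - t)) * fcoeff (\<lambda>x. F (x, t)) n * fcoeff_pos (\<lambda>y. cnj (F (y, u))) n)"
    using assms by (intro form_expansion s N) auto
  also have "\<dots> = slice_form t u" unfolding slice_form_def
  proof (rule infsum_cong)
    fix n :: "int ^ 'd"
    have 1: "fcoeff_pos (\<lambda>y. cnj (F (y, u))) n = cnj (fcoeff (\<lambda>x. F (x, u)) n)"
      unfolding fcoeff_pos_def fcoeff_def Bochner_Integration.integral_cnj[symmetric] by (simp add: cnj_echar)
    have 2: "echar (of_int (sq_length n) * (u - t)) = echar (- (of_int (sq_length n) * t)) * cnj (echar (- (of_int (sq_length n) * u)))"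
      unfolding cnj_echar echar_add[symmetric] by (rule arg_cong[where f = echar]) (simp add: algebra_simps)
    show "of_real (gauss_vec s N n) * echar (of_int (sq_length n) * (u - t)) * fcoeff (\<lambda>x. F (x, t)) n * fcoeff_pos (\<lambda>y. cnj (F (y, u))) n =
       of_real (gauss_vec s N n) * (time_mode n t * cnj (time_mode n u))"
      unfolding 1 2 time_mode_def complex_cnj_mult by (simp only: mult_ac)
  qed
  finally show ?thesis by simp
qed

end

end

section \<open>The restriction estimate\<close>

text \<open>L is a positive upper bound for the integral, as \<open>Young_torus_1\<close> requires,
  rather than the integral itself; a vanishing integral is treated in the theorem.\<close>

lemma core_estimate:
  fixes s p :: real
  assumes s: "s > 0" and p: "p > 2 + 8 / real CARD('d::finite)"
  shows "\<exists>C>0. \<forall>N\<ge>1. \<forall>F :: (real ^ 'd) \<times> real \<Rightarrow> complex. \<forall>L>0.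
    F \<in> borel_measurable (torus_d \<Otimes>\<^sub>M torus_1) \<longrightarrow> integrable (torus_d \<Otimes>\<^sub>M torus_1) (\<lambda>z. norm (F z) powr (p / (p - 1))) \<longrightarrow>
    (\<integral>z. norm (F z) powr (p / (p - 1)) \<partial>(torus_d \<Otimes>\<^sub>M torus_1)) \<le> L \<longrightarrow>
    (\<Sum>\<^sub>\<infinity>n. gauss_vec s N n * (norm (st_fourier F n))\<^sup>2)
      \<le> C * real N powr (real CARD('d) - 2 * (real CARD('d) + 2) / p) * L powr (2 / (p / (p - 1)))"
proof -
  define d where "d = real CARD('d)"
  have d: "d > 0" by (simp add: d_def)
  have p2: "p > 2" using p d by (smt (verit) d_def divide_pos_pos)
  define q where "q = p / (p - 1)"
  have q: "1 < q" "q < 2" using p2 by (auto simp: q_def field_simps)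
  \<comment> \<open>This v makes (d/2)(2/q - 1)/v equal to 2/p, so the bound at fixed times carries
    \<open>arc_sum\<close> to the power 2/p, the shape that \<open>Young_torus_1\<close>
    expects.\<close>
  define v where "v = d * (p - 2) / 4"
  have v: "v > 2"
  proof -
    have "8 / d < p - 2" using p by (simp add: d_def)
    then have "8 < (p - 2) * d" using d by (simp add: divide_less_eq)
    then show ?thesis by (simp add: v_def mult.commute)
  qed
  have v0: "v > 0" using v by simp
  obtain C0 where C0: "C0 > 0" "\<And>N \<rho> (x :: real ^ 'd). N \<ge> 1 \<Longrightarrow> \<bar>\<rho>\<bar> \<le> 1 \<Longrightarrow>
     0 < arc_sum N v \<rho> \<and> norm (kernel s N \<rho> x) \<le> (C0 * arc_sum N v \<rho> powr (1 / v)) powr (d / 2)"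
    using norm_kernel_le[where 'd = 'd, OF s v0] unfolding d_def by auto
  obtain C1 where C1: "C1 > 0" "\<And>N. N \<ge> 1 \<Longrightarrow> (\<integral>\<^sup>+t. ennreal (arc_sum N v t) \<partial>lborel) \<le> ennreal (C1 * real N powr (2 * v - 2))"
    using nn_integral_arc_sum_le[OF v] by auto
  define Cq where "Cq = 1 / (2 * q) + 1 / (2 * (2 - q)) + 1"
  have Cq: "Cq > 0" using q by (simp add: Cq_def add_pos_pos)
  define K where "K = Cq * C0 powr (2 * v / p)"
  have K: "K > 0" using Cq C0(1) by (simp add: K_def)
  have "(\<Sum>\<^sub>\<infinity>n. gauss_vec s N n * (norm (st_fourier F n))\<^sup>2)
      \<le> (K * C1 powr (2 / p)) * real N powr (d - 2 * (d + 2) / p) * L powr (2 / q)"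
    if N: "N \<ge> 1" and L: "L > 0" and F [measurable]: "F \<in> borel_measurable (torus_d \<Otimes>\<^sub>M torus_1)"
      and Fq: "integrable (torus_d \<Otimes>\<^sub>M torus_1) (\<lambda>z. norm (F z) powr q)"
      and FL: "(\<integral>z. norm (F z) powr q \<partial>(torus_d \<Otimes>\<^sub>M torus_1)) \<le> L"
    for N L and F :: "(real ^ 'd) \<times> real \<Rightarrow> complex"
  proof -
    interpret fm: finite_measure "torus_d \<Otimes>\<^sub>M torus_1 :: ((real ^ 'd) \<times> real) measure"
      by (intro finite_measure_pair_measure torus_d.finite_measure_axioms torus_1.finite_measure_axioms)
    have Fi: "integrable (torus_d \<Otimes>\<^sub>M torus_1) F"
      by (rule fm.integrable_of_integrable_powr[OF q(1) F Fq])
    define A where "A t = (\<integral>x. norm (F (x, t)) powr q \<partial>torus_d)" for t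
    have Am [measurable]: "A \<in> borel_measurable borel"
    proof -
      have "A \<in> borel_measurable torus_1" unfolding A_def[abs_def] by measurable
      then show ?thesis by (simp cong: measurable_cong_sets)
    qed
    have A0: "0 \<le> A t" for t by (simp add: A_def)
    have Fq': "integrable (torus_d \<Otimes>\<^sub>M torus_1) (\<lambda>(x, t). norm (F (x, t)) powr q)"
      using Fq by (simp add: case_prod_unfold)
    have AL: "(\<integral>\<^sup>+t. ennreal (A t) \<partial>torus_1) \<le> ennreal L"
    proof -
      have "integrable torus_1 A" using torus_pair.integrable_snd[OF Fq'] unfolding A_def[abs_def] .
      then have "(\<integral>\<^sup>+t. ennreal (A t) \<partial>torus_1) = ennreal (\<integral>t. A t \<partial>torus_1)"
        by (rule nn_integral_eq_integral) (simp add: A0)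
      also have "(\<integral>t. A t \<partial>torus_1) = (\<integral>z. norm (F z) powr q \<partial>(torus_d \<Otimes>\<^sub>M torus_1))"
        unfolding A_def torus_pair.integral_snd[OF Fq'] by (simp add: case_prod_unfold)
      finally show ?thesis using FL by (simp add: ennreal_leI)
    qed
    define J where "J = C1 * real N powr (2 * v - 2)"
    have J: "J > 0" using C1 N by (simp add: J_def)
    \<comment> \<open>Slices have a finite L^q norm only at almost every time, and times in [0, 1)
      give |u - t| <= 1, the range in which \<open>arc_sum\<close> controls the kernel.\<close>
    define good where "good t \<longleftrightarrow> integrable torus_d (\<lambda>x. norm (F (x, t)) powr q) \<and> 0 \<le> t \<and> t < 1" for t
    have good: "AE t in torus_1. good t"
      using torus_pair.AE_integrable_snd[OF Fq'] AE_torus_1 unfolding good_def by eventually_elim simp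
    have BBle: "norm (slice_form F s N t u) \<le> K * (arc_sum N v (u - t) powr (2 / p) * A t powr (1 / q) * A u powr (1 / q))"
      if "good t" "good u" for t u
    proof -
      define \<rho> where "\<rho> = u - t"
      have \<rho>: "\<bar>\<rho>\<bar> \<le> 1" using that by (auto simp: \<rho>_def good_def)
      define \<kappa> where "\<kappa> = (C0 * arc_sum N v \<rho> powr (1 / v)) powr (d / 2)"
      have G: "0 < arc_sum N v \<rho>" using C0(2)[OF N \<rho>] by blast
      have \<kappa>: "\<kappa> > 0" using C0(1) G by (simp add: \<kappa>_def)
      interpret bounded_kernel "torus_d :: (real ^ 'd) measure" "diff_kernel s N \<rho>" \<kappa>
        using C0(2)[OF N \<rho>] by (intro bounded_kernel_diff_kernel s N \<kappa>) (simp add: \<kappa>_def)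
      have m: "(\<lambda>x. F (x, t)) \<in> borel_measurable torus_d" for t by measurable
      then have m': "(\<lambda>x. cnj (F (x, t))) \<in> borel_measurable torus_d" for t by measurable
      have i: "integrable torus_d (\<lambda>x. norm (F (x, t)) powr q)" "integrable torus_d (\<lambda>x. norm (F (x, u)) powr q)"
        using that by (auto simp: good_def)
      then have i': "integrable torus_d (\<lambda>x. norm (cnj (F (x, u))) powr q)" by simp
      have "slice_form F s N t u = (\<integral>x. F (x, t) * T (\<lambda>y. cnj (F (y, u))) x \<partial>torus_d)"
        unfolding T_def unfolding \<rho>_def
        by (rule slice_form_form[OF Fi s N torus_d.integrable_of_integrable_powr[OF q(1) m i(1)] torus_d.integrable_of_integrable_powr[OF q(1) m i(2)]])
      also have "norm \<dots> \<le> Cq * \<kappa> powr (2 / q - 1) * A t powr (1 / q) * A u powr (1 / q)"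
        using form_le[OF q m m' i(1) i'] by (simp add: Cq_def A_def)
      also have "\<kappa> powr (2 / q - 1) = C0 powr (2 * v / p) * arc_sum N v \<rho> powr (2 / p)"
      proof -
        have e: "d / 2 * (2 / q - 1) = 2 * v / p" using p2 by (simp add: q_def v_def field_simps)
        have e2: "1 / v * (d / 2) * (2 / q - 1) = 2 / p" unfolding mult.assoc e using v0 by simp
        show ?thesis unfolding \<kappa>_def powr_powr e powr_mult e2 ..
      qed
      finally show ?thesis by (simp add: K_def \<rho>_def mult_ac)
    qed
    let ?H = "\<lambda>t u. arc_sum N v (u - t) powr (2 / p) * A t powr (1 / q) * A u powr (1 / q)"
    have H0: "0 \<le> ?H t u" for t u by simp
    have "ennreal (\<Sum>\<^sub>\<infinity>n. gauss_vec s N n * (norm (st_fourier F n))\<^sup>2) \<le> (\<integral>\<^sup>+t. \<integral>\<^sup>+u. ennreal (norm (slice_form F s N t u)) \<partial>torus_1 \<partial>torus_1)"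
      by (rule weighted_sum_le_slice_form[OF Fi s N])
    also have "\<dots> \<le> (\<integral>\<^sup>+t. \<integral>\<^sup>+u. ennreal K * ennreal (?H t u) \<partial>torus_1 \<partial>torus_1)"
    \<comment> \<open>Nested comparisons, almost everywhere in t and then in u, avoid null sets of
      the product.\<close>
    proof (rule nn_integral_mono_AE)
      show "AE t in torus_1. (\<integral>\<^sup>+u. ennreal (norm (slice_form F s N t u)) \<partial>torus_1) \<le> (\<integral>\<^sup>+u. ennreal K * ennreal (?H t u) \<partial>torus_1)"
        using good
      proof eventually_elim
        case (elim t)
        show ?case
        proof (rule nn_integral_mono_AE)
          show "AE u in torus_1. ennreal (norm (slice_form F s N t u)) \<le> ennreal K * ennreal (?H t u)"
            using good
          proof eventually_elim
            case (elim u)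
            show ?case unfolding ennreal_mult[OF less_imp_le[OF K] H0, symmetric]
              by (rule ennreal_leI[OF BBle[OF \<open>good t\<close> elim]])
          qed
        qed
      qed
    qed
    also have "\<dots> = ennreal K * (\<integral>\<^sup>+t. \<integral>\<^sup>+u. ennreal (?H t u) \<partial>torus_1 \<partial>torus_1)"
      by (subst nn_integral_cmult[symmetric]; (subst nn_integral_cmult)?) measurable
    also have "\<dots> \<le> ennreal K * ennreal (J powr (2 / p) * L powr (2 / q))"
      by (intro mult_left_mono Young_torus_1[OF p2 q_def _ Am arc_sum_nonneg A0 J _ L AL] arc_sum_measurable)
         (use C1(2)[OF N] in \<open>auto simp: J_def\<close>)
    also have "\<dots> = ennreal (K * (J powr (2 / p) * L powr (2 / q)))"
      using K by (simp add: ennreal_mult)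
    finally have "(\<Sum>\<^sub>\<infinity>n. gauss_vec s N n * (norm (st_fourier F n))\<^sup>2) \<le> K * (J powr (2 / p) * L powr (2 / q))"
      using K by (subst (asm) ennreal_le_iff) auto
    also have "J powr (2 / p) = C1 powr (2 / p) * real N powr (d - 2 * (d + 2) / p)"
    proof -
      have e: "(2 * v - 2) * (2 / p) = d - 2 * (d + 2) / p" using p2 by (simp add: v_def field_simps)
      show ?thesis unfolding J_def powr_mult powr_powr e ..
    qed
    finally show ?thesis by (simp add: mult_ac)
  qed
  moreover have "K * C1 powr (2 / p) > 0" using K C1 by simp
  ultimately show ?thesis unfolding d_def q_def by (intro exI[of _ "K * C1 powr (2 / p)"]) auto
qed

section \<open>From Lebesgue measure on the unit box to the Borel product measure\<close>

definition unit_box :: "((real ^ 'd) \<times> real) set" where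
  "unit_box = {(x, t). (\<forall>i. 0 \<le> x $ i \<and> x $ i < 1) \<and> 0 \<le> t \<and> t < 1}"

lemma unit_box_eq: "unit_box = cube \<times> {0..<1}"
  by (auto simp: unit_box_def cube_def)

lemma unit_box_measurable [measurable]: "(unit_box :: ((real ^ 'd::finite) \<times> real) set) \<in> sets borel"
  unfolding unit_box_eq borel_prod[symmetric] by measurable

lemma pair_torus_d_torus_1: "(torus_d \<Otimes>\<^sub>M torus_1 :: ((real ^ 'd::finite) \<times> real) measure) = density lborel (\<lambda>z. ennreal (indicator unit_box z))"
proof -
  have "(torus_d \<Otimes>\<^sub>M torus_1 :: ((real ^ 'd) \<times> real) measure) = density (lborel \<Otimes>\<^sub>M lborel) (\<lambda>(x, t). indicator cube x * indicator {0..<1} t)"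
    unfolding torus_d_def torus_1_def
    by (rule pair_measure_density)
       (auto simp: torus_1_def[symmetric] lborel.sigma_finite_measure_axioms intro: torus_1.sigma_finite_measure_axioms)
  also have "\<dots> = density lborel (\<lambda>z. ennreal (indicator unit_box z))"
    unfolding lborel_prod
  proof (rule density_cong)
    show "(\<lambda>(x, t). indicator cube x * indicator {0..<1} t :: ennreal) \<in> borel_measurable (lborel :: ((real ^ 'd) \<times> real) measure)"
      unfolding lborel_prod[symmetric] by measurable
    show "(\<lambda>z. ennreal (indicator unit_box z)) \<in> borel_measurable (lborel :: ((real ^ 'd) \<times> real) measure)"
      by measurable
    show "AE z in (lborel :: ((real ^ 'd) \<times> real) measure). (case z of (x, t) \<Rightarrow> indicator cube x * indicator {0..<1} t) = ennreal (indicator unit_box z)"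
      by (rule AE_I2) (auto simp: unit_box_eq indicator_def)
  qed
  finally show ?thesis .
qed

lemma torus_measure_eq: "torus_measure = lebesgue_on unit_box"
  by (simp add: torus_measure_def unit_box_def)

text \<open>\<open>torus_measure\<close> carries the completed sigma-algebra and the product measure
  the Borel one. Once h is replaced by a Borel function almost everywhere, the indicator of the box
  moves both integrals to \<open>lborel\<close>.\<close>

lemma torus_integral_eq:
  fixes h h' :: "(real ^ 'd::finite) \<times> real \<Rightarrow> 'b::{banach, second_countable_topology}"
  assumes h: "h \<in> borel_measurable torus_measure" and h' [measurable]: "h' \<in> borel_measurable borel"
    and ae: "AE z in lborel. z \<in> unit_box \<longrightarrow> h z = h' z"
  shows "(\<integral>z. h z \<partial>torus_measure) = (\<integral>z. h' z \<partial>(torus_d \<Otimes>\<^sub>M torus_1))"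
    "integrable torus_measure h \<longleftrightarrow> integrable (torus_d \<Otimes>\<^sub>M torus_1) h'"
proof -
  have S: "unit_box \<inter> space lebesgue \<in> sets (lebesgue :: ((real ^ 'd) \<times> real) measure)"
    using unit_box_measurable by (auto intro: sets_completionI_sets)
  have m: "(\<lambda>z. indicator unit_box z *\<^sub>R h z) \<in> borel_measurable lebesgue"
    using h unfolding torus_measure_eq borel_measurable_restrict_space_iff[OF S] .
  have mb: "(\<lambda>z. indicator unit_box z *\<^sub>R h' z) \<in> borel_measurable lborel" by measurable
  then have m': "(\<lambda>z. indicator unit_box z *\<^sub>R h' z) \<in> borel_measurable lebesgue" by (rule measurable_completion)
  have "AE z in lborel. indicator unit_box z *\<^sub>R h z = indicator unit_box z *\<^sub>R h' z"
    using ae by eventually_elim (auto simp: indicator_def)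
  then have ae': "AE z in lebesgue. indicator unit_box z *\<^sub>R h z = indicator unit_box z *\<^sub>R h' z"
    by (rule AE_completion)
  have "(\<integral>z. h z \<partial>torus_measure) = (\<integral>z. indicator unit_box z *\<^sub>R h z \<partial>lebesgue)"
    unfolding torus_measure_eq by (rule integral_restrict_space[OF S])
  also have "\<dots> = (\<integral>z. indicator unit_box z *\<^sub>R h' z \<partial>lebesgue)" by (rule integral_cong_AE[OF m m' ae'])
  also have "\<dots> = (\<integral>z. indicator unit_box z *\<^sub>R h' z \<partial>lborel)" by (rule integral_completion[OF mb])
  also have "\<dots> = (\<integral>z. h' z \<partial>(torus_d \<Otimes>\<^sub>M torus_1))"
    unfolding pair_torus_d_torus_1 by (rule integral_density[symmetric]) auto
  finally show "(\<integral>z. h z \<partial>torus_measure) = (\<integral>z. h' z \<partial>(torus_d \<Otimes>\<^sub>M torus_1))" .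
  have "integrable torus_measure h \<longleftrightarrow> integrable lebesgue (\<lambda>z. indicator unit_box z *\<^sub>R h z)"
    unfolding torus_measure_eq by (rule integrable_restrict_space[OF S])
  also have "\<dots> \<longleftrightarrow> integrable lebesgue (\<lambda>z. indicator unit_box z *\<^sub>R h' z)" by (rule integrable_cong_AE[OF m m' ae'])
  also have "\<dots> \<longleftrightarrow> integrable lborel (\<lambda>z. indicator unit_box z *\<^sub>R h' z)" by (rule integrable_completion[OF mb])
  also have "\<dots> \<longleftrightarrow> integrable (torus_d \<Otimes>\<^sub>M torus_1) h'"
    unfolding pair_torus_d_torus_1 by (rule integrable_density[symmetric]) auto
  finally show "integrable torus_measure h \<longleftrightarrow> integrable (torus_d \<Otimes>\<^sub>M torus_1) h'" .
qed

text \<open>Cutting f off outside the box makes it measurable on the whole space; real and imaginary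
  parts then get Borel versions separately.\<close>

lemma ex_borel_representative:
  fixes f :: "(real ^ 'd::finite) \<times> real \<Rightarrow> complex"
  assumes f: "f \<in> borel_measurable torus_measure"
  obtains F where "F \<in> borel_measurable borel" "AE z in lborel. z \<in> unit_box \<longrightarrow> f z = F z"
proof -
  have S: "unit_box \<inter> space lebesgue \<in> sets (lebesgue :: ((real ^ 'd) \<times> real) measure)"
    using unit_box_measurable by (auto intro: sets_completionI_sets)
  have m: "(\<lambda>z. indicator unit_box z *\<^sub>R f z) \<in> borel_measurable lebesgue"
    using f unfolding torus_measure_eq borel_measurable_restrict_space_iff[OF S] .
  have "(\<lambda>z. Re (indicator unit_box z *\<^sub>R f z)) \<in> borel_measurable lebesgue"
    using m by measurable
  then obtain g1 where g1: "g1 \<in> borel_measurable lborel" "AE z in lborel. Re (indicator unit_box z *\<^sub>R f z) = g1 z"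
    using completion_ex_borel_measurable_real by blast
  have "(\<lambda>z. Im (indicator unit_box z *\<^sub>R f z)) \<in> borel_measurable lebesgue"
    using m by measurable
  then obtain g2 where g2: "g2 \<in> borel_measurable lborel" "AE z in lborel. Im (indicator unit_box z *\<^sub>R f z) = g2 z"
    using completion_ex_borel_measurable_real by blast
  show thesis
  proof (rule that)
    have [measurable]: "g1 \<in> borel_measurable borel" "g2 \<in> borel_measurable borel" using g1 g2 by auto
    show "(\<lambda>z. complex_of_real (g1 z) + \<i> * complex_of_real (g2 z)) \<in> borel_measurable borel" by measurable
    show "AE z in lborel. z \<in> unit_box \<longrightarrow> f z = complex_of_real (g1 z) + \<i> * complex_of_real (g2 z)"
      using g1(2) g2(2) by eventually_elim (auto simp: complex_eq_iff)
  qed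
qed

theorem theorem1p1:
  fixes \<sigma> p d :: real
  assumes d_def: "d = real CARD('d::finite)"
    and "\<sigma> > 0"
    and "p > 4 * (d + 2) / d"
  shows "\<exists>C :: real. \<forall>N :: nat. N \<ge> 1 \<longrightarrow>
           (\<forall>f :: (real ^ 'd) \<times> real \<Rightarrow> complex. f \<in> Lq_torus (conj_exponent p) \<longrightarrow>
              (\<lambda>n :: int ^ 'd. exp (- (\<sigma> * of_int (sq_length n) / (real N)\<^sup>2))
                   * (norm (torus_fourier f n (sq_length n)))\<^sup>2) summable_on UNIV \<and>
              (\<Sum>\<^sub>\<infinity>n :: int ^ 'd. exp (- (\<sigma> * of_int (sq_length n) / (real N)\<^sup>2))
                   * (norm (torus_fourier f n (sq_length n)))\<^sup>2)
                \<le> C * real N powr (d - 2 * (d + 2) / p)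
                    * (Lq_norm_torus (conj_exponent p) f)\<^sup>2)"
proof -
  have d: "d > 0" by (simp add: d_def)
  have "4 * (d + 2) / d = 4 + 8 / d" using d by (simp add: field_simps)
  then have p8: "p > 4 + 8 / d" using assms(3) by simp
  then have p: "p > 2 + 8 / real CARD('d)" using d_def by simp
  have "8 / d > 0" using d by simp
  then have p2: "p > 2" using p8 by linarith
  define q where "q = p / (p - 1)"
  have q: "1 < q" "q < 2" using p2 by (auto simp: q_def field_simps)
  obtain C where C: "C > 0" "\<And>N (F :: (real ^ 'd) \<times> real \<Rightarrow> complex) L. N \<ge> 1 \<Longrightarrow> L > 0 \<Longrightarrow>
    F \<in> borel_measurable (torus_d \<Otimes>\<^sub>M torus_1) \<Longrightarrow> integrable (torus_d \<Otimes>\<^sub>M torus_1) (\<lambda>z. norm (F z) powr q) \<Longrightarrow>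
    (\<integral>z. norm (F z) powr q \<partial>(torus_d \<Otimes>\<^sub>M torus_1)) \<le> L \<Longrightarrow>
    (\<Sum>\<^sub>\<infinity>n. gauss_vec \<sigma> N n * (norm (st_fourier F n))\<^sup>2) \<le> C * real N powr (d - 2 * (d + 2) / p) * L powr (2 / q)"
    using core_estimate[OF assms(2) p] unfolding q_def d_def by blast
  show ?thesis
  proof (intro exI[of _ C] allI impI)
    fix N :: nat and f :: "(real ^ 'd) \<times> real \<Rightarrow> complex"
    assume N: "N \<ge> 1" and f: "f \<in> Lq_torus (conj_exponent p)"
    have fm: "f \<in> borel_measurable torus_measure" and fi: "integrable torus_measure (\<lambda>z. norm (f z) powr q)"
      using f by (auto simp: Lq_torus_def conj_exponent_def q_def)
    obtain F where F: "F \<in> borel_measurable borel" "AE z in lborel. z \<in> unit_box \<longrightarrow> f z = F z"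
      by (rule ex_borel_representative[OF fm])
    note F(1) [measurable]
    have TTs: "sets (torus_d \<Otimes>\<^sub>M torus_1 :: ((real ^ 'd) \<times> real) measure) = sets borel"
      unfolding pair_torus_d_torus_1 by simp
    have fcoeff [measurable]: "F \<in> borel_measurable (torus_d \<Otimes>\<^sub>M torus_1)" using F(1) by (simp add: measurable_cong_sets[OF TTs])
    have ae1: "AE z in lborel. z \<in> unit_box \<longrightarrow> norm (f z) powr q = norm (F z) powr q"
      using F(2) by eventually_elim auto
    have mf: "(\<lambda>z. norm (f z) powr q) \<in> borel_measurable torus_measure" using fi by auto
    have mF: "(\<lambda>z. norm (F z) powr q) \<in> borel_measurable borel" by measurable
    have Fi: "integrable (torus_d \<Otimes>\<^sub>M torus_1) (\<lambda>z. norm (F z) powr q)"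
      using fi unfolding torus_integral_eq(2)[OF mf mF ae1] .
    define \<Lambda> where "\<Lambda> = (\<integral>z. norm (F z) powr q \<partial>(torus_d \<Otimes>\<^sub>M torus_1))"
    have \<Lambda>0: "0 \<le> \<Lambda>" by (simp add: \<Lambda>_def)
    have "Lq_norm_torus (conj_exponent p) f = \<Lambda> powr (1 / q)"
      unfolding Lq_norm_torus_def conj_exponent_def q_def[symmetric] torus_integral_eq(1)[OF mf mF ae1] \<Lambda>_def ..
    then have nrm: "(Lq_norm_torus (conj_exponent p) f)\<^sup>2 = \<Lambda> powr (2 / q)"
      by (simp add: power2_eq_square powr_add[symmetric])
    have tf: "torus_fourier f n (sq_length n) = st_fourier F n" for n
    proof -
      have e: "exp (- (2 * of_real pi * \<i> * of_real y)) = echar (- y)" for y :: real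
        by (simp add: echar_def cis_conv_exp mult_ac)
      have cont: "(\<lambda>z. echar (- (int_vec n \<bullet> fst z + of_int (sq_length n) * snd z))) \<in> borel_measurable borel"
        unfolding echar_def by (intro borel_measurable_continuous_onI continuous_intros)
      then have "(\<lambda>z. echar (- (int_vec n \<bullet> fst z + of_int (sq_length n) * snd z))) \<in> borel_measurable torus_measure"
        unfolding torus_measure_eq by (intro measurable_restrict_space1 measurable_completion) simp
      then have m1: "(\<lambda>z. f z * echar (- (int_vec n \<bullet> fst z + of_int (sq_length n) * snd z))) \<in> borel_measurable torus_measure"
        using fm by (intro borel_measurable_times)
      have m2: "(\<lambda>z. F z * echar (- (int_vec n \<bullet> fst z + of_int (sq_length n) * snd z))) \<in> borel_measurable borel"
        by (rule borel_measurable_times[OF F(1) cont])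
      have ae2: "AE z in lborel. z \<in> unit_box \<longrightarrow> f z * echar (- (int_vec n \<bullet> fst z + of_int (sq_length n) * snd z)) =
          F z * echar (- (int_vec n \<bullet> fst z + of_int (sq_length n) * snd z))"
        using F(2) by eventually_elim auto
      show ?thesis
        unfolding torus_fourier_def st_fourier_def e by (rule torus_integral_eq(1)[OF m1 m2 ae2])
    qed
    interpret fm: finite_measure "torus_d \<Otimes>\<^sub>M torus_1 :: ((real ^ 'd) \<times> real) measure"
      by (intro finite_measure_pair_measure torus_d.finite_measure_axioms torus_1.finite_measure_axioms)
    have Fint: "integrable (torus_d \<Otimes>\<^sub>M torus_1) F" by (rule fm.integrable_of_integrable_powr[OF q(1) fcoeff Fi])
    have "(\<Sum>\<^sub>\<infinity>n. gauss_vec \<sigma> N n * (norm (st_fourier F n))\<^sup>2) \<le> C * real N powr (d - 2 * (d + 2) / p) * \<Lambda> powr (2 / q)"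
    \<comment> \<open>\<open>core_estimate\<close> takes L > 0. When \<Lambda> = 0, F vanishes
      almost everywhere and so do all its coefficients.\<close>
    proof (cases "\<Lambda> = 0")
      case True
      then have "AE z in torus_d \<Otimes>\<^sub>M torus_1. norm (F z) powr q = 0"
        unfolding \<Lambda>_def using integral_nonneg_eq_0_iff_AE[OF Fi] by simp
      then have "AE z in torus_d \<Otimes>\<^sub>M torus_1. F z * echar (- (int_vec n \<bullet> fst z + of_int (sq_length n) * snd z)) = 0" for n :: "int ^ 'd"
        by eventually_elim simp
      then have "st_fourier F n = 0" for n unfolding st_fourier_def by (rule integral_eq_zero_AE)
      then show ?thesis using C(1) by simp
    next
      case False
      then have "\<Lambda> > 0" using \<Lambda>0 by simp
      then show ?thesis by (rule C(2)[OF N _ fcoeff Fi]) (simp add: \<Lambda>_def)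
    qed
    then show "(\<lambda>n :: int ^ 'd. exp (- (\<sigma> * of_int (sq_length n) / (real N)\<^sup>2))
                   * (norm (torus_fourier f n (sq_length n)))\<^sup>2) summable_on UNIV \<and>
              (\<Sum>\<^sub>\<infinity>n :: int ^ 'd. exp (- (\<sigma> * of_int (sq_length n) / (real N)\<^sup>2))
                   * (norm (torus_fourier f n (sq_length n)))\<^sup>2)
                \<le> C * real N powr (d - 2 * (d + 2) / p)
                    * (Lq_norm_torus (conj_exponent p) f)\<^sup>2"
      using summable_weighted_fourier[OF Fint assms(2) N] unfolding nrm tf gauss_vec_def by blast
  qed
qed

end
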